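(* Let $k\ge2$, and let $\mathcal{H}$ be an affine hyperplane in $\mathbb{R}^k$ with normal vector $\boldsymbol{\alpha}=(1,\alpha_2,\ldots,\alpha_k)$, with coordinates ordered so that $\alpha_2,\ldots,\alpha_\ell$ are non-zero and $\alpha_{\ell+1}=\cdots=\alpha_k=0$; in particular $\alpha_2\cdots\alpha_\ell\ne0$. Assume $\omega:=\omega(\alpha_2,\ldots,\alpha_k)<\infty$. Let $\eta>0$ be sufficiently small in terms of $\boldsymbol{\alpha},\mathcal{B},r_1,\dots,r_{k-1}$, and let $\mu_\eta$ and its periodisation $\mu_\eta^*(\mathbf{x})=\sum_{\mathbf{m}\in\mathbb{Z}^k}\mu_\eta(\mathbf{x}+\mathbf{m})$ be as in the context. Let $\mathbf{y}\in\mathbb{R}^k$, let $b_1,\ldots,b_k:\mathbb{R}\to[0,1]$ be non-zero smooth bump functions supported on $[-2,2]$, and for $n\in\mathbb{N}$ and $d_1,\ldots,d_k\in(0,1/(2n)]$ define \[ A_n^*(\mathbf{x})=\sum_{\mathbf{a}\in\mathbb{Z}^k}\prod_{j=1}^k b_j\!\left(\frac{x_j-(a_j+y_j)/n}{d_j}\right). \] Assume that, for some fixed $\varpi>\omega$, $\max\{d_j:1\le j\le\ell\}\gg n^{-1-1/\varpi}$. Then \[ \int_{[0,1]^k}A_n^*(\mathbf{x})\mu_\eta^*(\mathbf{x})\,d\mathbf{x}=\lambda(A_n^* )\bigl(1+O(n^{1-k})\bigr), \] where $\lambda(A_n^* )=\int_{[0,1]^k}A_n^*(\mathbf{x})\,d\mathbf{x}$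 and the implied constant does not depend on $\eta$ (nor on $n$, $\mathbf{y}$, $d_1,\dots,d_k$).
   Context: The simultaneous exponent of $\mathbf{x}\in\mathbb{R}^d$ is $\omega(\mathbf{x})=\sup\{w:\max_i\|nx_i\|<n^{-w}\text{ for infinitely many }n\in\mathbb{N}\}$, where $\|\cdot\|$ is the distance to the nearest integer. Construction of $\mu_\eta$: fix a box $\mathcal{B}=[-B_1,B_1]\times\cdots\times[-B_{k-1},B_{k-1}]\subset\mathbb{R}^{k-1}$, small positive constants $r_1,\ldots,r_{k-1}$, and non-zero smooth bump functions $\beta_1,\ldots,\beta_k:\mathbb{R}\to[0,1]$ supported on $[-2,2]$. Let $\mu_\eta^\dagger$ be the probability density on $\mathbb{R}^k$ proportional to $(x',x_k)\mapsto(1_{\mathcal{B}}*g)(x')\,\beta_k(x_k/\eta)$, where $x'=(x_1,\ldots,x_{k-1})$ and $g(x')=\prod_{i<k}\beta_i(x_i/r_i)$ (equivalently, the normalised convolution of Lebesgue measure on $\{x_k=0\}\cap\mathcal{B}$ with $\prod_{i<k}\beta_i(x_i/r_i)\beta_k(x_k/\eta)$). Then $\mu_\eta$ is obtained from $\mu_\eta^\dagger$ by a fixed rotation of $\mathbb{R}^k$ taking $\{x_k=0\}$ to the hyperplane through the origin parallel to $\mathcal{H}$ (so that the $x_k$-direction is mapped to the direction $\boldsymbol{\alpha}$), followed by a fixed translation moving this hyperplane onto $\mathcal{H}$. Implied constants may depend on $\boldsymbol{\alpha},\mathcal{B},r_1,\ldots,r_{k-1}$, $\varpi$ and the bump functions.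 *)

theory Defs
  imports "HOL-Analysis.Analysis"
begin

text \<open>
  The coordinates \<open>1, \<dots>, k\<close> of \<open>\<real>\<^sup>k\<close> are the elements of a finite linearly ordered
  index type \<open>'k\<close>, in increasing order.  The class \<open>wellorder\<close> costs no generality: every
  finite linear order is a well-order.
\<close>

definition first_ix :: "'k::{finite,wellorder}"
  where "first_ix = Min UNIV"

definition last_ix :: "'k::{finite,wellorder}"
  where "last_ix = Max UNIV"

definition dist_nearest_int :: "real \<Rightarrow> real"
  where "dist_nearest_int x = infdist x \<int>"

text \<open>
  The coordinates of the point are indexed by the finite nonempty set \<open>I\<close>; the value lies in the
  extended reals, so that it may be infinite.
\<close>

definition simultaneous_exponent :: "'i set \<Rightarrow> ('i \<Rightarrow> real) \<Rightarrow> ereal"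
  where "simultaneous_exponent I x =
    Sup (ereal ` {w. infinite {n::nat. 0 < n \<and>
      Max ((\<lambda>i. dist_nearest_int (real n * x i)) ` I) < real n powr (- w)}})"

definition smooth :: "(real \<Rightarrow> real) \<Rightarrow> bool"
  where "smooth f \<longleftrightarrow> (\<forall>m x. ((deriv ^^ m) f) differentiable (at x))"

definition bump_function :: "(real \<Rightarrow> real) \<Rightarrow> bool"
  where "bump_function f \<longleftrightarrow>
    smooth f \<and> range f \<subseteq> {0..1} \<and> closure {x. f x \<noteq> 0} \<subseteq> {-2..2} \<and> (\<exists>x. f x \<noteq> 0)"

text \<open>
  Points of \<open>\<real>\<^sup>k\<^sup>-\<^sup>1\<close> are the extensional functions on \<open>{..<last_ix}\<close>, with Lebesgue measure the
  product measure; only the values of \<open>B\<close> and \<open>r\<close> below \<open>last_ix\<close> matter.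
\<close>

definition base_convolution ::
    "('k::{finite,wellorder} \<Rightarrow> real) \<Rightarrow> ('k \<Rightarrow> real) \<Rightarrow> ('k \<Rightarrow> real \<Rightarrow> real) \<Rightarrow> ('k \<Rightarrow> real) \<Rightarrow> real"
  where "base_convolution B r \<beta> x' =
    (LINT u | Pi\<^sub>M {..<last_ix} (\<lambda>_. lborel).
      indicator (PiE {..<last_ix} (\<lambda>i. {- B i .. B i})) u *
      (\<Prod>i<last_ix. \<beta> i ((x' i - u i) / r i)))"

definition mu_dagger_raw ::
    "('k::{finite,wellorder} \<Rightarrow> real) \<Rightarrow> ('k \<Rightarrow> real) \<Rightarrow> ('k \<Rightarrow> real \<Rightarrow> real) \<Rightarrow> real \<Rightarrow> real^'k::_ \<Rightarrow> real"
  where "mu_dagger_raw B r \<beta> \<eta> x =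
    base_convolution B r \<beta> (\<lambda>i. x $ i) * \<beta> last_ix (x $ last_ix / \<eta>)"

definition mu_dagger ::
    "('k::{finite,wellorder} \<Rightarrow> real) \<Rightarrow> ('k \<Rightarrow> real) \<Rightarrow> ('k \<Rightarrow> real \<Rightarrow> real) \<Rightarrow> real \<Rightarrow> real^'k::_ \<Rightarrow> real"
  where "mu_dagger B r \<beta> \<eta> x =
    mu_dagger_raw B r \<beta> \<eta> x / (LINT z | lborel. mu_dagger_raw B r \<beta> \<eta> z)"

text \<open>The density of the image of \<open>mu_dagger\<close> under the rigid motion \<open>\<lambda>z. R *v z + t\<close>.\<close>

definition mu ::
    "('k::{finite,wellorder} \<Rightarrow> real) \<Rightarrow> ('k \<Rightarrow> real) \<Rightarrow> ('k \<Rightarrow> real \<Rightarrow> real)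
      \<Rightarrow> real^'k::_^'k::_ \<Rightarrow> real^'k::_ \<Rightarrow> real \<Rightarrow> real^'k::_ \<Rightarrow> real"
  where "mu B r \<beta> R t \<eta> x = mu_dagger B r \<beta> \<eta> (matrix_inv R *v (x - t))"

text \<open>
  \<open>int^'k\<close> plays the role of \<open>\<int>\<^sup>k\<close>.  In this and the next sum only finitely many terms are nonzero
  for the compactly supported functions at hand.
\<close>

definition periodisation :: "(real^'k \<Rightarrow> real) \<Rightarrow> real^'k \<Rightarrow> real"
  where "periodisation f x =
    (\<Sum>\<^sub>\<infinity> m \<in> (UNIV :: (int^'k) set). f (x + (\<chi> i. of_int (m $ i))))"

definition A_star ::
    "('k::finite \<Rightarrow> real \<Rightarrow> real) \<Rightarrow> real^'k \<Rightarrow> ('k \<Rightarrow> real) \<Rightarrow> nat \<Rightarrow> real^'k \<Rightarrow> real"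
  where "A_star b y d n x =
    (\<Sum>\<^sub>\<infinity> a \<in> (UNIV :: (int^'k) set).
      \<Prod>j\<in>UNIV. b j ((x $ j - (of_int (a $ j) + y $ j) / real n) / d j))"

end

theory Submission
  imports Defs
begin

text \<open>
  Periodicity unfolds the integral against the periodisation to the integral of
  \<open>A_star b y d n\<close> against \<open>mu\<close> over the whole space.  Poisson summation in each coordinate expands
  \<open>A_star b y d n\<close> in the characters of frequency \<open>n *\<^sub>R m\<close> with \<open>m\<close> an integer vector; the term
  \<open>m = 0\<close> is the main term, and the others involve the Fourier transform of \<open>mu\<close> at \<open>n *\<^sub>R m\<close>.  This
  transform decays, uniformly in \<open>\<eta>\<close>, with the distance \<open>n * L\<close> of \<open>n *\<^sub>R m\<close> from the line spanned
  by \<open>\<alpha>\<close>, since \<open>mu\<close> is smooth on a fixed scale along the hyperplane.  If \<open>m\<close> is close to that line, then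
  the finite exponent of \<open>\<alpha>\<close> forces \<open>m\<close> to be large, and so are its first coordinates up to \<open>l\<close>, because
  those coordinates of \<open>\<alpha>\<close> are nonzero; the lower bound on the largest \<open>d j\<close> then makes the coefficient
  of \<open>A_star b y d n\<close> small.  Either way each term with \<open>m \<noteq> 0\<close> is smaller than the main term by any
  power of \<open>n\<close> and of the size of \<open>m\<close>.
\<close>

section \<open>Fourier transforms of test functions\<close>

text \<open>The hypotheses meet at one scale. As long as the first coordinate of \<open>m\<close>
  stays below about \<open>n powr (1 / \<omega>')\<close>, the Diophantine bound with an exponent
  \<open>w < \<omega>'\<close> keeps the deviation \<open>L\<close> from the line above about
  \<open>n powr (- w / \<omega>')\<close>, so \<open>n * L\<close> is at least a positive power of
  \<open>n\<close>. Beyond that scale a small \<open>L\<close> forces every coordinate up to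
  \<open>l\<close> to be comparably large, and the lower bound on the largest \<open>d j\<close>
  makes \<open>n * d j * \<bar>m $ j\<bar>\<close> take over. Rather than separating the ranges, the
  estimate is made for the product of the two decay quantities. A second obstacle is summation over
  \<open>m\<close>: all other \<open>n * d i\<close> may be arbitrarily small, so the coefficients
  alone are not summable uniformly in \<open>d\<close>. But \<open>L\<close> and the first
  coordinate together bound every coordinate of \<open>m\<close>, so a power of the same product
  also pays for convergence. Uniformity in \<eta> comes from the product form of the density: the
  single factor that contains \<eta> is bounded by its integral, and decay is taken from one of the
  other factors.\<close>

lemma integrable_continuous_bounded_support:
  fixes f :: "'a::euclidean_space \<Rightarrow> 'b::{banach, second_countable_topology}"
  assumes "continuous_on UNIV f" and "\<And>x. norm x > R \<Longrightarrow> f x = 0"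
  shows "integrable lborel f"
proof -
  have "integrable lborel (\<lambda>x. indicator (cball 0 R) x *\<^sub>R f x)"
    by (rule borel_integrable_compact) (auto intro: continuous_on_subset[OF assms(1)])
  also have "(\<lambda>x. indicator (cball 0 R) x *\<^sub>R f x) = f"
    using assms(2) by (auto simp: fun_eq_iff indicator_def not_le)
  finally show ?thesis .
qed

definition fourier_transform :: "(real \<Rightarrow> real) \<Rightarrow> real \<Rightarrow> complex"
  where "fourier_transform f \<xi> = (LINT x|lborel. of_real (f x) * cis (- (2 * pi * \<xi> * x)))"

text \<open>A weakening of \<open>bump_function\<close> that is closed under \<open>deriv\<close>
  (the derivative of a bump takes negative values), so that decay of the transform can be proved by
  induction.\<close>

definition test_function :: "(real \<Rightarrow> real) \<Rightarrow> bool"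
  where "test_function f \<longleftrightarrow> smooth f \<and> (\<forall>x. 2 < \<bar>x\<bar> \<longrightarrow> f x = 0)"

lemma test_function_has_deriv:
  assumes "test_function f"
  shows "(f has_real_derivative deriv f x) (at x)"
proof -
  have "((deriv ^^ 0) f) differentiable (at x)"
    using assms unfolding test_function_def smooth_def by blast
  then show ?thesis by (simp add: DERIV_deriv_iff_real_differentiable)
qed

lemma test_function_continuous:
  assumes "test_function f"
  shows "continuous_on A f"
  using test_function_has_deriv[OF assms] DERIV_isCont
  by (metis continuous_at_imp_continuous_on)

lemma test_function_deriv:
  assumes "test_function f"
  shows "test_function (deriv f)"
  unfolding test_function_def
proof (intro conjI allI impI)
  show "smooth (deriv f)"
    unfolding smooth_def
  proof (intro allI)
    fix m x
    have "((deriv ^^ (Suc m)) f) differentiable (at x)"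
      using assms unfolding test_function_def smooth_def by blast
    then show "((deriv ^^ m) (deriv f)) differentiable (at x)"
      by (simp only: funpow_Suc_right o_def)
  qed
  fix x :: real assume x: "2 < \<bar>x\<bar>"
  have "open {x::real. 2 < \<bar>x\<bar>}"
    by (intro open_Collect_less continuous_intros)
  then have "((\<lambda>_. 0) has_real_derivative deriv f x) (at x)"
    using has_field_derivative_transform_within_open[OF test_function_has_deriv[OF assms, of x], of "{x. 2 < \<bar>x\<bar>}" "\<lambda>_. 0"]
      assms x unfolding test_function_def by auto
  then show "deriv f x = 0"
    using DERIV_unique DERIV_const by blast
qed

lemma test_function_integrable:
  assumes "test_function f"
  shows "integrable lborel f"
    and "integrable lborel (\<lambda>x. complex_of_real (f x) * cis (- (a * x)))"
  using assms
  by (auto intro!: integrable_continuous_bounded_support[where R = 2] continuous_intros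
      test_function_continuous[OF assms] simp: test_function_def)

text \<open>Integration by parts: \<open>F'\<close> is the derivative of the product
  \<open>F\<close> of \<open>f\<close> with the character, and \<open>F\<close> vanishes at both
  ends of \<open>{-3 .. 3}\<close>, which contains the support in its interior.\<close>

lemma fourier_transform_deriv:
  assumes f: "test_function f"
  shows "fourier_transform (deriv f) \<xi> = 2 * pi * \<i> * \<xi> * fourier_transform f \<xi>"
proof -
  define F where "F = (\<lambda>x. complex_of_real (f x) * cis (- (2 * pi * \<xi> * x)))"
  define F' where "F' = (\<lambda>x. complex_of_real (deriv f x) * cis (- (2 * pi * \<xi> * x))
      - 2 * pi * \<i> * \<xi> * (complex_of_real (f x) * cis (- (2 * pi * \<xi> * x))))"
  note int = test_function_integrable(2)[OF f, of "2 * pi * \<xi>"]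
    test_function_integrable(2)[OF test_function_deriv[OF f], of "2 * pi * \<xi>"]
  have deriv: "(F has_vector_derivative F' x) (at x within A)" for x A
  proof -
    define c where "c = - (2 * pi * \<i> * \<xi>)"
    have cis: "cis (- (2 * pi * \<xi> * x)) = exp (c * of_real x)" for x
      by (simp add: cis_conv_exp c_def algebra_simps)
    have "((\<lambda>z. exp (c * z)) has_field_derivative exp (c * of_real x) * c) (at (of_real x))"
      by (auto intro!: derivative_eq_intros)
    then have "((\<lambda>x. exp (c * of_real x)) has_vector_derivative exp (c * of_real x) * c) (at x within A)"
      by (rule has_vector_derivative_real_field)
    moreover have "((\<lambda>x. complex_of_real (f x)) has_vector_derivative of_real (deriv f x)) (at x within A)"
      using test_function_has_deriv[OF f] has_field_derivative_at_within
        has_real_derivative_iff_has_vector_derivative has_vector_derivative_of_real by blast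
    ultimately have "(F has_vector_derivative of_real (f x) * (exp (c * of_real x) * c)
        + of_real (deriv f x) * exp (c * of_real x)) (at x within A)"
      unfolding F_def cis by (rule has_vector_derivative_mult[rotated])
    then show ?thesis
      unfolding F'_def cis by (simp add: c_def algebra_simps)
  qed
  have zero: "f x = 0" "deriv f x = 0" if "\<bar>x\<bar> > 2" for x
    using f test_function_deriv[OF f] that by (auto simp: test_function_def)
  have "integral\<^sup>L lborel F' = integral\<^sup>L lborel (\<lambda>x. indicator {-3 .. 3} x *\<^sub>R F' x)"
    by (rule Bochner_Integration.integral_cong) (auto simp: F'_def indicator_def zero)
  also have "\<dots> = F 3 - F (-3)"
    by (rule integral_FTC_atLeastAtMost)
      (auto intro!: deriv, auto simp: F'_def intro!: continuous_intros test_function_continuous[OF f] test_function_continuous[OF test_function_deriv[OF f]])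
  also have "\<dots> = 0" by (simp add: F_def zero)
  finally have "integral\<^sup>L lborel F' = 0" .
  then show ?thesis
    using int by (simp add: F'_def fourier_transform_def mult.assoc)
qed

lemma fourier_transform_norm_le:
  "test_function f \<Longrightarrow> norm (fourier_transform f \<xi>) \<le> (LINT x|lborel. \<bar>f x\<bar>)"
  unfolding fourier_transform_def
  by (rule order.trans[OF integral_norm_bound]) (simp add: norm_mult)

text \<open>Each derivative buys one power of \<xi>. The induction keeps \<open>f\<close> arbitrary
  because its step passes to \<open>deriv f\<close>.\<close>

lemma fourier_transform_power_decay:
  assumes "test_function f"
  shows "\<exists>C. \<forall>\<xi>. \<bar>\<xi>\<bar> ^ M * norm (fourier_transform f \<xi>) \<le> C"
  using assms
proof (induction M arbitrary: f)
  case 0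
  then show ?case using fourier_transform_norm_le by auto
next
  case (Suc M)
  obtain C where C: "\<bar>\<xi>\<bar> ^ M * norm (fourier_transform (deriv f) \<xi>) \<le> C" for \<xi>
    using Suc.IH[OF test_function_deriv[OF Suc.prems]] by blast
  have "\<bar>\<xi>\<bar> ^ Suc M * norm (fourier_transform f \<xi>) \<le> C / (2 * pi)" for \<xi>
    using C[of \<xi>] by (simp add: fourier_transform_deriv[OF Suc.prems] norm_mult field_simps)
  then show ?case by blast
qed

text \<open>Combines the trivial bound with the power decay through
  \<open>1 + t \<le> 2 * max 1 t\<close>. The denominator never vanishes, so one bound serves all
  frequencies, zero included.\<close>

lemma fourier_transform_decay:
  assumes "test_function f"
  obtains C where "\<And>\<xi>. norm (fourier_transform f \<xi>) \<le> C / (1 + \<bar>\<xi>\<bar>) ^ M"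
proof -
  obtain C0 where C0: "norm (fourier_transform f \<xi>) \<le> C0" for \<xi>
    using fourier_transform_norm_le[OF assms] by blast
  obtain C1 where C1: "\<bar>\<xi>\<bar> ^ M * norm (fourier_transform f \<xi>) \<le> C1" for \<xi>
    using fourier_transform_power_decay[OF assms] by blast
  have "norm (fourier_transform f \<xi>) \<le> 2 ^ M * (max 0 C0 + max 0 C1) / (1 + \<bar>\<xi>\<bar>) ^ M" for \<xi>
  proof -
    have "(1 + \<bar>\<xi>\<bar>) ^ M \<le> (2 * max 1 \<bar>\<xi>\<bar>) ^ M"
      by (rule power_mono) auto
    also have "\<dots> \<le> 2 ^ M * (1 + \<bar>\<xi>\<bar> ^ M)"
      by (cases "\<bar>\<xi>\<bar> \<le> 1") (auto simp: power_mult_distrib max_def)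
    finally have "(1 + \<bar>\<xi>\<bar>) ^ M * norm (fourier_transform f \<xi>)
        \<le> 2 ^ M * (1 + \<bar>\<xi>\<bar> ^ M) * norm (fourier_transform f \<xi>)"
      by (rule mult_right_mono) simp
    also have "\<dots> \<le> 2 ^ M * (max 0 C0 + max 0 C1)"
      using C0[of \<xi>] C1[of \<xi>] by (auto simp: algebra_simps intro!: add_mono)
    finally show ?thesis by (simp add: field_simps add_pos_nonneg)
  qed
  then show ?thesis by (rule that)
qed

lemma bump_function_test_function: "test_function f" if "bump_function f"
  using that closure_subset[of "{x. f x \<noteq> 0}"]
  unfolding bump_function_def test_function_def by fastforce

lemma bump_function_range: "0 \<le> f x" "f x \<le> 1" if "bump_function f"
  using that unfolding bump_function_def by (auto simp: image_subset_iff)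

text \<open>A nonnegative function with zero integral vanishes almost everywhere, whereas the set
  where the continuous \<open>f\<close> is nonzero is open and contains a box of positive measure.
  Positivity allows division by the main term and the normalisation of \<open>mu\<close>.\<close>

lemma bump_function_integral_pos:
  assumes "bump_function f"
  shows "0 < (LINT x|lborel. f x)"
proof -
  note t = bump_function_test_function[OF assms]
  obtain x where x: "f x \<noteq> 0" using assms unfolding bump_function_def by blast
  have "\<not> (AE x in lborel. f x = 0)"
  proof
    assume ae: "AE x in lborel. f x = 0"
    have op: "open {x. f x \<noteq> 0}"
      by (intro open_Collect_neq test_function_continuous t continuous_intros)
    then obtain a b where ab: "x \<in> box a b" "box a b \<subseteq> {x. f x \<noteq> 0}"
      using x open_contains_box by (metis mem_Collect_eq open_contains_box)
    have "AE x in lborel. x \<notin> {x. f x \<noteq> 0}" using ae by simp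
    then have "emeasure lborel {x. f x \<noteq> 0} = 0"
      by (subst (asm) AE_iff_measurable[OF _ refl]) (use op in auto)
    then have "emeasure lborel (box a b) = 0"
      using ab(2) op emeasure_mono[of "box a b" "{x. f x \<noteq> 0}" lborel] by (auto simp: borel_open)
    then show False using ab(1) by (simp add: emeasure_lborel_box_eq split: if_splits)
  qed
  then have "(LINT x|lborel. f x) \<noteq> 0"
    using integral_nonneg_eq_0_iff_AE[OF test_function_integrable(1)[OF t]] bump_function_range[OF assms] by auto
  moreover have "0 \<le> (LINT x|lborel. f x)"
    using bump_function_range[OF assms] by (intro Bochner_Integration.integral_nonneg) auto
  ultimately show ?thesis by simp
qed

lemma fourier_transform_0: "fourier_transform f 0 = of_real (LINT x|lborel. f x)"
  by (simp add: fourier_transform_def)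

section \<open>Fourier series of periodic functions\<close>

definition fourier_coeff :: "(real \<Rightarrow> complex) \<Rightarrow> int \<Rightarrow> complex"
  where "fourier_coeff g m = integral {0..1} (\<lambda>t. g t * cis (- (2 * pi * m * t)))"

lemma periodic_of_int:
  fixes g :: "real \<Rightarrow> 'a"
  assumes "\<And>t. g (t + 1) = g t"
  shows "g (t + of_int m) = g t"
proof -
  have nat: "g (t + real n) = g t" for n t
  proof (induction n)
    case (Suc n)
    then show ?case using assms[of "t + real n"] by (simp add: algebra_simps)
  qed simp
  show ?thesis
  proof (cases "0 \<le> m")
    case True
    then show ?thesis using nat[of t "nat m"] by simp
  next
    case False
    then show ?thesis using nat[of "t + of_int m" "nat (- m)"] by simp
  qed
qed

lemma cis_2pi_int: "cis (2 * pi * of_int m) = 1" "cis (- (2 * pi * of_int m)) = 1"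
  using cis_multiple_2pi[of "of_int m"] cis_multiple_2pi[of "- of_int m"] by (auto simp: mult_ac)

text \<open>The part of the shifted interval that lies beyond 1 is moved back by one period.\<close>

lemma integral_periodic_shift:
  fixes h :: "real \<Rightarrow> complex"
  assumes cont: "continuous_on UNIV h" and per: "\<And>t. h (t + 1) = h t" and s: "0 \<le> s" "s \<le> 1"
  shows "integral {0..1} (\<lambda>t. h (t + s)) = integral {0..1} h"
proof -
  have int: "h integrable_on {a..b}" for a b
    by (intro integrable_continuous_real continuous_on_subset[OF cont]) auto
  have "integral {0..1} (\<lambda>t. h (t + s)) = integral {s..1 + s} h"
    using integral_shift[of 0 s 1 h] continuous_on_subset[OF cont] by (simp add: o_def)
  also have "\<dots> = integral {s..1} h + integral {1..1 + s} h"
    by (rule Henstock_Kurzweil_Integration.integral_combine[symmetric]) (use s int in auto)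
  also have "integral {1..1 + s} h = integral {0..s} (\<lambda>t. h (t + 1))"
    using integral_shift[of 0 1 s h] continuous_on_subset[OF cont] by (simp add: o_def add.commute)
  also have "\<dots> = integral {0..s} h" by (simp add: per)
  also have "integral {s..1} h + integral {0..s} h = integral {0..1} h"
    using Henstock_Kurzweil_Integration.integral_combine[of 0 s 1 h] s int by (simp add: add.commute)
  finally show ?thesis .
qed

text \<open>Shifting by half a period of the character flips its sign, so the coefficient is governed by
  the modulus of continuity.\<close>
lemma riemann_lebesgue_periodic:
  fixes g :: "real \<Rightarrow> complex"
  assumes cont: "continuous_on UNIV g" and per: "\<And>t. g (t + 1) = g t" and "0 < \<epsilon>"
  shows "\<exists>N. \<forall>m. N \<le> \<bar>m\<bar> \<longrightarrow> norm (fourier_coeff g m) \<le> \<epsilon>"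
proof -
  \<comment> \<open>The interval reaches up to 2 so that it contains both \<open>t\<close> in
    \<open>{0..1}\<close> and \<open>t + s\<close> with \<open>s \<le> 1\<close>.\<close>
  have "uniformly_continuous_on {0..2} g"
    by (intro compact_uniformly_continuous continuous_on_subset[OF cont]) auto
  then obtain \<delta> where \<delta>: "\<delta> > 0"
    "\<And>x y. x \<in> {0..2} \<Longrightarrow> y \<in> {0..2} \<Longrightarrow> dist y x < \<delta> \<Longrightarrow> dist (g y) (g x) < \<epsilon>"
    unfolding uniformly_continuous_on_def using \<open>0 < \<epsilon>\<close> by metis
  define N where "N = max 1 (\<lceil>1 / \<delta>\<rceil>)"
  have "norm (fourier_coeff g m) \<le> \<epsilon>" if m: "N \<le> \<bar>m\<bar>" for m
  proof -
    \<comment> \<open>Half a period of the character of frequency \<open>m\<close>; the choice of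
      \<open>N\<close> makes it smaller than \<delta>.\<close>
    define s where "s = 1 / (2 * \<bar>real_of_int m\<bar>)"
    have m1: "1 \<le> \<bar>real_of_int m\<bar>" using m unfolding N_def by linarith
    have "1 / \<delta> \<le> \<bar>real_of_int m\<bar>"
      using m unfolding N_def by linarith
    then have "1 / \<bar>real_of_int m\<bar> \<le> \<delta>" using \<delta>(1) m1 by (simp add: field_simps)
    then have s: "0 < s" "s \<le> 1" "s < \<delta>"
      using m1 \<delta>(1) unfolding s_def by (auto simp: field_simps)
    have half: "cis (- (2 * pi * m * (t + s))) = - cis (- (2 * pi * m * t))" for t
    proof -
      have "2 * pi * m * s = pi \<or> 2 * pi * m * s = - pi"
        using m1 by (cases "m > 0") (auto simp: s_def field_simps)
      then have "cis (- (2 * pi * m * s)) = - 1"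
        by (elim disjE) (simp_all only: minus_minus cis_pi, simp add: complex_eq_iff)
      moreover have "cis (- (2 * pi * m * (t + s))) = cis (- (2 * pi * m * t)) * cis (- (2 * pi * m * s))"
        by (simp add: cis_mult algebra_simps)
      ultimately show ?thesis by simp
    qed
    have per': "cis (- (2 * pi * m * (t + 1))) = cis (- (2 * pi * m * t))" for t
    proof -
      have "cis (- (2 * pi * m * (t + 1))) = cis (- (2 * pi * m * t)) * cis (- (2 * pi * m))"
        by (simp add: cis_mult algebra_simps)
      then show ?thesis by (simp add: cis_2pi_int)
    qed
    have cont': "continuous_on A (\<lambda>t. g t * cis (- (2 * pi * m * t)))" for A
      by (intro continuous_intros continuous_on_subset[OF cont]) auto
    have cont'': "continuous_on A (\<lambda>t. g (t + s) * cis (- (2 * pi * m * t)))" for A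
      by (intro continuous_intros continuous_on_compose2[OF cont]) auto
    have "fourier_coeff g m = integral {0..1} (\<lambda>t. g (t + s) * cis (- (2 * pi * m * (t + s))))"
      unfolding fourier_coeff_def
      using integral_periodic_shift[of "\<lambda>t. g t * cis (- (2 * pi * m * t))" s] s cont' per per'
      by simp
    also have "\<dots> = - integral {0..1} (\<lambda>t. g (t + s) * cis (- (2 * pi * m * t)))"
      unfolding half by simp
    \<comment> \<open>Adding the original and the shifted expression of the coefficient leaves the
      difference \<open>g t - g (t + s)\<close> under the integral.\<close>
    finally have "2 * fourier_coeff g m = fourier_coeff g m - integral {0..1} (\<lambda>t. g (t + s) * cis (- (2 * pi * m * t)))"
      by simp
    also have "\<dots> = integral {0..1} (\<lambda>t. g t * cis (- (2 * pi * m * t)) - g (t + s) * cis (- (2 * pi * m * t)))"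
      unfolding fourier_coeff_def
      by (intro Henstock_Kurzweil_Integration.integral_diff[symmetric] integrable_continuous_real cont' cont'')
    also have "norm \<dots> \<le> \<epsilon> * (1 - 0)"
    proof (rule integral_bound)
      fix t :: real assume t: "t \<in> {0..1}"
      have "norm (g t * cis (- (2 * pi * m * t)) - g (t + s) * cis (- (2 * pi * m * t))) = norm (g t - g (t + s))"
        by (simp add: norm_mult flip: left_diff_distrib)
      also have "\<dots> \<le> \<epsilon>"
        using \<delta>(2)[of "t + s" t] t s by (auto simp: dist_norm)
      finally show "norm (g t * cis (- (2 * pi * m * t)) - g (t + s) * cis (- (2 * pi * m * t))) \<le> \<epsilon>" .
    qed (auto intro!: continuous_on_diff cont' cont'')
    finally have "2 * norm (fourier_coeff g m) \<le> \<epsilon>" by (simp add: norm_mult)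
    then show ?thesis using norm_ge_zero[of "fourier_coeff g m"] by linarith
  qed
  then show ?thesis by blast
qed

lemma cis_2pi_eq_1_iff: "cis (2 * pi * t) = 1 \<longleftrightarrow> t \<in> \<int>"
proof
  assume "cis (2 * pi * t) = 1"
  then have "cos (2 * pi * t) = 1" by (simp add: complex_eq_iff)
  then obtain n where "2 * pi * t = of_int n * 2 * pi"
    using cos_one_2pi_int by blast
  then have "t = of_int n" by (simp add: field_simps)
  then show "t \<in> \<int>" by simp
next
  assume "t \<in> \<int>"
  then show "cis (2 * pi * t) = 1" using cis_2pi_int(1) by (auto elim!: Ints_cases)
qed

lemma has_vector_derivative_imp_quotient_tendsto:
  fixes f :: "real \<Rightarrow> 'a::real_normed_vector"
  assumes "(f has_vector_derivative D) (at 0)"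
  shows "((\<lambda>t. (f t - f 0) /\<^sub>R t) \<longlongrightarrow> D) (at 0)"
proof -
  have "((\<lambda>h. norm (f (0 + h) - f 0 - h *\<^sub>R D) / norm h) \<longlongrightarrow> 0) (at 0)"
    using assms unfolding has_vector_derivative_def has_derivative_at by blast
  moreover have "eventually (\<lambda>h. norm (f (0 + h) - f 0 - h *\<^sub>R D) / norm h = norm ((f h - f 0) /\<^sub>R h - D)) (at 0)"
    using eventually_neq_at_within[of 0]
  proof eventually_elim
    case (elim h)
    then have "(f h - f 0) /\<^sub>R h - D = (f (0 + h) - f 0 - h *\<^sub>R D) /\<^sub>R h"
      by (simp add: scaleR_diff_right)
    then show ?case by (simp add: divide_inverse_commute)
  qed
  ultimately have "((\<lambda>h. norm ((f h - f 0) /\<^sub>R h - D)) \<longlongrightarrow> 0) (at 0)"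
    by (rule Lim_transform_eventually)
  then show ?thesis
    using tendsto_norm_zero_iff Lim_null by blast
qed

text \<open>Chernoff's trick: dividing by \<open>cis (2 * pi * t) - 1\<close> makes the series telescope.\<close>
lemma fourier_series_at_zero:
  fixes G :: "real \<Rightarrow> complex"
  assumes cont: "continuous_on UNIV G" and per: "\<And>t. G (t + 1) = G t"
    and G0: "G 0 = 0" and D: "(G has_vector_derivative D) (at 0)"
    and sum: "(fourier_coeff G has_sum S) UNIV"
  shows "S = 0"
proof -
  \<comment> \<open>At the integers \<open>q\<close> is given the limit of the quotient: the
    derivative \<open>D\<close> of \<open>G\<close> over the derivative of
    \<open>cis (2 * pi * t)\<close> at 0. Differentiability of \<open>G\<close> at 0 thus makes
    \<open>q\<close> continuous.\<close>
  define q where "q t = (if t \<in> \<int> then D / (2 * pi * \<i>) else G t / (cis (2 * pi * t) - 1))" for t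
  have Ints_shift: "t + 1 \<in> \<int> \<longleftrightarrow> t \<in> \<int>" for t :: real
    using Ints_add[of t 1] Ints_diff[of "t + 1" 1] by auto
  have q_per: "q (t + 1) = q t" for t
  proof -
    have "cis (2 * pi * (t + 1)) = cis (2 * pi * t) * cis (2 * pi)"
      by (simp add: cis_mult algebra_simps)
    then show ?thesis by (simp add: q_def Ints_shift per)
  qed
  have G_int: "G t = 0" if "t \<in> \<int>" for t
    using that periodic_of_int[of G 0, OF per] G0 by (auto elim!: Ints_cases)
  have G_q: "G t = (cis (2 * pi * t) - 1) * q t" for t
    using cis_2pi_eq_1_iff[of t] G_int[of t] by (auto simp: q_def)
  have q_cont0: "(q \<longlongrightarrow> q 0) (at 0)"
  proof -
    have "((\<lambda>t. exp (2 * pi * \<i> * of_real t)) has_vector_derivative (exp (2 * pi * \<i> * of_real 0) * (2 * pi * \<i>))) (at 0 within UNIV)"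
      by (rule has_vector_derivative_real_field) (auto intro!: derivative_eq_intros)
    then have "((\<lambda>t. cis (2 * pi * t)) has_vector_derivative (2 * pi * \<i>)) (at 0)"
      by (simp add: cis_conv_exp mult_ac)
    then have "((\<lambda>t. (cis (2 * pi * t) - 1) /\<^sub>R t) \<longlongrightarrow> 2 * pi * \<i>) (at 0)"
      using has_vector_derivative_imp_quotient_tendsto by fastforce
    moreover have "((\<lambda>t. G t /\<^sub>R t) \<longlongrightarrow> D) (at 0)"
      using has_vector_derivative_imp_quotient_tendsto[OF D] G0 by simp
    ultimately have "((\<lambda>t. (G t /\<^sub>R t) / ((cis (2 * pi * t) - 1) /\<^sub>R t)) \<longlongrightarrow> D / (2 * pi * \<i>)) (at 0)"
      by (intro tendsto_divide) auto
    moreover have "eventually (\<lambda>t. (G t /\<^sub>R t) / ((cis (2 * pi * t) - 1) /\<^sub>R t) = q t) (at 0)"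
    proof -
      have "eventually (\<lambda>t::real. t \<in> {-1<..<1} - {0}) (at 0)"
        by (rule eventually_at_in_open) auto
      then show ?thesis
      proof eventually_elim
        case (elim t)
        then have "t \<notin> \<int>" by (auto elim!: Ints_cases)
        then show ?case using elim by (simp add: q_def scaleR_conv_of_real divide_simps)
      qed
    qed
    ultimately show ?thesis
      by (simp add: q_def Lim_transform_eventually)
  qed
  have q_isCont: "isCont q t" for t
  proof (cases "t \<in> \<int>")
    case True
    then obtain m where m: "t = of_int m" by (auto elim: Ints_cases)
    have "isCont (q \<circ> (\<lambda>u. u - of_int m)) t"
      by (intro continuous_at_compose continuous_intros) (use q_cont0 m in \<open>simp add: isCont_def\<close>)
    moreover have "q \<circ> (\<lambda>u. u - of_int m) = q"
      using periodic_of_int[of q _ "- m", OF q_per] by (auto simp: fun_eq_iff)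
    ultimately show ?thesis by simp
  next
    case False
    have "open (- \<int> :: real set)" by (simp add: open_Compl)
    moreover have "continuous_on (- \<int>) (\<lambda>t. G t / (cis (2 * pi * t) - 1))"
      by (intro continuous_intros continuous_on_subset[OF cont]) (auto simp: cis_2pi_eq_1_iff)
    then have "continuous_on (- \<int>) q"
      by (rule continuous_on_eq) (auto simp: q_def)
    ultimately show ?thesis
      using False by (simp add: continuous_on_eq_continuous_at)
  qed
  have q_cont: "continuous_on A q" for A
    using q_isCont continuous_at_imp_continuous_on by blast
  have step: "fourier_coeff G m = fourier_coeff q (m - 1) - fourier_coeff q m" for m
  proof -
    have "fourier_coeff G m = integral {0..1} (\<lambda>t. q t * cis (- (2 * pi * (m - 1) * t)) - q t * cis (- (2 * pi * m * t)))"
      unfolding fourier_coeff_def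
    proof (rule Henstock_Kurzweil_Integration.integral_cong)
      fix t :: real
      have "cis (2 * pi * t) * cis (- (2 * pi * m * t)) = cis (- (2 * pi * (m - 1) * t))"
        by (simp add: cis_mult algebra_simps)
      then show "G t * cis (- (2 * pi * m * t)) = q t * cis (- (2 * pi * (m - 1) * t)) - q t * cis (- (2 * pi * m * t))"
        by (simp add: G_q algebra_simps)
    qed
    also have "\<dots> = fourier_coeff q (m - 1) - fourier_coeff q m"
      unfolding fourier_coeff_def
      by (subst Henstock_Kurzweil_Integration.integral_diff)
        (auto intro!: integrable_continuous_real continuous_intros q_cont)
    finally show ?thesis .
  qed
  \<comment> \<open>The range is half open so that telescoping leaves the coefficients of
    \<open>q\<close> at two indices of the same absolute value \<open>N\<close>.\<close>
  have tele: "(\<Sum>m\<in>{- int N<..int N}. fourier_coeff G m) = fourier_coeff q (- int N) - fourier_coeff q (int N)" for N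
  proof (induction N)
    case (Suc N)
    have "{- int (Suc N)<..int (Suc N)} = insert (int N + 1) (insert (- int N) {- int N<..int N})"
      by auto
    moreover have "fourier_coeff q (- int N - 1) = fourier_coeff q (- 1 - int N)"
      "fourier_coeff q (int N + 1) = fourier_coeff q (1 + int N)"
      by (rule arg_cong, simp)+
    ultimately show ?case using Suc by (simp add: step)
  qed simp
  \<comment> \<open>\<open>has_sum\<close> is convergence along all finite sets, so its value may be
    read off along these growing intervals.\<close>
  have "filterlim (\<lambda>N. {- int N<..int N}) (finite_subsets_at_top UNIV) sequentially"
    unfolding filterlim_finite_subsets_at_top
  proof (intro allI impI)
    fix X :: "int set" assume X: "finite X \<and> X \<subseteq> UNIV"
    then obtain K where K: "\<bar>m\<bar> \<le> K" if "m \<in> X" for m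
      using finite_imageI[of X abs] by (metis Max_ge imageI)
    show "\<forall>\<^sub>F N in sequentially. finite {- int N<..int N} \<and> X \<subseteq> {- int N<..int N} \<and> {- int N<..int N} \<subseteq> UNIV"
      using eventually_gt_at_top[of "nat K"]
    proof eventually_elim
      case (elim N)
      then show ?case using K by fastforce
    qed
  qed
  then have "(\<lambda>N. \<Sum>m\<in>{- int N<..int N}. fourier_coeff G m) \<longlonglongrightarrow> S"
    using sum unfolding has_sum_def by (rule filterlim_compose[rotated])
  moreover have "(\<lambda>N. fourier_coeff q (- int N) - fourier_coeff q (int N)) \<longlonglongrightarrow> 0 - 0"
  proof (intro tendsto_diff)
    have "\<exists>N. \<forall>n\<ge>N. norm (fourier_coeff q (f n)) < e" if "e > 0" "\<And>n. \<bar>f n\<bar> = int n" for e f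
    proof -
      obtain N where "\<forall>m. N \<le> \<bar>m\<bar> \<longrightarrow> norm (fourier_coeff q m) \<le> e / 2"
        using riemann_lebesgue_periodic[OF q_cont q_per, of "e / 2"] \<open>e > 0\<close> by auto
      then have "norm (fourier_coeff q (f n)) \<le> e / 2" if "n \<ge> nat N" for n
        using that \<open>\<bar>f n\<bar> = int n\<close> by auto
      then show ?thesis using \<open>e > 0\<close> by (intro exI[of _ "nat N"]) (force intro: le_less_trans)
    qed
    from this[of _ "\<lambda>n. - int n"] this[of _ int]
    show "(\<lambda>N. fourier_coeff q (- int N)) \<longlonglongrightarrow> 0" "(\<lambda>N. fourier_coeff q (int N)) \<longlonglongrightarrow> 0"
      by (auto simp: LIMSEQ_iff)
  qed
  ultimately show "S = 0"
    using LIMSEQ_unique by (fastforce simp: tele)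
qed

section \<open>Integration over the unit cube and product integrals\<close>

lemma AE_lborel_inner_not_Ints:
  "AE x :: 'a::euclidean_space in lborel. \<forall>b\<in>Basis. x \<bullet> b \<notin> \<int>"
proof -
  have "AE x :: 'a in lborel. x \<bullet> b \<noteq> of_int z" if "b \<in> Basis" for b and z :: int
  proof (rule AE_I')
    have "{x::'a. x \<bullet> b = of_int z} \<in> null_sets lebesgue"
      using negligible_standard_hyperplane[OF that] negligible_iff_null_sets by blast
    moreover have "closed {x::'a. x \<bullet> b = of_int z}"
      by (intro closed_Collect_eq continuous_intros)
    ultimately show "{x::'a. x \<bullet> b = of_int z} \<in> null_sets lborel"
      by (metis borel_closed null_sets_completion_iff sets_lborel)
  qed auto
  then have "AE x :: 'a in lborel. \<forall>b\<in>Basis. \<forall>z::int. x \<bullet> b \<noteq> of_int z"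
    by (intro AE_finite_allI) (auto simp: AE_all_countable)
  then show ?thesis
    by eventually_elim (auto elim!: Ints_cases)
qed

text \<open>Formulated in an arbitrary Euclidean space so that one unfolding lemma serves both the
  line, for Poisson summation, and \<open>real^'k\<close>, for \<open>periodisation\<close>.\<close>

definition int_lattice :: "'a::euclidean_space set"
  where "int_lattice = {a. \<forall>b\<in>Basis. a \<bullet> b \<in> \<int>}"

lemma finite_int_lattice_bounded: "finite {a \<in> int_lattice. norm (a::'a::euclidean_space) \<le> K}"
proof (rule finite_subset)
  define Z where "Z = (of_int ` {- \<lceil>K\<rceil>..\<lceil>K\<rceil>} :: real set)"
  show "{a \<in> int_lattice. norm (a::'a) \<le> K} \<subseteq> (\<lambda>f. \<Sum>b\<in>Basis. f b *\<^sub>R b) ` (PiE Basis (\<lambda>_. Z))"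
  proof
    fix a :: 'a assume a: "a \<in> {a \<in> int_lattice. norm a \<le> K}"
    have "a \<bullet> b \<in> Z" if b: "b \<in> Basis" for b
    proof -
      obtain z where z: "a \<bullet> b = of_int z"
        using a b by (auto simp: int_lattice_def elim: Ints_cases)
      have "\<bar>a \<bullet> b\<bar> \<le> K" using Basis_le_norm[OF b, of a] a by auto
      then have "\<bar>z\<bar> \<le> \<lceil>K\<rceil>" using z by linarith
      then show ?thesis unfolding Z_def using z by (intro image_eqI[of _ _ z]) auto
    qed
    then show "a \<in> (\<lambda>f. \<Sum>b\<in>Basis. f b *\<^sub>R b) ` (PiE Basis (\<lambda>_. Z))"
      by (intro image_eqI[of _ _ "restrict (\<lambda>b. a \<bullet> b) Basis"]) (auto simp: euclidean_representation)
  qed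
qed (auto intro!: finite_imageI finite_PiE)

lemma infsum_lattice_translates_eq_sum:
  fixes F :: "'a::euclidean_space \<Rightarrow> 'b::{comm_monoid_add, t2_space}"
  assumes supp: "\<And>x. K < norm x \<Longrightarrow> F x = 0" and x: "norm x \<le> r"
  shows "(\<Sum>\<^sub>\<infinity>a\<in>int_lattice. F (x + a)) = (\<Sum>a | a \<in> int_lattice \<and> norm a \<le> K + r. F (x + a))"
proof -
  have "F (x + a) = 0" if "\<not> norm a \<le> K + r" for a
  proof -
    have "norm a \<le> norm (x + a) + norm x"
      using norm_triangle_ineq4[of "x + a" x] by simp
    then show ?thesis using that x by (intro supp) simp
  qed
  then have "(\<Sum>\<^sub>\<infinity>a\<in>int_lattice. F (x + a)) = (\<Sum>\<^sub>\<infinity>a\<in>{a \<in> int_lattice. norm a \<le> K + r}. F (x + a))"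
    by (intro infsum_cong_neutral) auto
  then show ?thesis by (simp only: infsum_finite[OF finite_int_lattice_bounded])
qed

lemma lborel_integral_translate:
  fixes F :: "'a::euclidean_space \<Rightarrow> 'b::{banach, second_countable_topology}"
  assumes [measurable]: "F \<in> borel_measurable borel"
  shows "(LINT x|lborel. F (x + a)) = (LINT x|lborel. F x)"
proof -
  have "(LINT x|lborel. F x) = (LINT x|distr lborel borel ((+) a). F x)"
    by (simp add: lborel_distr_plus)
  also have "\<dots> = (LINT x|lborel. F (a + x))"
    by (subst integral_distr) auto
  finally show ?thesis by (simp add: add.commute)
qed

lemma integrable_lborel_translate:
  fixes F :: "'a::euclidean_space \<Rightarrow> 'b::{banach, second_countable_topology}"
  assumes "integrable lborel F"
  shows "integrable lborel (\<lambda>x. F (x + a))"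
proof -
  have "integrable (distr lborel borel ((+) a)) F"
    using assms by (simp add: lborel_distr_plus)
  then show ?thesis
    by (subst (asm) integrable_distr_eq) (use assms in \<open>auto simp: add.commute dest: borel_measurable_integrable\<close>)
qed

text \<open>The lattice translates of the cube tile the space up to a null set. As \<open>F\<close>
  has bounded support, one finite set of translates suffices for all points of the cube, so the sum
  commutes with the integral.\<close>

lemma integral_unit_cube_periodise:
  fixes F :: "'a::euclidean_space \<Rightarrow> 'b::{banach, second_countable_topology}"
  assumes int: "integrable lborel F" and supp: "\<And>x. K < norm x \<Longrightarrow> F x = 0"
  shows "(LINT x:cbox 0 One|lborel. (\<Sum>\<^sub>\<infinity>a\<in>int_lattice. F (x + a))) = (LINT x|lborel. F x)"
proof -
  \<comment> \<open>Points of the unit cube have norm at most the dimension, so only these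
    translates can bring such a point into the ball of radius \<open>K\<close>.\<close>
  define L where "L = {a::'a. a \<in> int_lattice \<and> norm a \<le> K + real DIM('a)}"
  define Q where "Q = (cbox 0 One :: 'a set)"
  have L: "finite L" unfolding L_def by (rule finite_int_lattice_bounded)
  have Q[measurable]: "Q \<in> sets borel" by (simp add: Q_def)
  have F[measurable]: "F \<in> borel_measurable borel" using int by (auto dest: borel_measurable_integrable)
  have Q_norm: "norm x \<le> real DIM('a)" if "x \<in> Q" for x
  proof -
    have "norm x \<le> (\<Sum>b\<in>Basis. \<bar>x \<bullet> b\<bar>)" by (rule norm_le_l1)
    also have "\<dots> \<le> (\<Sum>b\<in>(Basis::'a set). 1)"
      using that by (intro sum_mono) (auto simp: Q_def mem_box)
    finally show ?thesis by simp
  qed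
  have "(LINT x:Q|lborel. (\<Sum>\<^sub>\<infinity>a\<in>int_lattice. F (x + a))) = (LINT x|lborel. (\<Sum>a\<in>L. indicator Q x *\<^sub>R F (x + a)))"
    unfolding set_lebesgue_integral_def
    using infsum_lattice_translates_eq_sum[OF supp Q_norm] unfolding L_def
    by (intro Bochner_Integration.integral_cong) (auto simp: indicator_def)
  also have "\<dots> = (\<Sum>a\<in>L. (LINT x|lborel. indicator Q x *\<^sub>R F (x + a)))"
    by (intro Bochner_Integration.integral_sum integrable_mult_indicator integrable_lborel_translate int) simp
  also have "\<dots> = (\<Sum>a\<in>L. (LINT x|lborel. indicator Q (x - a) *\<^sub>R F x))"
  proof (rule sum.cong)
    fix a
    show "(LINT x|lborel. indicator Q x *\<^sub>R F (x + a)) = (LINT x|lborel. indicator Q (x - a) *\<^sub>R F x)"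
      using lborel_integral_translate[of "\<lambda>x. indicator Q (x - a) *\<^sub>R F x" a] by simp
  qed simp
  also have "\<dots> = (LINT x|lborel. (\<Sum>a\<in>L. indicator Q (x - a) *\<^sub>R F x))"
  proof (rule Bochner_Integration.integral_sum[symmetric])
    fix a
    have "(\<lambda>x. indicator Q (x - a) *\<^sub>R F x) = (\<lambda>x. indicator ((\<lambda>x. x - a) -` Q) x *\<^sub>R F x)"
      by (auto simp: indicator_def)
    moreover have "(\<lambda>x. x - a) -` Q \<in> sets lborel"
      using measurable_sets_borel[of "\<lambda>x. x - a" borel Q] by simp
    ultimately show "integrable lborel (\<lambda>x. indicator Q (x - a) *\<^sub>R F x)"
      using int by (simp add: integrable_mult_indicator)
  qed
  also have "\<dots> = (LINT x|lborel. F x)"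
  proof (rule integral_cong_AE)
    \<comment> \<open>The cubes are closed and overlap on their faces. A point without integer
      coordinates lies in exactly one translate, the one by its vector \<open>c\<close> of
      coordinatewise floors.\<close>
    show "AE x in lborel. (\<Sum>a\<in>L. indicator Q (x - a) *\<^sub>R F x) = F x"
      using AE_lborel_inner_not_Ints
    proof eventually_elim
      case (elim x)
      show ?case
      proof (cases "K < norm x")
        case True
        then show ?thesis by (simp add: supp)
      next
        case False
        define c where "c = (\<Sum>b\<in>Basis. of_int \<lfloor>x \<bullet> b\<rfloor> *\<^sub>R b)"
        have c_inner: "c \<bullet> b = of_int \<lfloor>x \<bullet> b\<rfloor>" if "b \<in> Basis" for b
          using that by (simp add: c_def inner_sum_left inner_Basis if_distrib sum.delta cong: if_cong)
        have cQ: "x - c \<in> Q"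
          unfolding Q_def mem_box
          by (auto simp: inner_diff_left c_inner) linarith+
        have "norm c \<le> norm x + norm (x - c)"
          using norm_triangle_ineq4[of x "x - c"] by simp
        then have cL: "c \<in> L"
          using False Q_norm[OF cQ] by (auto simp: L_def int_lattice_def c_inner)
        have uniq: "a = c" if a: "a \<in> L" "x - a \<in> Q" for a
        proof (rule euclidean_eqI)
          fix b :: 'a assume b: "b \<in> Basis"
          obtain z where z: "a \<bullet> b = of_int z"
            using a(1) b by (auto simp: L_def int_lattice_def elim: Ints_cases)
          have "0 \<le> x \<bullet> b - of_int z" "x \<bullet> b - of_int z \<le> 1"
            using a(2) b z unfolding Q_def mem_box by (auto simp: inner_diff_left)
          moreover have "x \<bullet> b - of_int z \<noteq> 1"
            using elim b by (metis Ints_1 Ints_add Ints_of_int diff_add_cancel)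
          ultimately have "\<lfloor>x \<bullet> b\<rfloor> = z" by (simp add: floor_eq_iff)
          then show "a \<bullet> b = c \<bullet> b" using z c_inner[OF b] by simp
        qed
        have "(\<Sum>a\<in>L - {c}. indicator Q (x - a) *\<^sub>R F x) = 0"
          by (rule sum.neutral) (metis DiffE indicator_simps(2) scaleR_zero_left singletonI uniq)
        then have "(\<Sum>a\<in>L. indicator Q (x - a) *\<^sub>R F x) = F x"
          using sum.remove[OF L cL, of "\<lambda>a. indicator Q (x - a) *\<^sub>R F x"] cQ by simp
        then show ?thesis by simp
      qed
    qed
  qed measurable
  finally show ?thesis unfolding Q_def .
qed

lemma lborel_integral_prod_Basis:
  fixes f :: "'a::euclidean_space \<Rightarrow> real \<Rightarrow> 'b::{real_normed_field, banach, second_countable_topology}"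
  assumes int: "\<And>b. b \<in> Basis \<Longrightarrow> integrable lborel (f b)"
  shows "(LINT x|lborel. (\<Prod>b\<in>Basis. f b (x \<bullet> b))) = (\<Prod>b\<in>Basis. (LINT t|lborel. f b t))"
    and "integrable lborel (\<lambda>x. \<Prod>b\<in>Basis. f b (x \<bullet> b))"
proof -
  interpret product_sigma_finite "\<lambda>_::'a. lborel :: real measure" ..
  have [measurable]: "f b \<in> borel_measurable borel" if "b \<in> Basis" for b
    using int[OF that] by (auto dest: borel_measurable_integrable)
  have inner: "(\<Sum>b'\<in>Basis. x b' *\<^sub>R b') \<bullet> b = x b" if "b \<in> Basis" for x b
    using that by (simp add: inner_sum_left inner_Basis if_distrib sum.delta cong: if_cong)
  have meas: "(\<lambda>x::'a. \<Prod>b\<in>Basis. f b (x \<bullet> b)) \<in> borel_measurable borel"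
    by measurable
  have meas': "(\<lambda>f. \<Sum>b\<in>Basis. f b *\<^sub>R b) \<in> Pi\<^sub>M Basis (\<lambda>_::'a. lborel :: real measure) \<rightarrow>\<^sub>M (borel :: 'a measure)"
    by measurable
  show "(LINT x|lborel. (\<Prod>b\<in>Basis. f b (x \<bullet> b))) = (\<Prod>b\<in>Basis. (LINT t|lborel. f b t))"
    by (subst lborel_eq, subst integral_distr[OF meas' meas])
       (simp add: inner product_integral_prod int cong: prod.cong)
  show "integrable lborel (\<lambda>x. \<Prod>b\<in>Basis. f b (x \<bullet> b))"
    by (subst lborel_eq, subst integrable_distr_eq[OF meas' meas])
       (simp add: inner product_integrable_prod int cong: prod.cong)
qed

section \<open>Poisson summation\<close>

text \<open>Used twice: for absolute convergence in Poisson summation, and in each coordinate for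
  the weights of the final sum over all frequencies.\<close>

lemma summable_on_int_inverse_square:
  "(\<lambda>m::int. 1 / (1 + \<bar>real_of_int m\<bar>)\<^sup>2) summable_on UNIV"
proof -
  have "summable (\<lambda>n. 1 / (1 + real n)\<^sup>2)"
    using summable_Suc_iff[of "\<lambda>n. inverse (real n ^ 2)"] inverse_power_summable[of 2, where 'a = real]
    by (simp add: inverse_eq_divide algebra_simps)
  then have nat: "(\<lambda>n. 1 / (1 + real n)\<^sup>2) summable_on UNIV"
    by (intro norm_summable_imp_summable_on) simp
  have "(\<lambda>m::int. 1 / (1 + \<bar>real_of_int m\<bar>)\<^sup>2) summable_on range h"
    if "inj h" "\<And>n. \<bar>h n\<bar> = int n" for h
  proof -
    have "\<bar>real_of_int (h n)\<bar> = real n" for n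
      using that(2)[of n] by linarith
    then show ?thesis
      using nat by (subst summable_on_reindex[OF that(1)]) (simp add: o_def)
  qed
  from this[of int] this[of "\<lambda>n. - int n"]
  have "(\<lambda>m::int. 1 / (1 + \<bar>real_of_int m\<bar>)\<^sup>2) summable_on (range int \<union> (range (\<lambda>n. - int n) - range int))"
    by (intro summable_on_Un_disjoint)
      (auto simp: inj_on_def intro: summable_on_subset_banach[where A = "range (\<lambda>n. - int n)"])
  moreover have "range int \<union> range (\<lambda>n. - int n) = UNIV"
  proof -
    have "m \<in> range int \<union> range (\<lambda>n. - int n)" for m
      by (cases m rule: int_cases2) auto
    then show ?thesis by blast
  qed
  ultimately show ?thesis by (simp add: Un_Diff_cancel)
qed

lemma int_lattice_real: "(int_lattice :: real set) = range of_int"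
  by (auto simp: int_lattice_def elim: Ints_cases)

lemma integral_cis_unit_interval:
  "integral {0..1} (\<lambda>t. cis (- (2 * pi * of_int m * t))) = (if m = 0 then 1 else 0)"
proof (cases "m = 0")
  case False
  define c where "c = - (2 * pi * \<i> * of_int m)"
  have c: "c \<noteq> 0" using False by (simp add: c_def)
  have cis: "cis (- (2 * pi * of_int m * t)) = exp (c * of_real t)" for t
    by (simp add: cis_conv_exp c_def mult_ac)
  have "((\<lambda>t. exp (c * of_real t)) has_integral (exp (c * of_real 1) / c - exp (c * of_real 0) / c)) {0..1}"
  proof (rule fundamental_theorem_of_calculus)
    fix t :: real
    show "((\<lambda>t. exp (c * of_real t) / c) has_vector_derivative exp (c * of_real t)) (at t within {0..1})"
      by (rule has_vector_derivative_real_field) (use c in \<open>auto intro!: derivative_eq_intros\<close>)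
  qed simp
  moreover have "exp (c * of_real 1) = 1"
    using cis[of 1] cis_2pi_int(2)[of m] by simp
  ultimately show ?thesis using False by (simp add: cis integral_unique)
qed simp

text \<open>Clearing the denominator \<open>n\<close> in the argument of \<open>b j\<close> turns
  the \<open>j\<close>-th factor of \<open>A_star\<close> into this sum with
  \<open>s = n * d j\<close> and \<open>v = n * x $ j - y $ j\<close>; in these variables it has
  period 1.\<close>

definition periodic_sum :: "(real \<Rightarrow> real) \<Rightarrow> real \<Rightarrow> real \<Rightarrow> real"
  where "periodic_sum f s v = (\<Sum>\<^sub>\<infinity>a::int. f ((v - of_int a) / s))"

context
  fixes f :: "real \<Rightarrow> real" and s :: real
  assumes f: "test_function f" and s: "0 < s"
begin

lemma test_function_scaled_eq_0:
  assumes "\<bar>v\<bar> \<le> K" "K + 2 * s < \<bar>real_of_int a\<bar>"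
  shows "f ((v - of_int a) / s) = 0"
proof -
  have "2 * s < \<bar>v - of_int a\<bar>" using assms by linarith
  then have "2 < \<bar>(v - of_int a) / s\<bar>" using s by (simp add: field_simps)
  then show ?thesis using f unfolding test_function_def by blast
qed

lemma finite_scaled_support: "finite {a::int. f ((v - of_int a) / s) \<noteq> 0}"
proof (rule finite_subset)
  show "{a::int. f ((v - of_int a) / s) \<noteq> 0} \<subseteq> {- \<lceil>\<bar>v\<bar> + 2 * s\<rceil>..\<lceil>\<bar>v\<bar> + 2 * s\<rceil>}"
  proof
    fix a :: int assume "a \<in> {a. f ((v - of_int a) / s) \<noteq> 0}"
    then have "\<not> \<bar>v\<bar> + 2 * s < \<bar>real_of_int a\<bar>"
      using test_function_scaled_eq_0[of v "\<bar>v\<bar>" a] by blast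
    then have "\<bar>real_of_int a\<bar> \<le> \<bar>v\<bar> + 2 * s" by linarith
    then show "a \<in> {- \<lceil>\<bar>v\<bar> + 2 * s\<rceil>..\<lceil>\<bar>v\<bar> + 2 * s\<rceil>}"
      by (auto simp: abs_le_iff) linarith+
  qed
qed simp

lemma periodic_sum_abs_summable: "(\<lambda>a::int. norm (f ((v - of_int a) / s))) summable_on UNIV"
proof -
  have "(\<lambda>a::int. norm (f ((v - of_int a) / s))) summable_on {a::int. f ((v - of_int a) / s) \<noteq> 0}"
    using finite_scaled_support by (rule summable_on_finite)
  then show ?thesis
    by (rule summable_on_cong_neutral[THEN iffD1, rotated -1]) auto
qed

lemma periodic_sum_local:
  assumes "\<bar>v\<bar> \<le> K"
  shows "periodic_sum f s v = (\<Sum>a = - \<lceil>K + 2 * s\<rceil>..\<lceil>K + 2 * s\<rceil>. f ((v - of_int a) / s))"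
proof -
  have "f ((v - of_int a) / s) = 0" if "a \<notin> {- \<lceil>K + 2 * s\<rceil>..\<lceil>K + 2 * s\<rceil>}" for a
    by (rule test_function_scaled_eq_0[OF assms]) (use that in \<open>auto simp: not_le; linarith\<close>)
  then have "periodic_sum f s v = (\<Sum>\<^sub>\<infinity>a\<in>{- \<lceil>K + 2 * s\<rceil>..\<lceil>K + 2 * s\<rceil>}. f ((v - of_int a) / s))"
    unfolding periodic_sum_def by (intro infsum_cong_neutral) auto
  then show ?thesis by simp
qed

text \<open>Near any point the sum runs over one fixed finite range and can be differentiated term
  by term. The derivative is what pointwise recovery of the Fourier series requires.\<close>

lemma periodic_sum_differentiable: "\<exists>D. (periodic_sum f s has_real_derivative D) (at v)"
proof -
  define N where "N = \<lceil>\<bar>v\<bar> + 1 + 2 * s\<rceil>"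
  have "((\<lambda>v. f ((v - of_int a) / s)) has_real_derivative deriv f ((v - of_int a) / s) * (1 / s)) (at v)" for a :: int
    by (rule DERIV_chain2[OF test_function_has_deriv[OF f]]) (use s in \<open>auto intro!: derivative_eq_intros\<close>)
  then have D: "((\<lambda>v. \<Sum>a = -N..N. f ((v - of_int a) / s)) has_real_derivative
      (\<Sum>a = -N..N. deriv f ((v - of_int a) / s) * (1 / s))) (at v)"
    by (intro DERIV_sum) auto
  have "(periodic_sum f s has_real_derivative (\<Sum>a = -N..N. deriv f ((v - of_int a) / s) * (1 / s))) (at v)"
  proof (rule has_field_derivative_transform_within_open[OF D])
    fix w assume "w \<in> ball v 1"
    then have "\<bar>w\<bar> \<le> \<bar>v\<bar> + 1" by (auto simp: dist_real_def)
    then show "(\<Sum>a = -N..N. f ((w - of_int a) / s)) = periodic_sum f s w"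
      unfolding N_def by (rule periodic_sum_local[symmetric])
  qed auto
  then show ?thesis by blast
qed

lemma periodic_sum_continuous: "continuous_on A (periodic_sum f s)"
  using periodic_sum_differentiable DERIV_isCont continuous_at_imp_continuous_on by metis

lemma periodic_sum_periodic: "periodic_sum f s (v + 1) = periodic_sum f s v"
  unfolding periodic_sum_def
  by (rule infsum_reindex_bij_witness[of _ "\<lambda>a. a + 1" "\<lambda>a. a - 1"]) (auto simp: algebra_simps)

text \<open>A character of integer frequency is unchanged by integer shifts, so it can be moved
  inside the sum over translates; unfolding then gives an integral over the whole line. The offset
  \<open>u\<close> is built in because the Fourier series is later evaluated only at 0.\<close>

lemma fourier_coeff_periodic_sum:
  "fourier_coeff (\<lambda>t. of_real (periodic_sum f s (u + t))) m
    = s * fourier_transform f (s * m) * cis (2 * pi * m * u)"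
proof -
  define F where "F = (\<lambda>t. complex_of_real (f ((u + t) / s)) * cis (- (2 * pi * m * t)))"
  have F_cont: "continuous_on A F" for A
    unfolding F_def using s
    by (intro continuous_intros continuous_on_compose2[OF test_function_continuous[OF f, of UNIV]]) auto
  have F_supp: "F t = 0" if "\<bar>u\<bar> + 2 * s < norm t" for t
  proof -
    have "2 * s < \<bar>u + t\<bar>" using that by auto
    then have "2 < \<bar>(u + t) / s\<bar>" using s by (simp add: field_simps)
    then show ?thesis using f unfolding test_function_def F_def by simp
  qed
  have F_int: "integrable lborel F"
    using F_cont F_supp by (rule integrable_continuous_bounded_support)
  have unfold: "of_real (periodic_sum f s (u + t)) * cis (- (2 * pi * m * t)) = (\<Sum>\<^sub>\<infinity>a\<in>int_lattice. F (t + a))" for t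
  proof -
    have "(\<Sum>\<^sub>\<infinity>a\<in>int_lattice. F (t + a)) = (\<Sum>\<^sub>\<infinity>a::int. F (t + of_int a))"
      unfolding int_lattice_real by (subst infsum_reindex) (auto simp: o_def inj_on_def)
    also have "\<dots> = (\<Sum>\<^sub>\<infinity>a::int. of_real (f ((u + t + of_int a) / s)) * cis (- (2 * pi * m * t)))"
    proof (rule infsum_cong)
      fix a :: int
      have "cis (- (2 * pi * m * (t + of_int a))) = cis (- (2 * pi * m * t)) * cis (- (2 * pi * of_int (m * a)))"
        by (simp add: cis_mult algebra_simps)
      then have "cis (- (2 * pi * m * (t + of_int a))) = cis (- (2 * pi * m * t))"
        by (simp only: cis_2pi_int mult_1_right)
      then show "F (t + of_int a) = of_real (f ((u + t + of_int a) / s)) * cis (- (2 * pi * m * t))"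
        by (simp add: F_def add.assoc)
    qed
    also have "\<dots> = (\<Sum>\<^sub>\<infinity>a::int. of_real (f ((u + t - of_int a) / s)) * cis (- (2 * pi * m * t)))"
      by (rule infsum_reindex_bij_witness[of _ uminus uminus]) auto
    also have "\<dots> = (\<Sum>\<^sub>\<infinity>a::int. of_real (f ((u + t - of_int a) / s))) * cis (- (2 * pi * m * t))"
      by (rule infsum_cmult_left')
    also have "(\<Sum>\<^sub>\<infinity>a::int. complex_of_real (f ((u + t - of_int a) / s))) = of_real (periodic_sum f s (u + t))"
      unfolding periodic_sum_def
      by (rule infsumI[OF has_sum_of_real[OF has_sum_infsum[OF abs_summable_summable[OF periodic_sum_abs_summable]]]])
    finally show ?thesis by simp
  qed
  have cont: "continuous_on A (\<lambda>t. complex_of_real (periodic_sum f s (u + t)) * cis (- (2 * pi * m * t)))" for A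
    by (intro continuous_intros continuous_on_compose2[OF periodic_sum_continuous[of UNIV]]) auto
  have "fourier_coeff (\<lambda>t. of_real (periodic_sum f s (u + t))) m
      = (LINT t:{0..1}|lborel. of_real (periodic_sum f s (u + t)) * cis (- (2 * pi * m * t)))"
    unfolding fourier_coeff_def
    by (intro set_borel_integral_eq_integral(2)[symmetric] borel_integrable_atLeastAtMost' cont)
  also have "\<dots> = (LINT t|lborel. F t)"
    unfolding unfold using integral_unit_cube_periodise[OF F_int F_supp] by simp
  also have "\<dots> = s *\<^sub>R (LINT x|lborel. F (- u + s * x))"
    using lborel_integral_real_affine[of s F "- u"] s by simp
  also have "(\<lambda>x. F (- u + s * x)) = (\<lambda>x. cis (2 * pi * m * u) * (of_real (f x) * cis (- (2 * pi * (s * m) * x))))"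
  proof
    fix x
    have "cis (- (2 * pi * m * (- u + s * x))) = cis (2 * pi * m * u) * cis (- (2 * pi * (s * m) * x))"
      by (simp add: cis_mult algebra_simps)
    then show "F (- u + s * x) = cis (2 * pi * m * u) * (of_real (f x) * cis (- (2 * pi * (s * m) * x)))"
      using s by (simp add: F_def)
  qed
  also have "(LINT x|lborel. cis (2 * pi * m * u) * (of_real (f x) * cis (- (2 * pi * (s * m) * x))))
      = cis (2 * pi * m * u) * fourier_transform f (s * m)"
    unfolding fourier_transform_def by (rule integral_mult_right_zero)
  finally show ?thesis by (simp add: scaleR_conv_of_real mult_ac)
qed

lemma fourier_transform_abs_summable_int:
  "(\<lambda>m::int. norm (s * fourier_transform f (s * m) * cis (2 * pi * m * u))) summable_on UNIV"
proof -
  obtain C where C: "norm (fourier_transform f \<xi>) \<le> C / (1 + \<bar>\<xi>\<bar>) ^ 2" for \<xi>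
    by (rule fourier_transform_decay[OF f, of 2]) blast
  have C0: "0 \<le> C" using order.trans[OF norm_ge_zero C[of 0]] by simp
  \<comment> \<open>Turns decay in \<open>s * m\<close> into decay in \<open>m\<close>, by
    \<open>\<sigma> * (1 + \<bar>m\<bar>) \<le> 1 + \<bar>s * m\<bar>\<close>.\<close>
  define \<sigma> where "\<sigma> = min 1 s"
  have \<sigma>: "0 < \<sigma>" "\<sigma> \<le> 1" "\<sigma> \<le> s" using s by (auto simp: \<sigma>_def)
  show ?thesis
  proof (rule Infinite_Sum.abs_summable_on_comparison_test')
    show "(\<lambda>m::int. s * C / \<sigma>\<^sup>2 * (1 / (1 + \<bar>real_of_int m\<bar>)\<^sup>2)) summable_on UNIV"
      by (intro summable_on_cmult_right summable_on_int_inverse_square)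
    fix m :: int
    have "\<sigma> * (1 + \<bar>real_of_int m\<bar>) \<le> 1 + \<bar>s * m\<bar>"
      using \<sigma> s mult_right_mono[of \<sigma> s "\<bar>real_of_int m\<bar>"] by (simp add: abs_mult distrib_left)
    then have "(\<sigma> * (1 + \<bar>real_of_int m\<bar>))\<^sup>2 \<le> (1 + \<bar>s * m\<bar>)\<^sup>2"
      using \<sigma> by (intro power_mono) auto
    then have "C / (1 + \<bar>s * m\<bar>)\<^sup>2 \<le> C / (\<sigma> * (1 + \<bar>real_of_int m\<bar>))\<^sup>2"
      using \<sigma> C0 by (intro divide_left_mono mult_pos_pos zero_less_power add_pos_nonneg) auto
    with C[of "s * m"] have "norm (fourier_transform f (s * m)) \<le> C / (\<sigma> * (1 + \<bar>real_of_int m\<bar>))\<^sup>2"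
      by linarith
    then have "s * norm (fourier_transform f (s * m)) \<le> s * (C / (\<sigma> * (1 + \<bar>real_of_int m\<bar>))\<^sup>2)"
      using s by (intro mult_left_mono) auto
    then show "norm (s * fourier_transform f (s * m) * cis (2 * pi * m * u))
        \<le> s * C / \<sigma>\<^sup>2 * (1 / (1 + \<bar>real_of_int m\<bar>)\<^sup>2)"
      using s by (simp add: norm_mult power_mult_distrib)
  qed
qed

text \<open>Subtracting the value \<open>S\<close> at \<open>u\<close> gives a function
  \<open>G\<close> that vanishes at 0. This changes only the coefficient at 0, so the coefficients
  of \<open>G\<close> sum to \<open>T - S\<close>, where \<open>T\<close> is the sum of the
  absolutely convergent series; \<open>fourier_series_at_zero\<close> makes that difference
  0.\<close>

lemma poisson_summation:
  "((\<lambda>m::int. s * fourier_transform f (s * m) * cis (2 * pi * m * u)) has_sum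
    of_real (periodic_sum f s u)) UNIV"
proof -
  define c where "c m = s * fourier_transform f (s * m) * cis (2 * pi * of_int m * u)" for m :: int
  define S where "S = complex_of_real (periodic_sum f s u)"
  define G where "G t = complex_of_real (periodic_sum f s (u + t)) - S" for t
  obtain T where T: "(c has_sum T) UNIV"
    using abs_summable_summable[OF fourier_transform_abs_summable_int[of u]]
    unfolding c_def summable_on_def by blast
  have coeff: "fourier_coeff G m = c m - S * (if m = 0 then 1 else 0)" for m
  proof -
    have "fourier_coeff G m = integral {0..1} (\<lambda>t. of_real (periodic_sum f s (u + t)) * cis (- (2 * pi * m * t))
        - S * cis (- (2 * pi * m * t)))"
      by (simp add: fourier_coeff_def G_def left_diff_distrib)
    also have "\<dots> = fourier_coeff (\<lambda>t. of_real (periodic_sum f s (u + t))) m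
        - S * integral {0..1} (\<lambda>t. cis (- (2 * pi * m * t)))"
      unfolding fourier_coeff_def
      by (subst Henstock_Kurzweil_Integration.integral_diff)
        (auto intro!: integrable_continuous_real continuous_intros continuous_on_compose2[OF periodic_sum_continuous[of UNIV]])
    finally show ?thesis
      by (simp only: fourier_coeff_periodic_sum integral_cis_unit_interval c_def)
  qed
  have "((\<lambda>m. S * (if m = 0 then 1 else 0)) has_sum S) (UNIV :: int set)"
    by (rule has_sum_finite_neutralI[of "{0}"]) auto
  with T have "((\<lambda>m. c m + - (S * (if m = 0 then 1 else 0))) has_sum (T + - S)) UNIV"
    by (intro has_sum_add has_sum_uminusI)
  moreover have "fourier_coeff G = (\<lambda>m. c m + - (S * (if m = 0 then 1 else 0)))"
    using coeff by auto
  ultimately have sum: "(fourier_coeff G has_sum (T - S)) UNIV" by simp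
  obtain D where "(periodic_sum f s has_real_derivative D) (at u)"
    using periodic_sum_differentiable by blast
  then have "((\<lambda>t. periodic_sum f s (u + t)) has_real_derivative D) (at 0)"
    using DERIV_at_within_shift[of "periodic_sum f s" D u 0 UNIV] by (simp add: add.commute)
  then have "((\<lambda>t. complex_of_real (periodic_sum f s (u + t))) has_vector_derivative of_real D) (at 0)"
    using has_real_derivative_iff_has_vector_derivative has_vector_derivative_of_real by blast
  then have "((\<lambda>t. complex_of_real (periodic_sum f s (u + t)) - S) has_vector_derivative of_real D - 0) (at 0)"
    by (intro has_vector_derivative_diff has_vector_derivative_const)
  then have "(G has_vector_derivative of_real D) (at 0)"
    by (simp add: G_def[abs_def])
  moreover have "continuous_on UNIV G"
    unfolding G_def by (intro continuous_intros continuous_on_compose2[OF periodic_sum_continuous[of UNIV]]) auto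
  moreover have "G (t + 1) = G t" for t
    using periodic_sum_periodic[of "u + t"] by (simp add: G_def add.assoc)
  moreover have "G 0 = 0" by (simp add: G_def S_def)
  ultimately have "T - S = 0"
    using fourier_series_at_zero sum by blast
  then show ?thesis using T unfolding c_def S_def by simp
qed

end

section \<open>Fourier expansion of \<open>A_star\<close>\<close>

lemma bij_vec_nth_PiE: "bij_betw vec_nth (UNIV :: ('a^'k::finite) set) (PiE UNIV (\<lambda>_. UNIV))"
  by (rule bij_betwI[of _ _ _ vec_lambda]) auto

text \<open>Any finite set of vectors lies in the box of its coordinate projections, and the sum
  over a box factorises into one-dimensional sums.\<close>

lemma vec_prod_norm_summable:
  fixes f :: "'k::finite \<Rightarrow> 'i \<Rightarrow> 'b::real_normed_field"
  assumes "\<And>j. (\<lambda>i. norm (f j i)) summable_on UNIV"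
  shows "(\<lambda>m::'i^'k. norm (\<Prod>j\<in>UNIV. f j (m $ j))) summable_on UNIV"
proof (rule nonneg_bdd_above_summable_on)
  show "bdd_above (sum (\<lambda>m::'i^'k. norm (\<Prod>j\<in>UNIV. f j (m $ j))) ` {F. F \<subseteq> UNIV \<and> finite F})"
  proof (rule bdd_aboveI2)
    fix F :: "('i^'k) set" assume "F \<in> {F. F \<subseteq> UNIV \<and> finite F}"
    then have F: "finite F" by simp
    define B where "B j = (\<lambda>m. m $ j) ` F" for j
    have B: "finite (B j)" for j using F by (simp add: B_def)
    have "sum (\<lambda>m::'i^'k. norm (\<Prod>j\<in>UNIV. f j (m $ j))) F
        = (\<Sum>g\<in>vec_nth ` F. \<Prod>j\<in>UNIV. norm (f j (g j)))"
      by (subst sum.reindex) (auto simp: inj_on_def vec_nth_inject prod_norm)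
    also have "\<dots> \<le> (\<Sum>g\<in>PiE UNIV B. \<Prod>j\<in>UNIV. norm (f j (g j)))"
      by (rule sum_mono2) (auto simp: B_def F intro!: finite_PiE prod_nonneg)
    also have "\<dots> = (\<Prod>j\<in>UNIV. \<Sum>i\<in>B j. norm (f j i))"
      by (rule prod_sum_PiE[symmetric]) (auto simp: B)
    also have "\<dots> \<le> (\<Prod>j\<in>UNIV. infsum (\<lambda>i. norm (f j i)) UNIV)"
      by (intro prod_mono conjI sum_nonneg finite_sum_le_infsum assms) (auto simp: B)
    finally show "sum (\<lambda>m::'i^'k. norm (\<Prod>j\<in>UNIV. f j (m $ j))) F \<le> (\<Prod>j\<in>UNIV. infsum (\<lambda>i. norm (f j i)) UNIV)" .
  qed
qed simp

lemma vec_prod_infsum: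
  fixes f :: "'k::finite \<Rightarrow> 'i \<Rightarrow> 'b::{banach, real_normed_field}"
  assumes "\<And>j. (\<lambda>i. norm (f j i)) summable_on UNIV"
  shows "(\<Sum>\<^sub>\<infinity>m\<in>(UNIV :: ('i^'k) set). \<Prod>j\<in>UNIV. f j (m $ j)) = (\<Prod>j\<in>UNIV. infsum (f j) UNIV)"
proof -
  have "(\<Sum>\<^sub>\<infinity>m\<in>(UNIV :: ('i^'k) set). \<Prod>j\<in>UNIV. f j (m $ j))
      = (\<Sum>\<^sub>\<infinity>g\<in>PiE (UNIV::'k set) (\<lambda>_. UNIV). \<Prod>j\<in>UNIV. f j (g j))"
    by (rule infsum_reindex_bij_betw[OF bij_vec_nth_PiE])
  also have "\<dots> = (\<Prod>j\<in>UNIV. infsum (f j) UNIV)"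
    by (rule infsum_prod_PiE_abs) (use assms in auto)
  finally show ?thesis .
qed

text \<open>The limit is taken along the net of finite sets, so the argument rests on a tail bound
  that is uniform in \<open>x\<close>: since \<open>e\<close> is bounded by 1, the tail of the
  series is at most the tail of the norms of \<open>c\<close>, and this tends to 0 also after
  integration against \<open>w\<close>.\<close>

lemma integral_has_sum_exchange:
  fixes c :: "'i \<Rightarrow> complex" and e :: "'i \<Rightarrow> 'a \<Rightarrow> complex"
  assumes c: "(\<lambda>i. norm (c i)) summable_on UNIV"
    and e[measurable]: "\<And>i. e i \<in> borel_measurable M" and e1: "\<And>i x. norm (e i x) \<le> 1"
    and A: "\<And>x. ((\<lambda>i. c i * e i x) has_sum A x) UNIV" and A_meas[measurable]: "A \<in> borel_measurable M"
    and w: "integrable M w"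
  shows "((\<lambda>i. c i * (LINT x|M. e i x * w x)) has_sum (LINT x|M. A x * w x)) UNIV"
    and "integrable M (\<lambda>x. A x * w x)"
proof -
  define S where "S = infsum (\<lambda>i. norm (c i)) UNIV"
  define W where "W = (LINT x|M. norm (w x))"
  have [measurable]: "w \<in> borel_measurable M" using w by (rule borel_measurable_integrable)
  have ce: "(\<lambda>i. norm (c i * e i x)) summable_on B" for x B
    by (rule Infinite_Sum.abs_summable_on_comparison_test'[OF summable_on_subset_banach[OF c, of B]])
      (auto simp: norm_mult intro: mult_left_le e1)
  have tail: "norm (A x - (\<Sum>i\<in>F. c i * e i x)) \<le> S - (\<Sum>i\<in>F. norm (c i))" if F: "finite F" for F x
  proof -
    have "A x = infsum (\<lambda>i. c i * e i x) UNIV" using A[of x] by (simp add: infsumI)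
    then have "A x - (\<Sum>i\<in>F. c i * e i x) = infsum (\<lambda>i. c i * e i x) (UNIV - F)"
      using infsum_Diff[of "\<lambda>i. c i * e i x" UNIV F] F A[of x] by (auto simp: has_sum_iff)
    also have "norm \<dots> \<le> infsum (\<lambda>i. norm (c i * e i x)) (UNIV - F)"
      by (rule norm_infsum_bound[OF ce])
    also have "\<dots> \<le> infsum (\<lambda>i. norm (c i)) (UNIV - F)"
      by (rule infsum_mono[OF ce summable_on_subset_banach[OF c]])
        (auto simp: norm_mult intro: mult_left_le e1)
    also have "\<dots> = S - (\<Sum>i\<in>F. norm (c i))"
      using infsum_Diff[of "\<lambda>i. norm (c i)" UNIV F] F c by (simp add: S_def)
    finally show ?thesis .
  qed
  have ew: "integrable M (\<lambda>x. e i x * w x)" for i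
    by (rule Bochner_Integration.integrable_bound[OF w])
      (auto simp: norm_mult intro!: AE_I2 mult_left_le_one_le e1)
  have AS: "norm (A x) \<le> S" for x
    using tail[of "{}" x] by simp
  show Aw: "integrable M (\<lambda>x. A x * w x)"
    by (rule Bochner_Integration.integrable_bound[where f = "\<lambda>x. complex_of_real S * w x"])
      (use w order.trans[OF AS abs_ge_self] in \<open>auto simp: norm_mult intro!: AE_I2 mult_right_mono\<close>)
  have bound: "norm ((\<Sum>i\<in>F. c i * (LINT x|M. e i x * w x)) - (LINT x|M. A x * w x))
      \<le> (S - (\<Sum>i\<in>F. norm (c i))) * W" if F: "finite F" for F
  proof -
    have cew: "integrable M (\<lambda>x. \<Sum>i\<in>F. c i * (e i x * w x))"
      by (intro Bochner_Integration.integrable_sum integrable_mult_right ew)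
    have sum: "(\<Sum>i\<in>F. c i * (LINT x|M. e i x * w x)) = (LINT x|M. (\<Sum>i\<in>F. c i * (e i x * w x)))"
      by (subst Bochner_Integration.integral_sum) (auto intro: ew)
    have "(\<Sum>i\<in>F. c i * (LINT x|M. e i x * w x)) - (LINT x|M. A x * w x)
        = (LINT x|M. (\<Sum>i\<in>F. c i * (e i x * w x)) - A x * w x)"
      unfolding sum by (rule Bochner_Integration.integral_diff[OF cew Aw, symmetric])
    also have "norm \<dots> \<le> (LINT x|M. norm ((\<Sum>i\<in>F. c i * (e i x * w x)) - A x * w x))"
      by (rule integral_norm_bound)
    also have "\<dots> \<le> (LINT x|M. (S - (\<Sum>i\<in>F. norm (c i))) * norm (w x))"
    proof (rule integral_mono)
      show "integrable M (\<lambda>x. norm ((\<Sum>i\<in>F. c i * (e i x * w x)) - A x * w x))"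
        by (intro integrable_norm Bochner_Integration.integrable_diff cew Aw)
      show "integrable M (\<lambda>x. (S - (\<Sum>i\<in>F. norm (c i))) * norm (w x))"
        using w by auto
      fix x
      have "(\<Sum>i\<in>F. c i * (e i x * w x)) - A x * w x = - ((A x - (\<Sum>i\<in>F. c i * e i x)) * w x)"
        by (simp add: sum_distrib_right left_diff_distrib mult.assoc)
      then show "norm ((\<Sum>i\<in>F. c i * (e i x * w x)) - A x * w x) \<le> (S - (\<Sum>i\<in>F. norm (c i))) * norm (w x)"
        using tail[OF F, of x] by (simp add: norm_mult mult_right_mono)
    qed
    also have "\<dots> = (S - (\<Sum>i\<in>F. norm (c i))) * W" by (simp add: W_def)
    finally show ?thesis .
  qed
  have "((\<lambda>i. norm (c i)) has_sum S) UNIV" unfolding S_def using c by simp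
  then have "((\<lambda>F. (S - (\<Sum>i\<in>F. norm (c i))) * W) \<longlongrightarrow> (S - S) * W) (finite_subsets_at_top UNIV)"
    unfolding has_sum_def by (intro tendsto_intros)
  then have lim: "((\<lambda>F. (S - (\<Sum>i\<in>F. norm (c i))) * W) \<longlongrightarrow> 0) (finite_subsets_at_top UNIV)"
    by simp
  have "eventually (\<lambda>F. norm ((\<Sum>i\<in>F. c i * (LINT x|M. e i x * w x)) - (LINT x|M. A x * w x))
      \<le> (S - (\<Sum>i\<in>F. norm (c i))) * W) (finite_subsets_at_top UNIV)"
    by (rule eventually_finite_subsets_at_top_weakI) (rule bound)
  from Lim_null_comparison[OF this lim]
  have "((\<lambda>F. (\<Sum>i\<in>F. c i * (LINT x|M. e i x * w x)) - (LINT x|M. A x * w x)) \<longlongrightarrow> 0) (finite_subsets_at_top UNIV)" .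
  then show "((\<lambda>i. c i * (LINT x|M. e i x * w x)) has_sum (LINT x|M. A x * w x)) UNIV"
    unfolding has_sum_def using Lim_null by blast
qed

definition of_int_vec :: "int^'k \<Rightarrow> real^'k"
  where "of_int_vec m = (\<chi> i. of_int (m $ i))"

lemma of_int_vec_nth[simp]: "of_int_vec m $ i = of_int (m $ i)"
  by (simp add: of_int_vec_def)

lemma int_lattice_vec: "(int_lattice :: (real^'k) set) = range of_int_vec"
proof (intro equalityI subsetI)
  fix a :: "real^'k" assume "a \<in> int_lattice"
  then have "a $ i \<in> \<int>" for i
    unfolding int_lattice_def cart_eq_inner_axis using axis_in_Basis_iff[of i "1::real"] by auto
  then have "a = of_int_vec (\<chi> i. \<lfloor>a $ i\<rfloor>)"
    by (simp add: vec_eq_iff)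
  then show "a \<in> range of_int_vec" by blast
next
  fix a :: "real^'k" assume "a \<in> range of_int_vec"
  then show "a \<in> int_lattice"
    by (auto simp: int_lattice_def Basis_vec_def simp flip: cart_eq_inner_axis)
qed

lemma periodisation_eq_lattice_sum: "periodisation f x = (\<Sum>\<^sub>\<infinity>a\<in>int_lattice. f (x + a))"
proof -
  have "inj of_int_vec" by (auto simp: inj_on_def vec_eq_iff)
  then have "(\<Sum>\<^sub>\<infinity>a\<in>range of_int_vec. f (x + a)) = (\<Sum>\<^sub>\<infinity>m\<in>UNIV. f (x + of_int_vec m))"
    by (subst infsum_reindex) (auto simp: o_def)
  then show ?thesis
    unfolding periodisation_def int_lattice_vec by (simp add: of_int_vec_def)
qed

lemma one_vec_eq_One: "(1 :: real^'k) = One"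
proof -
  have "One $ i = (1::real)" for i :: 'k
    by (subst cart_eq_inner_axis) (simp add: axis_in_Basis_iff)
  then show ?thesis by (simp add: vec_eq_iff)
qed

lemma Basis_eq_range_axis: "(Basis :: (real^'k) set) = range (\<lambda>i. axis i 1)"
  by (auto simp: Basis_vec_def)

lemma lborel_integral_prod_vec:
  fixes f :: "'k::finite \<Rightarrow> real \<Rightarrow> 'b::{real_normed_field, banach, second_countable_topology}"
  assumes int: "\<And>j. integrable lborel (f j)"
  shows "(LINT x|lborel. (\<Prod>j\<in>UNIV. f j (x $ j))) = (\<Prod>j\<in>UNIV. (LINT t|lborel. f j t))"
    and "integrable lborel (\<lambda>x::real^'k. \<Prod>j\<in>UNIV. f j (x $ j))"
proof -
  have reindex: "(\<Prod>b\<in>(Basis :: (real^'k) set). h (axis_index b) b) = (\<Prod>j\<in>UNIV. h j (axis j 1))"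
    for h :: "'k \<Rightarrow> real^'k \<Rightarrow> 'b"
    unfolding Basis_eq_range_axis by (subst prod.reindex) (auto simp: inj_on_def axis_eq_axis)
  have "(\<Prod>j\<in>UNIV. f j (x $ j)) = (\<Prod>b\<in>Basis. f (axis_index b) (x \<bullet> b))" for x :: "real^'k"
    by (simp add: reindex[of "\<lambda>j b. f j (x \<bullet> b)"] cart_eq_inner_axis)
  then show "(LINT x|lborel. (\<Prod>j\<in>UNIV. f j (x $ j))) = (\<Prod>j\<in>UNIV. (LINT t|lborel. f j t))"
    "integrable lborel (\<lambda>x::real^'k. \<Prod>j\<in>UNIV. f j (x $ j))"
    using lborel_integral_prod_Basis[of "\<lambda>b::real^'k. f (axis_index b)"] int
      reindex[of "\<lambda>j b. integral\<^sup>L lborel (f j)"] by auto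
qed

text \<open>The Fourier coefficient of \<open>A_star\<close> at frequency \<open>n\<close> times
  \<open>m\<close>. Only these frequencies occur because \<open>A_star\<close> is invariant under
  shifts by integer vectors divided by \<open>n\<close>; the factor \<open>cis\<close> carries the
  offset \<open>y\<close>.\<close>

definition A_star_coeff :: "('k::finite \<Rightarrow> real \<Rightarrow> real) \<Rightarrow> real^'k \<Rightarrow> ('k \<Rightarrow> real) \<Rightarrow> nat \<Rightarrow> int^'k \<Rightarrow> complex"
  where "A_star_coeff b y d n m = (\<Prod>j\<in>UNIV. real n * d j *
    fourier_transform (b j) (real n * d j * m $ j) * cis (- (2 * pi * m $ j * y $ j)))"

definition vec_char :: "real^'k \<Rightarrow> real^'k \<Rightarrow> complex"
  where "vec_char \<xi> x = cis (2 * pi * (\<xi> \<bullet> x))"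

lemma vec_char_measurable[measurable]: "vec_char \<xi> \<in> borel_measurable borel"
  unfolding vec_char_def[abs_def] by (intro borel_measurable_continuous_onI continuous_intros)

lemma cis_sum: "finite A \<Longrightarrow> cis (sum f A) = (\<Prod>i\<in>A. cis (f i))"
  by (induction rule: finite_induct) (auto simp flip: cis_mult)

lemma vec_char_eq_prod: "vec_char \<xi> x = (\<Prod>j\<in>UNIV. cis (2 * pi * \<xi> $ j * x $ j))"
  by (simp add: vec_char_def inner_vec_def sum_distrib_left cis_sum mult.assoc)

context
  fixes b :: "'k::finite \<Rightarrow> real \<Rightarrow> real" and y :: "real^'k" and d :: "'k \<Rightarrow> real" and n :: nat
  assumes b: "\<And>j. test_function (b j)" and d: "\<And>j. 0 < d j" and n: "1 \<le> n"
begin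

lemma scale_pos: "0 < real n * d j"
  using d n by simp

lemma A_star_eq_prod:
  "A_star b y d n x = (\<Prod>j\<in>UNIV. periodic_sum (b j) (n * d j) (n * x $ j - y $ j))"
proof -
  have "(x $ j - (of_int a + y $ j) / n) / d j = (n * x $ j - y $ j - of_int a) / (n * d j)" for a j
    using n d[of j] by (simp add: field_simps)
  then have "A_star b y d n x = (\<Sum>\<^sub>\<infinity> a \<in> (UNIV :: (int^'k) set).
      \<Prod>j\<in>UNIV. b j ((n * x $ j - y $ j - of_int (a $ j)) / (n * d j)))"
    by (simp add: A_star_def)
  also have "\<dots> = (\<Prod>j\<in>UNIV. \<Sum>\<^sub>\<infinity>a. b j ((n * x $ j - y $ j - of_int a) / (n * d j)))"
    by (rule vec_prod_infsum[of "\<lambda>j a. b j ((n * x $ j - y $ j - of_int a) / (n * d j))"])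
      (rule periodic_sum_abs_summable[OF b scale_pos])
  finally show ?thesis by (simp add: periodic_sum_def)
qed

lemma A_star_continuous: "continuous_on A (A_star b y d n)"
  unfolding A_star_eq_prod[abs_def]
  by (intro continuous_intros continuous_on_compose2[OF periodic_sum_continuous[OF b scale_pos, of UNIV]]) auto

lemma A_star_periodic:
  assumes "a \<in> int_lattice"
  shows "A_star b y d n (x + a) = A_star b y d n x"
proof -
  obtain m where m: "a = of_int_vec m" using assms int_lattice_vec by auto
  have "n * (x + a) $ j - y $ j = n * x $ j - y $ j + of_int (int n * m $ j)" for j
    by (simp add: m algebra_simps)
  then have "periodic_sum (b j) (n * d j) (n * (x + a) $ j - y $ j) = periodic_sum (b j) (n * d j) (n * x $ j - y $ j)" for j
    using periodic_of_int[where g = "periodic_sum (b j) (n * d j)"] periodic_sum_periodic[OF b scale_pos]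
    by metis
  then show ?thesis
    unfolding A_star_eq_prod by (intro prod.cong) auto
qed

lemma A_star_coeff_summable: "(\<lambda>m. norm (A_star_coeff b y d n m)) summable_on UNIV"
proof -
  have "(\<lambda>m::int^'k. norm (\<Prod>j\<in>UNIV. complex_of_real (n * d j) * fourier_transform (b j) (n * d j * m $ j)
      * cis (2 * pi * m $ j * (- (y $ j))))) summable_on UNIV"
    by (rule vec_prod_norm_summable, rule fourier_transform_abs_summable_int[OF b scale_pos])
  then show ?thesis by (simp add: A_star_coeff_def)
qed

text \<open>Poisson summation at scale \<open>n * d j\<close> and point
  \<open>n * x $ j - y $ j\<close>, multiplied out over \<open>j\<close>, which absolute convergence
  permits. Splitting each character puts \<open>y\<close> into the coefficient and leaves the
  frequency \<open>n\<close> times \<open>m\<close>.\<close>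

lemma A_star_fourier_series:
  "((\<lambda>m. A_star_coeff b y d n m * vec_char (n *\<^sub>R of_int_vec m) x) has_sum of_real (A_star b y d n x)) UNIV"
proof -
  define f where "f j m = complex_of_real (n * d j) * fourier_transform (b j) (n * d j * of_int m)
      * cis (2 * pi * of_int m * (n * x $ j - y $ j))" for j and m :: int
  have f_sum: "(\<lambda>m. norm (f j m)) summable_on UNIV" for j
    unfolding f_def by (rule fourier_transform_abs_summable_int[OF b scale_pos])
  have f_infsum: "infsum (f j) UNIV = of_real (periodic_sum (b j) (n * d j) (n * x $ j - y $ j))" for j
    unfolding f_def by (rule infsumI, rule poisson_summation[OF b scale_pos])
  have "(\<lambda>m::int^'k. \<Prod>j\<in>UNIV. f j (m $ j)) summable_on UNIV"
    by (rule abs_summable_summable[OF vec_prod_norm_summable[of f, OF f_sum]])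
  then have "((\<lambda>m::int^'k. \<Prod>j\<in>UNIV. f j (m $ j)) has_sum (\<Prod>j\<in>UNIV. infsum (f j) UNIV)) UNIV"
    unfolding vec_prod_infsum[of f, OF f_sum, symmetric] by (rule has_sum_infsum)
  moreover have "(\<Prod>j\<in>UNIV. f j (m $ j)) = A_star_coeff b y d n m * vec_char (n *\<^sub>R of_int_vec m) x" for m
  proof -
    have "cis (2 * pi * of_int i * (n * x $ j - y $ j)) = cis (- (2 * pi * i * y $ j)) * cis (2 * pi * (real n * of_int i) * x $ j)"
      for i :: int and j
      by (simp add: cis_mult algebra_simps)
    then have "f j (m $ j) = complex_of_real (n * d j) * fourier_transform (b j) (n * d j * m $ j)
        * cis (- (2 * pi * m $ j * y $ j)) * cis (2 * pi * (n *\<^sub>R of_int_vec m) $ j * x $ j)" for j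
      by (simp only: f_def mult.assoc vector_scaleR_component of_int_vec_nth real_scaleR_def)
    then show ?thesis
      unfolding A_star_coeff_def vec_char_eq_prod prod.distrib[symmetric] by (intro prod.cong refl)
  qed
  ultimately show ?thesis
    by (simp add: f_infsum A_star_eq_prod)
qed

lemma A_star_integral_has_sum:
  assumes w: "integrable lborel w"
  shows "((\<lambda>m. A_star_coeff b y d n m * (LINT x|lborel. vec_char (n *\<^sub>R of_int_vec m) x * of_real (w x)))
      has_sum of_real (LINT x|lborel. A_star b y d n x * w x)) UNIV"
    and "integrable lborel (\<lambda>x. A_star b y d n x * w x)"
proof -
  have w': "integrable lborel (\<lambda>x. complex_of_real (w x))" using w by simp
  have meas: "(\<lambda>x. complex_of_real (A_star b y d n x)) \<in> borel_measurable lborel"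
    using A_star_continuous[of UNIV] by (simp add: borel_measurable_continuous_onI)
  have e: "vec_char (n *\<^sub>R of_int_vec m) \<in> borel_measurable lborel"
    "norm (vec_char (n *\<^sub>R of_int_vec m) x) \<le> 1" for m :: "int^'k" and x
    using vec_char_measurable by (auto simp: vec_char_def)
  note ex = integral_has_sum_exchange[OF A_star_coeff_summable e A_star_fourier_series meas w']
  show "((\<lambda>m. A_star_coeff b y d n m * (LINT x|lborel. vec_char (n *\<^sub>R of_int_vec m) x * of_real (w x)))
      has_sum of_real (LINT x|lborel. A_star b y d n x * w x)) UNIV"
    using ex(1) by (simp flip: of_real_mult)
  show "integrable lborel (\<lambda>x. A_star b y d n x * w x)"
    using ex(2) unfolding of_real_mult[symmetric] complex_of_real_integrable_eq .
qed

text \<open>The indicator of the cube serves as the weight in the termwise integration. Every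
  character except the constant one integrates to 0 over the cube, so only the coefficient at 0
  survives.\<close>

lemma A_star_unit_cube_integral:
  "(LINT x:cbox 0 1|lborel. A_star b y d n x) = (\<Prod>j\<in>UNIV. n * d j * (LINT t|lborel. b j t))"
proof -
  define w where "w x = (indicator (cbox 0 1) x :: real)" for x :: "real^'k"
  have w: "integrable lborel w" unfolding w_def by (rule integrable_real_indicator[OF _ emeasure_lborel_cbox_finite]) auto
  have char: "(LINT x|lborel. vec_char (n *\<^sub>R of_int_vec m) x * of_real (w x)) = (if m = 0 then 1 else 0)" for m :: "int^'k"
  proof -
    have w_prod: "complex_of_real (w x) = (\<Prod>j\<in>UNIV. indicator {0..1} (x $ j))" for x
    proof (cases "x \<in> cbox 0 1")
      case True
      then show ?thesis by (auto simp: w_def mem_box_cart indicator_def)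
    next
      case False
      then obtain j where "x $ j \<notin> {0..1}" by (auto simp: mem_box_cart)
      then have "(\<Prod>j\<in>UNIV. indicator {0..1} (x $ j) :: complex) = 0"
        by (intro prod_zero bexI[of _ j]) auto
      then show ?thesis using False by (simp add: w_def)
    qed
    have one: "(LINT t|lborel. indicator {0..1} t * cis (2 * pi * (n * of_int i) * t)) = (if i = 0 then 1 else 0 :: complex)"
      and one_int: "integrable lborel (\<lambda>t. indicator {0..1} t * cis (2 * pi * (n * of_int i) * t))" for i :: int
    proof -
      have si: "set_integrable lborel {0..1::real} (\<lambda>t. cis (2 * pi * (n * of_int i) * t))"
        by (intro borel_integrable_atLeastAtMost' continuous_intros)
      then show "integrable lborel (\<lambda>t. indicator {0..1} t * cis (2 * pi * (n * of_int i) * t))"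
        by (simp add: set_integrable_def scaleR_conv_of_real of_real_indicator)
      have "(LINT t|lborel. indicator {0..1} t * cis (2 * pi * (n * of_int i) * t))
          = (LINT t:{0..1}|lborel. cis (2 * pi * (n * of_int i) * t))"
        by (simp add: set_lebesgue_integral_def scaleR_conv_of_real of_real_indicator)
      also have "\<dots> = integral {0..1} (\<lambda>t. cis (- (2 * pi * of_int (- (int n * i)) * t)))"
        using set_borel_integral_eq_integral(2)[OF si] by simp
      \<comment> \<open>Here \<open>1 \<le> n\<close> matters: \<open>n * i\<close> vanishes only
        for \<open>i = 0\<close>.\<close>
      also have "\<dots> = (if i = 0 then 1 else 0)"
        using integral_cis_unit_interval[of "- (int n * i)"] n by simp
      finally show "(LINT t|lborel. indicator {0..1} t * cis (2 * pi * (n * of_int i) * t)) = (if i = 0 then 1 else 0 :: complex)" .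
    qed
    have "(LINT x|lborel. vec_char (n *\<^sub>R of_int_vec m) x * of_real (w x))
        = (LINT x|lborel. (\<Prod>j\<in>UNIV. indicator {0..1} (x $ j) * cis (2 * pi * (n * of_int (m $ j)) * x $ j)))"
      by (simp add: w_prod vec_char_eq_prod prod.distrib mult_ac)
    also have "\<dots> = (\<Prod>j\<in>UNIV. if m $ j = 0 then 1 else 0)"
      by (subst lborel_integral_prod_vec(1)) (use one one_int in auto)
    also have "\<dots> = (if m = 0 then 1 else 0)"
      by (auto simp: vec_eq_iff)
    finally show ?thesis .
  qed
  have "((\<lambda>m. A_star_coeff b y d n m * (if m = 0 then 1 else 0)) has_sum
      of_real (LINT x|lborel. A_star b y d n x * w x)) UNIV"
    using A_star_integral_has_sum(1)[OF w] unfolding char .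
  moreover have "((\<lambda>m. A_star_coeff b y d n m * (if m = 0 then 1 else 0)) has_sum A_star_coeff b y d n 0) UNIV"
    by (rule has_sum_finite_neutralI[of "{0}"]) auto
  ultimately have "complex_of_real (LINT x|lborel. A_star b y d n x * w x) = A_star_coeff b y d n 0"
    by (rule has_sum_unique)
  also have "\<dots> = of_real (\<Prod>j\<in>UNIV. n * d j * (LINT t|lborel. b j t))"
    by (simp add: A_star_coeff_def fourier_transform_0)
  finally have "(LINT x|lborel. A_star b y d n x * w x) = (\<Prod>j\<in>UNIV. n * d j * (LINT t|lborel. b j t))"
    using of_real_eq_iff by blast
  then show ?thesis
    by (simp add: set_lebesgue_integral_def w_def mult.commute)
qed

text \<open>Lattice invariance lets \<open>A_star\<close> be moved under the sum over translates of
  \<open>w\<close>, after which the integral unfolds.\<close>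

lemma A_star_periodisation_integral:
  assumes w: "integrable lborel w" and supp: "\<And>x. K < norm x \<Longrightarrow> w x = 0"
  shows "(LINT x:cbox 0 1|lborel. A_star b y d n x * periodisation w x) = (LINT x|lborel. A_star b y d n x * w x)"
proof -
  define F where "F x = A_star b y d n x * w x" for x
  have "A_star b y d n x * periodisation w x = (\<Sum>\<^sub>\<infinity>a\<in>int_lattice. F (x + a))" for x
  proof -
    have "(\<Sum>\<^sub>\<infinity>a\<in>int_lattice. F (x + a)) = (\<Sum>\<^sub>\<infinity>a\<in>int_lattice. A_star b y d n x * w (x + a))"
      by (rule infsum_cong) (simp add: F_def A_star_periodic)
    then show ?thesis
      by (simp add: infsum_cmult_right' periodisation_eq_lattice_sum)
  qed
  then show ?thesis
    using integral_unit_cube_periodise[of F K] A_star_integral_has_sum(2)[OF w] supp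
    unfolding F_def by (simp add: one_vec_eq_One)
qed

end

section \<open>Fourier transform of \<open>mu\<close>\<close>

lemma lborel_distr_orthogonal:
  fixes Q :: "real^'k::{finite,wellorder}^'k::_"
  assumes Q: "orthogonal_matrix Q"
  shows "distr lborel borel ((*v) Q) = lborel"
proof (rule lborel_eqI[symmetric])
  fix l u :: "real^'k::_" assume le: "\<And>b. b \<in> Basis \<Longrightarrow> l \<bullet> b \<le> u \<bullet> b"
  \<comment> \<open>The preimage of a box under \<open>Q\<close> is its image under the inverse
    \<open>f\<close>, again an orthogonal map, so invariance of measure for images applies.\<close>
  define f where "f = (*v) (transpose Q)"
  have "orthogonal_matrix (transpose Q)" using Q by simp
  then have f: "orthogonal_transformation f"
    by (simp add: f_def orthogonal_transformation_matrix matrix_of_matrix_vector_mul)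
  have inv: "Q *v f x = x" "f (Q *v x) = x" for x
    using Q by (simp_all add: f_def matrix_vector_mul_assoc orthogonal_matrix_def del: transpose_matrix_vector)
  have pre: "(*v) Q -` box l u = f ` box l u"
    using inv by (auto simp: image_iff) metis
  have "open ((*v) Q -` box l u)"
    by (intro open_vimage) (auto intro: matrix_vector_mult_linear_continuous_on)
  then have op: "open (f ` box l u)" using pre by simp
  have bdd: "bounded (f ` box l u)"
    using f by (intro bounded_linear_image) (auto simp: orthogonal_transformation_linear linear_conv_bounded_linear[symmetric])
  have fm: "f ` box l u \<in> lmeasurable"
    using op bdd by (intro bounded_set_imp_lmeasurable) auto
  have "emeasure (distr lborel borel ((*v) Q)) (box l u) = emeasure lborel (f ` box l u)"
    by (subst emeasure_distr) (auto simp: pre borel_measurable_continuous_onI matrix_vector_mult_linear_continuous_on)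
  also have "\<dots> = emeasure lebesgue (f ` box l u)"
    using op by (simp add: borel_open)
  also have "\<dots> = ennreal (measure lebesgue (f ` box l u))"
    using fm by (rule emeasure_eq_measure2)
  also have "measure lebesgue (f ` box l u) = measure lebesgue (box l u)"
    using f by (intro measure_orthogonal_image) auto
  also have "\<dots> = (\<Prod>b\<in>Basis. (u - l) \<bullet> b)"
    using le by (simp add: measure_completion measure_lborel_box_eq)
  finally show "emeasure (distr lborel borel ((*v) Q)) (box l u) = ennreal (\<Prod>b\<in>Basis. (u - l) \<bullet> b)" .
qed simp

lemma lborel_integral_rigid_motion:
  fixes Q :: "real^'k::{finite,wellorder}^'k::_" and F :: "real^'k::_ \<Rightarrow> 'b::{banach, second_countable_topology}"
  assumes Q: "orthogonal_matrix Q" and F: "integrable lborel F"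
  shows "integrable lborel (\<lambda>x. F (Q *v (x - t)))"
    and "(LINT x|lborel. F (Q *v (x - t))) = (LINT x|lborel. F x)"
proof -
  have [measurable]: "F \<in> borel_measurable borel" using F by auto
  have [measurable]: "(*v) Q \<in> borel_measurable borel"
    by (intro borel_measurable_continuous_onI matrix_vector_mult_linear_continuous_on)
  have 1: "integrable lborel (\<lambda>x. F (Q *v x))"
    using F lborel_distr_orthogonal[OF Q] integrable_distr_eq[of "(*v) Q" lborel borel F] by simp
  have 2: "(LINT x|lborel. F (Q *v x)) = (LINT x|lborel. F x)"
    using lborel_distr_orthogonal[OF Q] integral_distr[of "(*v) Q" lborel borel F] by simp
  show "integrable lborel (\<lambda>x. F (Q *v (x - t)))"
    using integrable_lborel_translate[OF 1, of "- t"] by simp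
  show "(LINT x|lborel. F (Q *v (x - t))) = (LINT x|lborel. F x)"
    using lborel_integral_translate[of "\<lambda>x. F (Q *v x)" "- t"] 2 by simp
qed

text \<open>One coordinate of \<open>base_convolution\<close>: box and kernel are both products over
  the coordinates, so the convolution factorises, with \<open>a\<close> and \<open>r\<close> in the
  roles of \<open>B i\<close> and \<open>r i\<close>.\<close>

definition interval_convolution :: "real \<Rightarrow> real \<Rightarrow> (real \<Rightarrow> real) \<Rightarrow> real \<Rightarrow> real"
  where "interval_convolution a r f s = (LINT u|lborel. indicator {- a..a} u * f ((s - u) / r))"

lemma integrable_interval_convolution_integrand:
  assumes f: "test_function f" and r: "0 < r"
  shows "integrable lborel (\<lambda>u. indicator {- a..a} u * f ((s - u) / r))"
proof -
  have "set_integrable lborel {- a..a} (\<lambda>u. f ((s - u) / r))"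
    by (intro borel_integrable_atLeastAtMost' continuous_on_compose2[OF test_function_continuous[OF f, of UNIV]] continuous_intros)
      (use r in auto)
  then show ?thesis by (simp add: set_integrable_def)
qed

lemma base_convolution_eq_prod:
  fixes B r :: "'k::{finite,wellorder} \<Rightarrow> real"
  assumes \<beta>: "\<And>i. test_function (\<beta> i)" and r: "\<And>i. i < last_ix \<Longrightarrow> 0 < r i"
  shows "base_convolution B r \<beta> x = (\<Prod>i<last_ix. interval_convolution (B i) (r i) (\<beta> i) (x i))"
proof -
  interpret product_sigma_finite "\<lambda>_::'k. lborel :: real measure" ..
  have "base_convolution B r \<beta> x = (LINT u | Pi\<^sub>M {..<last_ix} (\<lambda>_. lborel).
      (\<Prod>i<last_ix. indicator {- B i..B i} (u i) * \<beta> i ((x i - u i) / r i)))"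
    unfolding base_convolution_def
  proof (rule Bochner_Integration.integral_cong)
    fix u :: "'k \<Rightarrow> real" assume u: "u \<in> space (Pi\<^sub>M {..<last_ix} (\<lambda>_. lborel))"
    have "(indicator (PiE {..<last_ix} (\<lambda>i. {- B i..B i})) u :: real) = (\<Prod>i<last_ix. indicator {- B i..B i} (u i))"
    proof (cases "\<forall>i<last_ix. u i \<in> {- B i..B i}")
      case True
      then have "u \<in> PiE {..<last_ix} (\<lambda>i. {- B i..B i})"
        using u by (auto simp: space_PiM PiE_iff)
      then show ?thesis using True by (simp add: indicator_def)
    next
      case False
      then obtain i where i: "i < last_ix" "u i \<notin> {- B i..B i}" by blast
      then have "(\<Prod>i<last_ix. indicator {- B i..B i} (u i) :: real) = 0"
        by (intro prod_zero bexI[of _ i]) auto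
      moreover have "u \<notin> PiE {..<last_ix} (\<lambda>i. {- B i..B i})"
        using i by (auto simp: PiE_iff)
      ultimately show ?thesis by simp
    qed
    then show "indicator (PiE {..<last_ix} (\<lambda>i. {- B i..B i})) u * (\<Prod>i<last_ix. \<beta> i ((x i - u i) / r i))
        = (\<Prod>i<last_ix. indicator {- B i..B i} (u i) * \<beta> i ((x i - u i) / r i))"
      by (simp add: prod.distrib)
  qed simp
  also have "\<dots> = (\<Prod>i<last_ix. interval_convolution (B i) (r i) (\<beta> i) (x i))"
    unfolding interval_convolution_def
    by (rule product_integral_prod) (auto intro: integrable_interval_convolution_integrand \<beta> r)
  finally show ?thesis .
qed

lemma interval_convolution_eq_0:
  assumes f: "test_function f" and r: "0 < r" and "a + 2 * r < \<bar>s\<bar>"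
  shows "interval_convolution a r f s = 0"
proof -
  have "indicator {- a..a} u * f ((s - u) / r) = 0" for u
  proof (cases "u \<in> {- a..a}")
    case True
    then have "2 * r < \<bar>s - u\<bar>" using assms(3) by auto
    then have "2 < \<bar>(s - u) / r\<bar>" using r by (simp add: field_simps)
    then show ?thesis using f unfolding test_function_def by simp
  qed simp
  then show ?thesis unfolding interval_convolution_def by (simp only: integral_zero)
qed

lemma interval_convolution_nonneg:
  assumes "\<And>x. 0 \<le> f x"
  shows "0 \<le> interval_convolution a r f s"
  unfolding interval_convolution_def by (intro Bochner_Integration.integral_nonneg) (simp add: assms)

text \<open>The convolution theorem: Fubini, then the substitution \<open>s = u + r * x\<close> in
  the inner integral.\<close>

lemma fourier_transform_interval_convolution:
  assumes f: "test_function f" and r: "0 < r" and a: "0 \<le> a"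
  shows "integrable lborel (interval_convolution a r f)"
    and "fourier_transform (interval_convolution a r f) \<xi>
      = (LINT u|lborel. indicator {- a..a} u * cis (- (2 * pi * \<xi> * u))) * (r * fourier_transform f (r * \<xi>))"
proof -
  define g where "g \<xi> u s = complex_of_real (indicator {- a..a} u * f ((s - u) / r)) * cis (- (2 * pi * \<xi> * s))" for \<xi> u s
  have g_int: "integrable (lborel \<Otimes>\<^sub>M lborel) (case_prod (g \<xi>))" for \<xi>
  proof -
    define h where "h p = complex_of_real (f ((snd p - fst p) / r)) * cis (- (2 * pi * \<xi> * snd p))" for p :: "real \<times> real"
    \<comment> \<open>If \<open>u\<close> lies in \<open>{- a..a}\<close> and \<open>s - u\<close>
      has size at most \<open>2 * r\<close>, then \<open>s\<close> has size at most
      \<open>a + 2 * r\<close>; hence the integrand vanishes off this compact rectangle.\<close>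
    define K where "K = {- a..a} \<times> {- (a + 2 * r)..a + 2 * r}"
    have "integrable lborel (\<lambda>p. indicator K p *\<^sub>R h p)"
    proof (rule borel_integrable_compact)
      show "compact K" unfolding K_def by (intro compact_Times compact_Icc)
      show "continuous_on K h" unfolding h_def
        by (intro continuous_intros continuous_on_compose2[OF test_function_continuous[OF f, of UNIV]]) (use r in auto)
    qed
    moreover have "(\<lambda>p. indicator K p *\<^sub>R h p) = case_prod (g \<xi>)"
    proof
      fix p :: "real \<times> real"
      have "f ((snd p - fst p) / r) = 0" if "fst p \<in> {- a..a}" "snd p \<notin> {- (a + 2 * r)..a + 2 * r}"
      proof -
        have "2 * r < \<bar>snd p - fst p\<bar>" using that by auto
        then have "2 < \<bar>(snd p - fst p) / r\<bar>" using r by (simp add: field_simps)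
        then show ?thesis using f unfolding test_function_def by simp
      qed
      then show "indicator K p *\<^sub>R h p = case_prod (g \<xi>) p"
        by (cases p) (auto simp: K_def h_def g_def indicator_def)
    qed
    ultimately show ?thesis by (simp add: lborel_prod)
  qed
  have conv: "(LINT u|lborel. g \<xi> u s) = of_real (interval_convolution a r f s) * cis (- (2 * pi * \<xi> * s))" for \<xi> s
    unfolding g_def interval_convolution_def by (simp del: of_real_mult)
  show "integrable lborel (interval_convolution a r f)"
    using lborel_pair.integrable_snd[OF g_int[of 0]] unfolding conv by (simp add: complex_of_real_integrable_eq)
  have inner: "(LINT s|lborel. g \<xi> u s) = indicator {- a..a} u * cis (- (2 * pi * \<xi> * u)) * (r * fourier_transform f (r * \<xi>))" for u
  proof -
    have "(LINT s|lborel. g \<xi> u s) = r *\<^sub>R (LINT x|lborel. g \<xi> u (u + r * x))"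
      using lborel_integral_real_affine[of r "g \<xi> u" u] r by simp
    also have "(\<lambda>x. g \<xi> u (u + r * x)) = (\<lambda>x. (indicator {- a..a} u * cis (- (2 * pi * \<xi> * u))) *
        (of_real (f x) * cis (- (2 * pi * (r * \<xi>) * x))))"
    proof
      fix x
      have "cis (- (2 * pi * \<xi> * (u + r * x))) = cis (- (2 * pi * \<xi> * u)) * cis (- (2 * pi * (r * \<xi>) * x))"
        by (simp add: cis_mult algebra_simps)
      then show "g \<xi> u (u + r * x) = (indicator {- a..a} u * cis (- (2 * pi * \<xi> * u))) *
          (of_real (f x) * cis (- (2 * pi * (r * \<xi>) * x)))"
        using r by (simp add: g_def of_real_indicator)
    qed
    also have "(LINT x|lborel. (indicator {- a..a} u * cis (- (2 * pi * \<xi> * u))) *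
        (of_real (f x) * cis (- (2 * pi * (r * \<xi>) * x))))
      = (indicator {- a..a} u * cis (- (2 * pi * \<xi> * u))) * fourier_transform f (r * \<xi>)"
      unfolding fourier_transform_def by (rule integral_mult_right_zero)
    finally show ?thesis by (simp add: scaleR_conv_of_real mult_ac)
  qed
  have "fourier_transform (interval_convolution a r f) \<xi> = (LINT s|lborel. (LINT u|lborel. g \<xi> u s))"
    unfolding conv fourier_transform_def ..
  also have "\<dots> = (LINT u|lborel. (LINT s|lborel. g \<xi> u s))"
    by (rule lborel_pair.Fubini_integral[OF g_int])
  also have "\<dots> = (LINT u|lborel. indicator {- a..a} u * cis (- (2 * pi * \<xi> * u))) * (r * fourier_transform f (r * \<xi>))"
    unfolding inner by (rule integral_mult_left_zero)
  finally show "fourier_transform (interval_convolution a r f) \<xi>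
      = (LINT u|lborel. indicator {- a..a} u * cis (- (2 * pi * \<xi> * u))) * (r * fourier_transform f (r * \<xi>))" .
qed

lemma interval_convolution_integral:
  assumes f: "test_function f" and r: "0 < r" and a: "0 \<le> a"
  shows "(LINT s|lborel. interval_convolution a r f s) = 2 * a * r * (LINT x|lborel. f x)"
proof -
  have "(LINT u|lborel. indicator {- a..a} u :: complex) = of_real (2 * a)"
  proof -
    have "(LINT u|lborel. complex_of_real (indicator {- a..a} u)) = of_real (LINT u|lborel. indicator {- a..a} u)"
      by (rule integral_complex_of_real)
    then show ?thesis using a by (simp add: of_real_indicator)
  qed
  then have "complex_of_real (LINT s|lborel. interval_convolution a r f s) = of_real (2 * a * r * (LINT x|lborel. f x))"
    using fourier_transform_interval_convolution(2)[OF assms, of 0] by (simp add: fourier_transform_0)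
  then show ?thesis using of_real_eq_iff by blast
qed

text \<open>The interval contributes only its length, so all decay comes from the bump. The
  prefactor \<open>2 * a * r\<close> also occurs in the total mass and cancels on
  normalisation.\<close>

lemma fourier_transform_interval_convolution_norm_le:
  assumes f: "test_function f" and r: "0 < r" and a: "0 \<le> a"
  shows "norm (fourier_transform (interval_convolution a r f) \<xi>) \<le> 2 * a * r * norm (fourier_transform f (r * \<xi>))"
proof -
  have "norm (LINT u|lborel. indicator {- a..a} u * cis (- (2 * pi * \<xi> * u)))
      \<le> (LINT u|lborel. norm (indicator {- a..a} u * cis (- (2 * pi * \<xi> * u))))"
    by (rule integral_norm_bound)
  also have "\<dots> = (LINT u|lborel. indicator {- a..a} u)"
    by (intro Bochner_Integration.integral_cong) (auto simp: norm_mult indicator_def)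
  also have "\<dots> = 2 * a" using a by simp
  finally have "norm (LINT u|lborel. indicator {- a..a} u * cis (- (2 * pi * \<xi> * u))) * (r * norm (fourier_transform f (r * \<xi>)))
      \<le> 2 * a * (r * norm (fourier_transform f (r * \<xi>)))"
    using r by (intro mult_right_mono) auto
  then show ?thesis
    using r by (simp add: fourier_transform_interval_convolution(2)[OF assms] norm_mult mult_ac)
qed


text \<open>The coordinate factors of \<open>mu_dagger_raw\<close>; only the one at
  \<open>last_ix\<close>, transverse to the hyperplane, contains \<eta>.\<close>

definition mu_factor ::
    "('k::{finite,wellorder} \<Rightarrow> real) \<Rightarrow> ('k \<Rightarrow> real) \<Rightarrow> ('k \<Rightarrow> real \<Rightarrow> real) \<Rightarrow> real \<Rightarrow> 'k \<Rightarrow> real \<Rightarrow> real"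
  where "mu_factor B r \<beta> \<eta> j =
    (if j = last_ix then \<lambda>s. \<beta> last_ix (s / \<eta>) else interval_convolution (B j) (r j) (\<beta> j))"

lemma le_last_ix: "(j::'k::{finite,wellorder}) \<le> last_ix"
  by (simp add: last_ix_def)

context
  fixes B r :: "'k::{finite,wellorder} \<Rightarrow> real" and \<beta> :: "'k \<Rightarrow> real \<Rightarrow> real" and \<eta> :: real
  assumes B: "\<And>i. i < last_ix \<Longrightarrow> 0 < B i" and r: "\<And>i. i < last_ix \<Longrightarrow> 0 < r i"
    and \<beta>: "\<And>i. bump_function (\<beta> i)" and \<eta>: "0 < \<eta>"
begin

lemma less_last_ix: "j \<noteq> last_ix \<Longrightarrow> j < (last_ix :: 'k)"
  using le_last_ix by (simp add: less_le)

lemma mu_dagger_raw_eq_prod: "mu_dagger_raw B r \<beta> \<eta> x = (\<Prod>j\<in>UNIV. mu_factor B r \<beta> \<eta> j (x $ j))"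
proof -
  have UNIV: "(UNIV :: 'k set) = insert last_ix {..<last_ix}"
    using less_last_ix by auto
  have "(\<Prod>j<last_ix. interval_convolution (B j) (r j) (\<beta> j) (x $ j)) = (\<Prod>j<last_ix. mu_factor B r \<beta> \<eta> j (x $ j))"
    by (rule prod.cong) (auto simp: mu_factor_def)
  moreover have "mu_factor B r \<beta> \<eta> last_ix (x $ last_ix) = \<beta> last_ix (x $ last_ix / \<eta>)"
    by (simp add: mu_factor_def)
  ultimately show ?thesis
    unfolding mu_dagger_raw_def UNIV
    by (simp add: base_convolution_eq_prod bump_function_test_function \<beta> r mult.commute)
qed

lemma mu_factor_integrable: "integrable lborel (mu_factor B r \<beta> \<eta> j)"
proof (cases "j = last_ix")
  case True
  have "integrable lborel (\<lambda>s. \<beta> last_ix (0 + (1 / \<eta>) * s))"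
    by (rule lborel_integrable_real_affine) (use \<eta> in \<open>auto intro: test_function_integrable(1) bump_function_test_function \<beta>\<close>)
  then show ?thesis using True by (simp add: mu_factor_def)
next
  case False
  then show ?thesis
    using fourier_transform_interval_convolution(1)[OF bump_function_test_function[OF \<beta>] r, of j "B j" j] B less_last_ix[of j]
    by (simp add: mu_factor_def less_imp_le)
qed

lemma mu_factor_nonneg: "0 \<le> mu_factor B r \<beta> \<eta> j s"
  by (simp add: mu_factor_def interval_convolution_nonneg bump_function_range(1) \<beta>)

lemma mu_factor_integral_less_last:
  "j \<noteq> last_ix \<Longrightarrow> integral\<^sup>L lborel (mu_factor B r \<beta> \<eta> j) = 2 * B j * r j * (LINT x|lborel. \<beta> j x)"
  using interval_convolution_integral[OF bump_function_test_function[OF \<beta>] r, of j "B j" j] B less_last_ix[of j]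
  by (simp add: mu_factor_def less_imp_le)

lemma mu_factor_integral_pos: "0 < integral\<^sup>L lborel (mu_factor B r \<beta> \<eta> j)"
proof (cases "j = last_ix")
  case True
  have "(LINT s|lborel. \<beta> last_ix s) = (1 / \<eta>) * (LINT s|lborel. \<beta> last_ix (s / \<eta>))"
    using lborel_integral_real_affine[of "1 / \<eta>" "\<beta> last_ix" 0] \<eta> by simp
  then have "0 < (1 / \<eta>) * (LINT s|lborel. \<beta> last_ix (s / \<eta>))"
    using bump_function_integral_pos[OF \<beta>] by metis
  then show ?thesis using \<eta> True by (simp add: mu_factor_def zero_less_divide_iff)
next
  case False
  then show ?thesis
    using bump_function_integral_pos[OF \<beta>] B r less_last_ix[of j]
    by (simp add: mu_factor_integral_less_last)
qed

lemma mu_dagger_raw_integrable: "integrable lborel (mu_dagger_raw B r \<beta> \<eta>)"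
  unfolding mu_dagger_raw_eq_prod[abs_def] by (rule lborel_integral_prod_vec(2)[OF mu_factor_integrable])

lemma mu_dagger_raw_integral:
  "(LINT z|lborel. mu_dagger_raw B r \<beta> \<eta> z) = (\<Prod>j\<in>UNIV. integral\<^sup>L lborel (mu_factor B r \<beta> \<eta> j))"
  unfolding mu_dagger_raw_eq_prod[abs_def] by (rule lborel_integral_prod_vec(1)[OF mu_factor_integrable])

lemma mu_dagger_raw_bounded_support: "\<exists>K. \<forall>x. K < norm x \<longrightarrow> mu_dagger_raw B r \<beta> \<eta> x = 0"
proof -
  define b where "b j = (if j = last_ix then 2 * \<eta> else B j + 2 * r j)" for j
  have zero: "mu_factor B r \<beta> \<eta> j s = 0" if "b j < \<bar>s\<bar>" for j s
  proof (cases "j = last_ix")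
    case True
    then have "2 < \<bar>s / \<eta>\<bar>" using that \<eta> by (simp add: b_def field_simps)
    then show ?thesis
      using bump_function_test_function[OF \<beta>] True by (simp add: mu_factor_def test_function_def)
  next
    case False
    then show ?thesis
      using that interval_convolution_eq_0[OF bump_function_test_function[OF \<beta>] r] less_last_ix[of j]
      by (simp add: mu_factor_def b_def)
  qed
  have "mu_dagger_raw B r \<beta> \<eta> x = 0" if "sum b UNIV < norm x" for x
  proof -
    have "norm x \<le> (\<Sum>j\<in>UNIV. \<bar>x $ j\<bar>)" by (rule norm_le_l1_cart)
    then have "\<not> (\<forall>j. \<bar>x $ j\<bar> \<le> b j)"
      using that sum_mono[of UNIV "\<lambda>j. \<bar>x $ j\<bar>" b] by auto
    then obtain j where "b j < \<bar>x $ j\<bar>" by (auto simp: not_le)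
    then show ?thesis
      unfolding mu_dagger_raw_eq_prod by (intro prod_zero bexI[of _ j]) (auto intro: zero)
  qed
  then show ?thesis by blast
qed

lemma mu_dagger_raw_fourier:
  "(LINT z|lborel. vec_char \<zeta> z * of_real (mu_dagger_raw B r \<beta> \<eta> z))
    = (\<Prod>j\<in>UNIV. fourier_transform (mu_factor B r \<beta> \<eta> j) (- (\<zeta> $ j)))"
proof -
  have int: "integrable lborel (\<lambda>s. cis (2 * pi * \<zeta> $ j * s) * of_real (mu_factor B r \<beta> \<eta> j s))" for j
  proof (rule Bochner_Integration.integrable_bound[OF mu_factor_integrable[of j]])
    have [measurable]: "(\<lambda>s. cis (2 * pi * \<zeta> $ j * s)) \<in> borel_measurable borel"
      by (intro borel_measurable_continuous_onI continuous_intros)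
    have [measurable]: "mu_factor B r \<beta> \<eta> j \<in> borel_measurable borel"
      using mu_factor_integrable[of j] by auto
    show "(\<lambda>s. cis (2 * pi * \<zeta> $ j * s) * of_real (mu_factor B r \<beta> \<eta> j s)) \<in> borel_measurable lborel"
      by measurable
  qed (auto simp: norm_mult)
  have "(LINT z|lborel. vec_char \<zeta> z * of_real (mu_dagger_raw B r \<beta> \<eta> z))
      = (LINT z|lborel. (\<Prod>j\<in>UNIV. cis (2 * pi * \<zeta> $ j * z $ j) * of_real (mu_factor B r \<beta> \<eta> j (z $ j))))"
    by (simp add: vec_char_eq_prod mu_dagger_raw_eq_prod prod.distrib)
  also have "\<dots> = (\<Prod>j\<in>UNIV. (LINT s|lborel. cis (2 * pi * \<zeta> $ j * s) * of_real (mu_factor B r \<beta> \<eta> j s)))"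
    by (rule lborel_integral_prod_vec(1)[OF int])
  finally show ?thesis
    by (simp add: fourier_transform_def mult.commute)
qed

text \<open>The factors are nonnegative, so each normalised transform has modulus at most 1,
  whatever \<eta> is.\<close>

lemma fourier_transform_mu_factor_norm_le:
  "norm (fourier_transform (mu_factor B r \<beta> \<eta> j) \<xi>) \<le> integral\<^sup>L lborel (mu_factor B r \<beta> \<eta> j)"
proof -
  have "norm (fourier_transform (mu_factor B r \<beta> \<eta> j) \<xi>)
      \<le> (LINT x|lborel. norm (of_real (mu_factor B r \<beta> \<eta> j x) * cis (- (2 * pi * \<xi> * x))))"
    unfolding fourier_transform_def by (rule integral_norm_bound)
  then show ?thesis by (simp add: norm_mult mu_factor_nonneg)
qed

context
  fixes R :: "real^'k::_^'k::_" and t :: "real^'k::_"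
  assumes R: "orthogonal_matrix R"
begin

lemma matrix_inv_orthogonal: "matrix_inv R = transpose R"
proof -
  have "R ** transpose R = mat 1 \<and> transpose R ** R = mat 1"
    using R unfolding orthogonal_matrix_def by blast
  then have "matrix_inv R ** R = mat 1"
    unfolding matrix_inv_def by (metis (mono_tags, lifting) someI_ex)
  then show ?thesis
    using R unfolding orthogonal_matrix_def
    by (metis matrix_mul_assoc matrix_mul_lid matrix_mul_rid)
qed

lemma mu_eq: "mu B r \<beta> R t \<eta> x = mu_dagger_raw B r \<beta> \<eta> (transpose R *v (x - t)) / (LINT z|lborel. mu_dagger_raw B r \<beta> \<eta> z)"
  unfolding mu_def mu_dagger_def matrix_inv_orthogonal ..

lemma mu_integrable: "integrable lborel (mu B r \<beta> R t \<eta>)"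
  unfolding mu_eq[abs_def]
  using lborel_integral_rigid_motion(1)[OF _ mu_dagger_raw_integrable, of "transpose R" t] R
  by (auto simp del: transpose_matrix_vector)

lemma mu_bounded_support: "\<exists>K. \<forall>x. K < norm x \<longrightarrow> mu B r \<beta> R t \<eta> x = 0"
proof -
  obtain K where K: "\<And>x. K < norm x \<Longrightarrow> mu_dagger_raw B r \<beta> \<eta> x = 0"
    using mu_dagger_raw_bounded_support by blast
  have "orthogonal_matrix (transpose R)" using R by simp
  then have norm: "norm (transpose R *v x) = norm x" for x
    by (intro orthogonal_transformation_norm)
      (simp add: orthogonal_transformation_matrix matrix_of_matrix_vector_mul del: transpose_matrix_vector)
  have "mu B r \<beta> R t \<eta> x = 0" if "K + norm t < norm x" for x
  proof -
    have "K < norm (x - t)" using that norm_triangle_ineq2[of x t] by linarith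
    then show ?thesis unfolding mu_eq by (subst K) (auto simp: norm simp del: transpose_matrix_vector)
  qed
  then show ?thesis by blast
qed

lemma mu_integral: "(LINT x|lborel. mu B r \<beta> R t \<eta> x) = 1"
proof -
  have "(LINT x|lborel. mu_dagger_raw B r \<beta> \<eta> (transpose R *v (x - t))) = (LINT z|lborel. mu_dagger_raw B r \<beta> \<eta> z)"
    using R by (intro lborel_integral_rigid_motion(2) mu_dagger_raw_integrable) simp
  moreover have "(LINT z|lborel. mu_dagger_raw B r \<beta> \<eta> z) \<noteq> 0"
    using mu_factor_integral_pos by (simp add: mu_dagger_raw_integral less_imp_neq[symmetric])
  ultimately show ?thesis
    unfolding mu_eq by (simp del: transpose_matrix_vector)
qed

text \<open>Under the rigid motion the translation contributes a phase of modulus 1 and the rotation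
  carries the frequency back to \<open>transpose R *v \<xi>\<close>, where the transform of a
  product density factorises.\<close>

lemma mu_fourier_norm:
  "norm (LINT x|lborel. vec_char \<xi> x * of_real (mu B r \<beta> R t \<eta> x))
    = (\<Prod>j\<in>UNIV. norm (fourier_transform (mu_factor B r \<beta> \<eta> j) (- ((transpose R *v \<xi>) $ j)))
        / integral\<^sup>L lborel (mu_factor B r \<beta> \<eta> j))"
proof -
  define \<zeta> where "\<zeta> = transpose R *v \<xi>"
  define Z where "Z = (LINT z|lborel. mu_dagger_raw B r \<beta> \<eta> z)"
  define G where "G z = vec_char \<zeta> z * of_real (mu_dagger_raw B r \<beta> \<eta> z)" for z
  have G_int: "integrable lborel G"
  proof (rule Bochner_Integration.integrable_bound[OF mu_dagger_raw_integrable])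
    have [measurable]: "mu_dagger_raw B r \<beta> \<eta> \<in> borel_measurable borel"
      using mu_dagger_raw_integrable by auto
    show "G \<in> borel_measurable lborel" unfolding G_def by measurable
  qed (auto simp: G_def norm_mult vec_char_def)
  have inner: "\<zeta> \<bullet> (transpose R *v v) = \<xi> \<bullet> v" for v
  proof -
    have "orthogonal_transformation ((*v) (transpose R))"
      using R by (simp add: orthogonal_transformation_matrix matrix_of_matrix_vector_mul del: transpose_matrix_vector)
    then show ?thesis unfolding \<zeta>_def orthogonal_transformation_def by blast
  qed
  have "vec_char \<xi> x * of_real (mu B r \<beta> R t \<eta> x) = vec_char \<xi> t / of_real Z * G (transpose R *v (x - t))" for x
  proof -
    have "vec_char \<xi> x = vec_char \<xi> t * vec_char \<zeta> (transpose R *v (x - t))"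
      unfolding vec_char_def inner by (simp add: cis_mult inner_diff_right algebra_simps)
    then show ?thesis by (simp add: mu_eq G_def Z_def del: transpose_matrix_vector)
  qed
  then have "(LINT x|lborel. vec_char \<xi> x * of_real (mu B r \<beta> R t \<eta> x))
      = vec_char \<xi> t / of_real Z * (LINT x|lborel. G (transpose R *v (x - t)))"
    by (simp only: integral_mult_right_zero)
  also have "(LINT x|lborel. G (transpose R *v (x - t))) = (LINT z|lborel. G z)"
    using R by (intro lborel_integral_rigid_motion(2) G_int) simp
  also have "norm (vec_char \<xi> t / of_real Z * (LINT z|lborel. G z))
      = (\<Prod>j\<in>UNIV. norm (fourier_transform (mu_factor B r \<beta> \<eta> j) (- (\<zeta> $ j)))) / \<bar>Z\<bar>"
    unfolding G_def mu_dagger_raw_fourier by (simp add: norm_mult norm_divide vec_char_def prod_norm)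
  also have "\<bar>Z\<bar> = (\<Prod>j\<in>UNIV. integral\<^sup>L lborel (mu_factor B r \<beta> \<eta> j))"
    unfolding Z_def mu_dagger_raw_integral by (intro abs_of_nonneg prod_nonneg) (auto intro: less_imp_le mu_factor_integral_pos)
  finally show ?thesis unfolding \<zeta>_def by (simp only: prod_dividef)
qed

text \<open>Of the normalised factors only the tangential one at \<open>i\<close> is kept and the
  others are bounded by 1. In that quotient \<open>B i\<close> cancels and \<eta> does not
  occur.\<close>

lemma mu_fourier_norm_le:
  assumes "i \<noteq> last_ix"
  shows "norm (LINT x|lborel. vec_char \<xi> x * of_real (mu B r \<beta> R t \<eta> x))
    \<le> norm (fourier_transform (\<beta> i) (- (r i * (transpose R *v \<xi>) $ i))) / (LINT x|lborel. \<beta> i x)"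
proof -
  define f where "f j = norm (fourier_transform (mu_factor B r \<beta> \<eta> j) (- ((transpose R *v \<xi>) $ j)))
        / integral\<^sup>L lborel (mu_factor B r \<beta> \<eta> j)" for j
  have f: "0 \<le> f j" "f j \<le> 1" for j
    using mu_factor_integral_pos[of j] fourier_transform_mu_factor_norm_le[of j]
    by (auto simp: f_def simp del: transpose_matrix_vector)
  have i: "i < last_ix" using assms less_last_ix by blast
  have "norm (LINT x|lborel. vec_char \<xi> x * of_real (mu B r \<beta> R t \<eta> x)) = f i * prod f (UNIV - {i})"
    unfolding mu_fourier_norm f_def[symmetric] by (rule prod.remove) auto
  also have "\<dots> \<le> f i * 1"
    by (intro mult_left_mono prod_le_1) (use f in auto)
  also have "f i \<le> (2 * B i * r i * norm (fourier_transform (\<beta> i) (r i * - ((transpose R *v \<xi>) $ i))))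
      / (2 * B i * r i * (LINT x|lborel. \<beta> i x))"
    unfolding f_def mu_factor_integral_less_last[OF assms]
    using assms B[OF i] r[OF i] bump_function_integral_pos[OF \<beta>, of i]
      fourier_transform_interval_convolution_norm_le[OF bump_function_test_function[OF \<beta>] r[OF i],
        of "B i" i "- ((transpose R *v \<xi>) $ i)"]
    by (intro divide_right_mono) (auto simp: mu_factor_def simp del: transpose_matrix_vector)
  also have "\<dots> = norm (fourier_transform (\<beta> i) (- (r i * (transpose R *v \<xi>) $ i))) / (LINT x|lborel. \<beta> i x)"
    using B[OF i] r[OF i] by (simp del: transpose_matrix_vector)
  finally show ?thesis by simp
qed

end

end

section \<open>Decay estimates and Diophantine approximation\<close>

text \<open>A vector \<open>w\<close> orthogonal to the normal is rotated to \<open>v\<close> with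
  last coordinate 0, so \<open>w \<bullet> \<xi>\<close> involves only the tangential coordinates of
  the rotated frequency. The largest of these is then at least
  \<open>\<bar>w \<bullet> \<xi>\<bar>\<close> over \<open>CARD('k) * norm w\<close> when
  \<open>w\<close> is nonzero, and decay is taken in that coordinate. Testing against
  \<open>w\<close> lets the bound be expressed by integer linear forms later.\<close>

lemma mu_fourier_decay:
  fixes B r :: "'k::{finite,wellorder} \<Rightarrow> real" and \<beta> :: "'k \<Rightarrow> real \<Rightarrow> real" and M :: nat
  assumes B: "\<And>i. i < last_ix \<Longrightarrow> 0 < B i" and r: "\<And>i. i < last_ix \<Longrightarrow> 0 < r i"
    and \<beta>: "\<And>i. bump_function (\<beta> i)" and card: "2 \<le> CARD('k)"
  obtains C where "0 \<le> C"
    "\<And>\<eta> (R :: real^'k::_^'k::_) t \<xi> w. 0 < \<eta> \<Longrightarrow> orthogonal_matrix R \<Longrightarrow> (R *v axis last_ix 1) \<bullet> w = 0 \<Longrightarrow>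
      norm (LINT x|lborel. vec_char \<xi> x * of_real (mu B r \<beta> R t \<eta> x))
        \<le> C * (1 + CARD('k) * norm w) ^ M / (1 + \<bar>w \<bullet> \<xi>\<bar>) ^ M"
proof -
  define I where "I = UNIV - {last_ix :: 'k}"
  have I: "finite I" "I \<noteq> {}"
  proof -
    show "I \<noteq> {}"
    proof
      assume "I = {}"
      then have "(UNIV :: 'k set) = {last_ix}" unfolding I_def by auto
      then have "CARD('k) = 1" by (metis card_1_singleton_iff One_nat_def)
      then show False using card by simp
    qed
  qed (simp add: I_def)
  have "\<exists>c. \<forall>\<xi>. norm (fourier_transform (\<beta> i) \<xi>) \<le> c / (1 + \<bar>\<xi>\<bar>) ^ M" for i
    using fourier_transform_decay[OF bump_function_test_function[OF \<beta>], of i M] by blast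
  then obtain c where c: "\<And>i \<xi>. norm (fourier_transform (\<beta> i) \<xi>) \<le> c i / (1 + \<bar>\<xi>\<bar>) ^ M"
    by metis
  have c0: "0 \<le> c i" for i using order.trans[OF norm_ge_zero c[of i 0]] by simp
  define b where "b i = (LINT x|lborel. \<beta> i x)" for i
  have b: "0 < b i" for i unfolding b_def by (rule bump_function_integral_pos[OF \<beta>])
  \<comment> \<open>Removes the scale of the bump:
    \<open>1 + \<bar>z\<bar> \<le> s i * (1 + \<bar>r i * z\<bar>)\<close>.\<close>
  define s where "s i = 1 + 1 / r i" for i
  have less: "i < last_ix" if "i \<in> I" for i using that le_last_ix[of i] by (auto simp: I_def)
  have s: "0 < s i" if "i \<in> I" for i using r[OF less[OF that]] by (simp add: s_def add_pos_pos)
  define D where "D i = c i * s i ^ M / b i" for i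
  have D0: "0 \<le> D i" if "i \<in> I" for i
    using c0[of i] s[OF that] b[of i] by (simp add: D_def)
  \<comment> \<open>The coordinate that is used depends on \<xi> and \<open>R\<close>; summing over
    all of them makes the constant independent of both.\<close>
  define C where "C = sum D I"
  have C0: "0 \<le> C" unfolding C_def using D0 by (rule sum_nonneg)
  have "norm (LINT x|lborel. vec_char \<xi> x * of_real (mu B r \<beta> R t \<eta> x))
      \<le> C * (1 + CARD('k) * norm w) ^ M / (1 + \<bar>w \<bullet> \<xi>\<bar>) ^ M"
    if \<eta>: "0 < \<eta>" and R: "orthogonal_matrix R" and w: "(R *v axis last_ix 1) \<bullet> w = 0"
    for \<eta> and R :: "real^'k::_^'k::_" and t \<xi> w
  proof -
    define \<zeta> where "\<zeta> = transpose R *v \<xi>"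
    define v where "v = transpose R *v w"
    have ot: "orthogonal_transformation ((*v) (transpose R))"
      using R by (simp add: orthogonal_transformation_matrix matrix_of_matrix_vector_mul del: transpose_matrix_vector)
    have inner: "v \<bullet> \<zeta> = w \<bullet> \<xi>"
      using ot unfolding v_def \<zeta>_def orthogonal_transformation_def by blast
    have v_norm: "\<bar>v $ i\<bar> \<le> norm w" for i
      using component_le_norm_cart[of v i] orthogonal_transformation_norm[OF ot] unfolding v_def by metis
    have v_last: "v $ last_ix = 0"
    proof -
      have "v $ last_ix = axis last_ix 1 \<bullet> (transpose R *v w)"
        unfolding v_def by (simp add: inner_axis' del: transpose_matrix_vector)
      also have "\<dots> = (R *v axis last_ix 1) \<bullet> w"
        using dot_lmul_matrix[of "axis last_ix 1" "transpose R" w] by (simp add: inner_commute)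
      finally show ?thesis using w by simp
    qed
    define Q where "Q = Max ((\<lambda>i. \<bar>\<zeta> $ i\<bar>) ` I)"
    have "Q \<in> (\<lambda>i. \<bar>\<zeta> $ i\<bar>) ` I" unfolding Q_def by (intro Max_in) (use I in auto)
    then obtain i where i: "i \<in> I" "Q = \<bar>\<zeta> $ i\<bar>" by blast
    have Q: "\<bar>\<zeta> $ j\<bar> \<le> \<bar>\<zeta> $ i\<bar>" if "j \<in> I" for j
      unfolding i(2)[symmetric] Q_def using I that by (intro Max_ge) auto
    have "\<bar>w \<bullet> \<xi>\<bar> = \<bar>\<Sum>j\<in>I. v $ j * \<zeta> $ j\<bar>"
      using v_last sum.remove[of UNIV last_ix "\<lambda>j. v $ j * \<zeta> $ j"]
      unfolding inner[symmetric] by (simp add: inner_vec_def I_def)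
    also have "\<dots> \<le> (\<Sum>j\<in>I. norm w * \<bar>\<zeta> $ i\<bar>)"
      by (intro order.trans[OF sum_abs] sum_mono) (auto simp: abs_mult intro!: mult_mono v_norm Q)
    also have "\<dots> \<le> CARD('k) * (norm w * \<bar>\<zeta> $ i\<bar>)"
      unfolding sum_constant by (intro mult_right_mono) (auto simp: I_def card_Diff_singleton)
    finally have wx: "\<bar>w \<bullet> \<xi>\<bar> \<le> CARD('k) * norm w * \<bar>\<zeta> $ i\<bar>" by simp
    have ri: "0 < r i" using r less i(1) by blast
    have "1 + \<bar>w \<bullet> \<xi>\<bar> \<le> (1 + CARD('k) * norm w) * (1 + \<bar>\<zeta> $ i\<bar>)"
    proof -
      have "1 + x \<le> (1 + a) * (1 + z)" if "x \<le> a * z" "0 \<le> a" "0 \<le> z" for a x z :: real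
        using that by (simp add: distrib_left distrib_right)
      from this[OF wx] show ?thesis by simp
    qed
    also have "1 + \<bar>\<zeta> $ i\<bar> \<le> s i * (1 + \<bar>r i * \<zeta> $ i\<bar>)"
      using ri by (simp add: s_def abs_mult distrib_left distrib_right)
    finally have "1 + \<bar>w \<bullet> \<xi>\<bar> \<le> (1 + CARD('k) * norm w) * (s i * (1 + \<bar>r i * \<zeta> $ i\<bar>))"
      by (simp add: mult_left_mono add_nonneg_nonneg)
    then have le: "(1 + \<bar>w \<bullet> \<xi>\<bar>) ^ M \<le> ((1 + CARD('k) * norm w) * (s i * (1 + \<bar>r i * \<zeta> $ i\<bar>))) ^ M"
      by (intro power_mono) auto
    have "norm (LINT x|lborel. vec_char \<xi> x * of_real (mu B r \<beta> R t \<eta> x))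
        \<le> norm (fourier_transform (\<beta> i) (- (r i * \<zeta> $ i))) / b i"
      unfolding \<zeta>_def b_def by (rule mu_fourier_norm_le[OF B r \<beta> \<eta> R]) (use i in \<open>auto simp: I_def\<close>)
    also have "\<dots> \<le> (c i / (1 + \<bar>r i * \<zeta> $ i\<bar>) ^ M) / b i"
      using c[of i "- (r i * \<zeta> $ i)"] b[of i] by (intro divide_right_mono) auto
    also have "\<dots> \<le> D i * (1 + CARD('k) * norm w) ^ M / (1 + \<bar>w \<bullet> \<xi>\<bar>) ^ M"
    proof -
      have "c i * (1 + \<bar>w \<bullet> \<xi>\<bar>) ^ M \<le> c i * ((1 + CARD('k) * norm w) * (s i * (1 + \<bar>r i * \<zeta> $ i\<bar>))) ^ M"
        using le c0 by (rule mult_left_mono)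
      then show ?thesis
        using b[of i] unfolding D_def
        by (simp add: divide_simps power_mult_distrib add_pos_nonneg mult_ac)
    qed
    also have "\<dots> \<le> C * (1 + CARD('k) * norm w) ^ M / (1 + \<bar>w \<bullet> \<xi>\<bar>) ^ M"
      unfolding C_def using member_le_sum[OF i(1), of D] D0 I(1)
      by (intro divide_right_mono mult_right_mono) auto
    finally show ?thesis .
  qed
  then show ?thesis using that C0 by blast
qed

section \<open>From the simultaneous exponent to a Diophantine lower bound\<close>

lemma dist_nearest_int_le: "dist_nearest_int x \<le> \<bar>x - of_int p\<bar>"
  unfolding dist_nearest_int_def using infdist_le[of "of_int p" \<int> x] by (simp add: dist_real_def)

lemma dist_nearest_int_eq_0_iff: "dist_nearest_int x = 0 \<longleftrightarrow> x \<in> \<int>"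
  unfolding dist_nearest_int_def using in_closed_iff_infdist_zero[of "\<int> :: real set" x] by auto

lemma dist_nearest_int_less_1: "dist_nearest_int x < 1"
  using dist_nearest_int_le[of x "\<lfloor>x\<rfloor>"] by linarith

lemma dist_nearest_int_nonneg: "0 \<le> dist_nearest_int x"
  unfolding dist_nearest_int_def by (rule infdist_nonneg)

text \<open>A number \<open>z\<close> strictly between the exponent and \<omega>' has only finitely
  many exceptional \<open>n\<close>, and a small constant \<open>c\<close> absorbs them. The strict
  inequality \<open>w < \<omega>'\<close> is what later yields a positive power of
  \<open>n\<close>.\<close>

lemma simultaneous_exponent_diophantine:
  assumes I: "finite I" "I \<noteq> {}" and \<omega>': "simultaneous_exponent I x < ereal \<omega>'"
  obtains w c where "0 < w" "w < \<omega>'" "0 < c"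
    "\<And>n::nat. 1 \<le> n \<Longrightarrow> \<exists>i\<in>I. \<forall>p. c * real n powr (- w) \<le> \<bar>real n * x i - of_int p\<bar>"
proof -
  define D where "D n = Max ((\<lambda>i. dist_nearest_int (real n * x i)) ` I)" for n :: nat
  define W where "W = {w. infinite {n::nat. 0 < n \<and> D n < real n powr (- w)}}"
  have exponent: "simultaneous_exponent I x = Sup (ereal ` W)"
    unfolding simultaneous_exponent_def W_def D_def ..
  have inf_pos: "infinite {n::nat. 0 < n}"
    using infinite_Ioi[of "0::nat"] by (simp add: greaterThan_def)
  have D_in: "\<exists>i\<in>I. D n = dist_nearest_int (real n * x i)" for n
  proof -
    have "D n \<in> (\<lambda>i. dist_nearest_int (real n * x i)) ` I"
      unfolding D_def by (intro Max_in) (use I in auto)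
    then show ?thesis by blast
  qed
  have D_ge: "dist_nearest_int (real n * x i) \<le> D n" if "i \<in> I" for n i
    unfolding D_def using I that by (intro Max_ge) auto
  \<comment> \<open>The distance to the nearest integer is always below \<open>1 = n powr 0\<close>;
    so the exponent is nonnegative and \<open>z\<close> is positive.\<close>
  have "0 \<in> W"
  proof -
    have "{n::nat. 0 < n \<and> D n < real n powr (- 0)} = {n. 0 < n}"
      using D_in dist_nearest_int_less_1 by (auto simp: powr_zero_eq_one) metis
    then show ?thesis unfolding W_def using inf_pos by simp
  qed
  then have "0 \<le> simultaneous_exponent I x"
    unfolding exponent by (metis Sup_upper imageI zero_ereal_def)
  obtain z where z: "simultaneous_exponent I x < ereal z" "ereal z < ereal \<omega>'"
    using ereal_dense2[OF \<omega>'] by blast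
  have z_pos: "0 < z" using z(1) \<open>0 \<le> simultaneous_exponent I x\<close> by (metis ereal_less(2) le_less_trans)
  have "z \<notin> W"
  proof
    assume "z \<in> W"
    then have "ereal z \<le> simultaneous_exponent I x" unfolding exponent by (intro Sup_upper) auto
    then show False using z(1) by simp
  qed
  then have fin: "finite {n::nat. 0 < n \<and> D n < real n powr (- z)}" (is "finite ?S") by (simp add: W_def)
  \<comment> \<open>If \<open>D n\<close> were 0, all multiples of \<open>n\<close> would be
    exceptional too, contradicting finiteness.\<close>
  have D_pos: "0 < D n" if n: "0 < n" for n
  proof (rule ccontr)
    assume "\<not> 0 < D n"
    then have "dist_nearest_int (real n * x i) = 0" if "i \<in> I" for i
      using D_ge[OF that, of n] dist_nearest_int_nonneg[of "real n * x i"] by linarith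
    then have int: "real n * x i \<in> \<int>" if "i \<in> I" for i
      using that dist_nearest_int_eq_0_iff by blast
    have "D (k * n) = 0" for k
    proof -
      obtain i where "i \<in> I" "D (k * n) = dist_nearest_int (real (k * n) * x i)" using D_in by blast
      moreover have "real k * (real n * x i) \<in> \<int>" by (rule Ints_mult[OF Ints_of_nat int[OF \<open>i \<in> I\<close>]])
      ultimately show ?thesis using dist_nearest_int_eq_0_iff by (simp add: mult.assoc)
    qed
    then have "(\<lambda>k. k * n) ` {0<..} \<subseteq> ?S" using n by auto
    moreover have "infinite ((\<lambda>k. k * n) ` {0<..})"
      using n by (subst finite_image_iff) (auto simp: inj_on_def infinite_Ioi)
    ultimately show False using fin finite_subset by blast
  qed
  \<comment> \<open>The values of \<open>D\<close> handle the exceptional \<open>n\<close>, the 1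
    all others.\<close>
  define c where "c = Min (insert 1 (D ` ?S))"
  have c: "0 < c" "c \<le> 1"
    unfolding c_def using fin D_pos by (auto simp: Min_gr_iff)
  have cD: "c * real n powr (- z) \<le> D n" if n: "1 \<le> n" for n
  proof (cases "n \<in> ?S")
    case True
    then have "c \<le> D n" unfolding c_def using fin by (intro Min_le) auto
    moreover have "real n powr (- z) \<le> 1"
      using n z_pos by (simp add: powr_minus ge_one_powr_ge_zero inverse_le_1_iff)
    ultimately show ?thesis using c mult_left_le[of "real n powr (- z)" c] by linarith
  next
    case False
    then have "real n powr (- z) \<le> D n" using n by auto
    moreover have "c * real n powr (- z) \<le> real n powr (- z)"
      using c by (simp add: mult_left_le_one_le)
    ultimately show ?thesis by linarith
  qed
  show ?thesis
  proof (rule that[of z c])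
    fix n :: nat assume n: "1 \<le> n"
    obtain i where i: "i \<in> I" "D n = dist_nearest_int (real n * x i)" using D_in by blast
    then have "\<forall>p. c * real n powr (- z) \<le> \<bar>real n * x i - of_int p\<bar>"
      using cD[OF n] dist_nearest_int_le by (metis order.trans)
    then show "\<exists>i\<in>I. \<forall>p. c * real n powr (- z) \<le> \<bar>real n * x i - of_int p\<bar>" using i by blast
  qed (use z_pos z c in auto)
qed

text \<open>
  With \<open>Z\<close> the product of the two decay quantities, the lower bound on \<open>d\<close> bounds \<open>q\<close> by a constant
  times \<open>n powr (1 / \<omega>') * Z\<close>; inserted into the Diophantine bound for \<open>L\<close> this bounds
  \<open>Z powr (1 + w)\<close> below by a constant times \<open>n powr (1 - w / \<omega>')\<close>, so \<open>Z\<close> dominates a power of both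
  \<open>n\<close> and \<open>N\<close>.
\<close>
lemma frequency_tradeoff:
  fixes \<omega>' w c c0 a0 a1 :: real and A E :: nat
  assumes w: "0 < w" "w < \<omega>'" and c: "0 < c" "0 < c0" and a: "0 < a0" "0 \<le> a1"
  obtains K :: real and P :: nat where "0 < K"
    "\<And>n q L u d N :: real. 1 \<le> n \<Longrightarrow> 0 \<le> q \<Longrightarrow> 0 \<le> L \<Longrightarrow> 0 \<le> u \<Longrightarrow> c * n powr (- 1 - 1 / \<omega>') \<le> d \<Longrightarrow>
      a0 * q \<le> u + L \<Longrightarrow> (0 < q \<Longrightarrow> c0 * q powr (- w) \<le> L) \<Longrightarrow> (q = 0 \<Longrightarrow> 1 \<le> L) \<Longrightarrow>
      0 \<le> N \<Longrightarrow> N \<le> 1 + L + a1 * q \<Longrightarrow> n ^ A * N ^ E \<le> K * ((1 + n * L) * (1 + n * d * u)) ^ P"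
proof -
  \<comment> \<open>In the application \<open>q\<close> is the size of the first coordinate of
    \<open>m\<close>, \<open>L\<close> the largest
    \<open>\<bar>m $ i - \<alpha> $ i * m $ first_ix\<bar>\<close>, \<open>u\<close> the size of the
    coordinate at which \<open>d\<close> is largest, and \<open>N\<close> exceeds all coordinates.
    The gap between \<open>w\<close> and \<omega>' makes \<delta> positive.\<close>
  define \<delta> where "\<delta> = 1 - w / \<omega>'"
  have \<delta>: "0 < \<delta>" "\<delta> \<le> 1" using w by (auto simp: \<delta>_def field_simps)
  define k where "k = (1 / c + 1) / a0"
  have k: "0 < k" using c a by (simp add: k_def add_pos_pos)
  \<comment> \<open>The minimum with 1 lets the same inequality cover \<open>q = 0\<close>, where
    \<open>1 \<le> L\<close> already gives \<open>n \<le> Z\<close>.\<close>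
  define \<kappa> where "\<kappa> = min 1 (c0 * k powr (- w))"
  have \<kappa>: "0 < \<kappa>" "\<kappa> \<le> 1" "\<kappa> \<le> c0 * k powr (- w)" using c k by (auto simp: \<kappa>_def)
  \<comment> \<open>Solving \<open>\<kappa> * n powr \<delta> \<le> Z powr (1 + w)\<close> for
    \<open>n\<close> gives \<open>k1 * Z powr p\<close>. Inserting this into the bound of
    \<open>N\<close> by a multiple of \<open>n powr (1 / \<omega>') * Z\<close> gives
    \<open>k2 * Z powr e\<close>. As \<open>1 \<le> Z\<close>, the total exponent may be rounded up
    to the natural number \<open>P\<close>.\<close>
  define p where "p = (1 + w) / \<delta>"
  have p: "0 < p" using w \<delta> by (simp add: p_def)
  define k1 where "k1 = (1 / \<kappa>) powr (1 / \<delta>)"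
  have k1: "0 < k1" using \<kappa> by (simp add: k1_def)
  define k2 where "k2 = (2 + a1 * k) * k1 powr (1 / \<omega>')"
  have k2: "0 < k2" using a k k1 by (simp add: k2_def add_pos_nonneg)
  define e where "e = p / \<omega>' + 1"
  define P where "P = nat \<lceil>p * A + e * E\<rceil>"
  define K where "K = k1 ^ A * k2 ^ E"
  have K: "0 < K" using k1 k2 by (simp add: K_def)
  have "n ^ A * N ^ E \<le> K * ((1 + n * L) * (1 + n * d * u)) ^ P"
    if n: "1 \<le> n" and q: "0 \<le> q" and L: "0 \<le> L" and u: "0 \<le> u" and d: "c * n powr (- 1 - 1 / \<omega>') \<le> d"
      and qu: "a0 * q \<le> u + L" and qL: "0 < q \<Longrightarrow> c0 * q powr (- w) \<le> L" and q0: "q = 0 \<Longrightarrow> 1 \<le> L"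
      and N: "0 \<le> N" "N \<le> 1 + L + a1 * q" for n q L u d N :: real
  proof -
    define X where "X = 1 + n * L"
    define Y where "Y = 1 + n * d * u"
    define Z where "Z = X * Y"
    have d0: "0 \<le> d" using order.trans[OF _ d] c by simp
    have X: "1 \<le> X" using n L by (simp add: X_def)
    have Y: "1 \<le> Y" using n u d0 by (simp add: Y_def)
    have Z: "1 \<le> Z" "X \<le> Z" "Y \<le> Z"
      using X Y mult_mono[of 1 X 1 Y] mult_left_mono[of 1 Y X] mult_right_mono[of 1 X Y] by (auto simp: Z_def)
    have n_ge: "1 \<le> n powr (1 / \<omega>')" using n w by (intro ge_one_powr_ge_zero) auto
    have u_le: "u \<le> n powr (1 / \<omega>') * (Y / c)"
    proof -
      have "c * n powr (- (1 / \<omega>')) = n * (c * n powr (- 1 - 1 / \<omega>'))"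
      proof -
        have "n powr (- (1 / \<omega>')) = n powr (1 + (- 1 - 1 / \<omega>'))" by simp
        also have "\<dots> = n * n powr (- 1 - 1 / \<omega>')" using n by (subst powr_add) simp
        finally show ?thesis by simp
      qed
      also have "\<dots> \<le> n * d" using d n by (intro mult_left_mono) auto
      finally have "c * n powr (- (1 / \<omega>')) * u \<le> n * d * u" using u by (rule mult_right_mono)
      also have "\<dots> \<le> Y" by (simp add: Y_def)
      finally show ?thesis using c n by (simp add: powr_minus field_simps)
    qed
    have L_le: "L \<le> X" using n L mult_right_mono[of 1 n L] by (simp add: X_def)
    have q_le: "q \<le> k * (n powr (1 / \<omega>') * Z)"
    proof -
      have "u + L \<le> n powr (1 / \<omega>') * (Z / c) + n powr (1 / \<omega>') * Z"
      proof (rule add_mono)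
        have "n powr (1 / \<omega>') * (Y / c) \<le> n powr (1 / \<omega>') * (Z / c)"
          using Z c by (intro mult_left_mono divide_right_mono) auto
        then show "u \<le> n powr (1 / \<omega>') * (Z / c)" using u_le by linarith
        have "L \<le> 1 * Z" using L_le Z by simp
        also have "\<dots> \<le> n powr (1 / \<omega>') * Z" using n_ge Z by (intro mult_right_mono) auto
        finally show "L \<le> n powr (1 / \<omega>') * Z" .
      qed
      also have "\<dots> = a0 * (k * (n powr (1 / \<omega>') * Z))"
        using a c by (simp add: k_def field_simps)
      finally have "a0 * q \<le> a0 * (k * (n powr (1 / \<omega>') * Z))" using qu by linarith
      then show ?thesis using a by simp
    qed
    have key: "\<kappa> * n powr \<delta> \<le> Z powr (1 + w)"
    proof (cases "q = 0")
      case True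
      have "\<kappa> * n powr \<delta> \<le> 1 * n powr 1"
        using \<kappa> \<delta> n by (intro mult_mono powr_mono) auto
      also have "\<dots> \<le> X"
      proof -
        have "n * 1 \<le> n * L" using q0[OF True] n by (intro mult_left_mono) auto
        then have "n \<le> X" unfolding X_def mult_1_right by (rule order.trans) simp
        then show ?thesis using n by simp
      qed
      also have "\<dots> \<le> Z powr 1" using Z by simp
      also have "\<dots> \<le> Z powr (1 + w)" using Z w by (intro powr_mono) auto
      finally show ?thesis .
    next
      case False
      then have q: "0 < q" using q by simp
      have "\<kappa> * (n powr \<delta> * Z powr (- w)) \<le> c0 * k powr (- w) * (n powr \<delta> * Z powr (- w))"
        using \<kappa> by (intro mult_right_mono) auto
      also have "\<dots> = n * (c0 * (k * (n powr (1 / \<omega>') * Z)) powr (- w))"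
      proof -
        have "(k * (n powr (1 / \<omega>') * Z)) powr (- w) = k powr (- w) * (n powr (1 / \<omega>' * - w) * Z powr (- w))"
          using k n Z by (simp add: powr_mult powr_powr)
        moreover have "n powr \<delta> = n * n powr (1 / \<omega>' * - w)"
        proof -
          have "n powr \<delta> = n powr (1 + 1 / \<omega>' * - w)" by (simp add: \<delta>_def)
          also have "\<dots> = n * n powr (1 / \<omega>' * - w)" using n by (subst powr_add) simp
          finally show ?thesis .
        qed
        ultimately show ?thesis by simp
      qed
      also have "\<dots> \<le> n * (c0 * q powr (- w))"
        using q q_le w c n by (intro mult_left_mono powr_mono2') auto
      also have "\<dots> \<le> n * L" using qL[OF q] n by (intro mult_left_mono) auto
      also have "\<dots> \<le> X" by (simp add: X_def)
      also have "\<dots> \<le> Z" by (rule Z)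
      finally have "\<kappa> * n powr \<delta> \<le> Z * Z powr w"
        using Z by (simp add: powr_minus field_simps)
      also have "\<dots> = Z powr (1 + w)" using Z by (simp add: powr_add)
      finally show ?thesis .
    qed
    have n_le: "n \<le> k1 * Z powr p"
    proof -
      have "n = (n powr \<delta>) powr (1 / \<delta>)" using n \<delta> by (simp add: powr_powr)
      also have "\<dots> \<le> (1 / \<kappa> * Z powr (1 + w)) powr (1 / \<delta>)"
        using key \<kappa> \<delta> by (intro powr_mono2) (auto simp: field_simps)
      also have "\<dots> = k1 * Z powr p"
        using \<kappa> Z by (simp add: powr_mult powr_divide powr_powr k1_def p_def)
      finally show ?thesis .
    qed
    have N_le: "N \<le> k2 * Z powr e"
    proof -
      have "N \<le> Z + Z + a1 * (k * (n powr (1 / \<omega>') * Z))"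
        using N(2) Z(1) L_le Z(2) mult_left_mono[OF q_le a(2)] by linarith
      also have "\<dots> \<le> (2 + a1 * k) * (n powr (1 / \<omega>') * Z)"
        using mult_right_mono[OF n_ge, of Z] Z by (simp add: algebra_simps)
      also have "\<dots> \<le> (2 + a1 * k) * ((k1 * Z powr p) powr (1 / \<omega>') * Z)"
        using n_le n w Z a k by (intro mult_left_mono mult_right_mono powr_mono2) auto
      also have "\<dots> = k2 * Z powr e"
        using k1 Z by (simp add: k2_def e_def powr_mult powr_powr powr_add)
      finally show ?thesis .
    qed
    have "n ^ A * N ^ E \<le> (k1 * Z powr p) ^ A * (k2 * Z powr e) ^ E"
      using n_le N_le n N k1 k2 by (intro mult_mono power_mono) auto
    also have "\<dots> = K * Z powr (p * A + e * E)"
      using Z by (simp add: K_def power_mult_distrib powr_power powr_add mult_ac)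
    also have "\<dots> \<le> K * Z powr (real P)"
      using K Z by (intro mult_left_mono powr_mono) (auto simp: P_def intro: order.trans[OF le_of_int_ceiling])
    also have "\<dots> = K * ((1 + n * L) * (1 + n * d * u)) ^ P"
      using Z by (simp add: powr_realpow Z_def X_def Y_def)
    finally show ?thesis .
  qed
  then show ?thesis using that[of K P] K by blast
qed

section \<open>Comparison of the integrals\<close>

lemma bump_fourier_ratio_le_1:
  assumes "bump_function f"
  shows "norm (fourier_transform f \<xi>) / (LINT x|lborel. f x) \<le> 1"
  using fourier_transform_norm_le[OF bump_function_test_function[OF assms], of \<xi>]
    bump_function_integral_pos[OF assms] bump_function_range(1)[OF assms] by simp

text \<open>Splits off the main term, which leaves ratios of modulus at most 1.\<close>

lemma A_star_coeff_norm:
  fixes d :: "'k::finite \<Rightarrow> real" and n :: nat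
  assumes b: "\<And>j. bump_function (b j)" and d: "\<And>j. 0 < d j"
  shows "norm (A_star_coeff b y d n m) = (\<Prod>j\<in>UNIV. n * d j * (LINT t|lborel. b j t))
    * (\<Prod>j\<in>UNIV. norm (fourier_transform (b j) (n * d j * m $ j)) / (LINT t|lborel. b j t))"
proof -
  have "norm (A_star_coeff b y d n m) = (\<Prod>j\<in>UNIV. n * d j * norm (fourier_transform (b j) (n * d j * m $ j)))"
    using d by (simp add: A_star_coeff_def prod_norm[symmetric] norm_mult abs_of_pos)
  also have "\<dots> = (\<Prod>j\<in>UNIV. (n * d j * (LINT t|lborel. b j t))
      * (norm (fourier_transform (b j) (n * d j * m $ j)) / (LINT t|lborel. b j t)))"
    using bump_function_integral_pos[OF b] by (intro prod.cong) (auto simp: less_imp_neq[symmetric])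
  finally show ?thesis by (simp only: prod.distrib)
qed

text \<open>\<open>frequency_tradeoff\<close> is applied with the power \<open>CARD('k) - 1\<close>
  of \<open>n\<close>, the saving to be proved, and the power \<open>2 * CARD('k)\<close> of
  \<open>N\<close>, two for each coordinate, which yields summable weights. It supplies the order
  \<open>P\<close> to which the decay of both transforms is then used.\<close>

lemma A_star_coeff_mu_fourier_bound:
  fixes \<alpha> :: "real^'k::{finite,wellorder}" and l :: 'k and B r :: "'k \<Rightarrow> real"
    and \<beta> b :: "'k \<Rightarrow> real \<Rightarrow> real" and \<omega>' c :: real
  assumes card: "2 \<le> CARD('k)" and \<alpha>1: "\<alpha> $ first_ix = 1" and \<alpha>l: "\<And>i. i \<le> l \<Longrightarrow> \<alpha> $ i \<noteq> 0"
    and B: "\<And>i. i < last_ix \<Longrightarrow> 0 < B i" and r: "\<And>i. i < last_ix \<Longrightarrow> 0 < r i"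
    and \<beta>: "\<And>i. bump_function (\<beta> i)" and b: "\<And>j. bump_function (b j)"
    and \<omega>': "simultaneous_exponent {first_ix<..} (\<lambda>i. \<alpha> $ i) < ereal \<omega>'" and c: "0 < c"
  obtains C where "0 \<le> C"
    "\<And>\<eta> (R :: real^'k::_^'k::_) t (n::nat) y (d :: 'k \<Rightarrow> real) m. 0 < \<eta> \<Longrightarrow> orthogonal_matrix R \<Longrightarrow>
      R *v axis last_ix 1 = (1 / norm \<alpha>) *\<^sub>R \<alpha> \<Longrightarrow> 1 \<le> n \<Longrightarrow> (\<And>j. 0 < d j) \<Longrightarrow>
      c * real n powr (- 1 - 1 / \<omega>') \<le> Max (d ` {..l}) \<Longrightarrow> m \<noteq> 0 \<Longrightarrow>
      norm (A_star_coeff b y d n m * (LINT x|lborel. vec_char (n *\<^sub>R of_int_vec m) x * of_real (mu B r \<beta> R t \<eta> x)))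
      \<le> (\<Prod>j\<in>UNIV. n * d j * (LINT t|lborel. b j t)) *
        (C / real n ^ (CARD('k) - 1) * (\<Prod>j\<in>UNIV. 1 / (1 + \<bar>real_of_int (m $ j)\<bar>)\<^sup>2))"
proof -
  define f where "f = (first_ix :: 'k)"
  have f_le: "f \<le> i" for i unfolding f_def first_ix_def by simp
  have I: "finite {f<..}" "{f<..} \<noteq> {}"
  proof -
    show "{f<..} \<noteq> {}"
    proof
      assume e: "{f<..} = {}"
      have "i = f" for i using e f_le[of i] by (metis empty_iff greaterThan_iff less_le)
      then have "(UNIV :: 'k set) = {f}" by auto
      then have "CARD('k) = 1" by (metis card_1_singleton_iff One_nat_def)
      then show False using card by simp
    qed
  qed simp
  obtain w c0 where w: "0 < w" "w < \<omega>'" "0 < c0"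
    and dio: "\<And>n::nat. 1 \<le> n \<Longrightarrow> \<exists>i\<in>{f<..}. \<forall>p. c0 * real n powr (- w) \<le> \<bar>real n * \<alpha> $ i - of_int p\<bar>"
    using simultaneous_exponent_diophantine[OF I] \<omega>' unfolding f_def by metis
  define a0 where "a0 = Min ((\<lambda>i. \<bar>\<alpha> $ i\<bar>) ` {..l})"
  have a0: "0 < a0" unfolding a0_def using \<alpha>l by (subst Min_gr_iff) auto
  have a0_le: "a0 \<le> \<bar>\<alpha> $ i\<bar>" if "i \<le> l" for i unfolding a0_def using that by (intro Min_le) auto
  define a1 where "a1 = Max (range (\<lambda>i. \<bar>\<alpha> $ i\<bar>))"
  have a1: "\<bar>\<alpha> $ i\<bar> \<le> a1" for i unfolding a1_def by (intro Max_ge) auto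
  have a1_0: "0 \<le> a1" using a1[of f] by linarith
  obtain K P where K: "0 < K" and trade:
    "\<And>n q L u d N :: real. 1 \<le> n \<Longrightarrow> 0 \<le> q \<Longrightarrow> 0 \<le> L \<Longrightarrow> 0 \<le> u \<Longrightarrow> c * n powr (- 1 - 1 / \<omega>') \<le> d \<Longrightarrow>
      a0 * q \<le> u + L \<Longrightarrow> (0 < q \<Longrightarrow> c0 * q powr (- w) \<le> L) \<Longrightarrow> (q = 0 \<Longrightarrow> 1 \<le> L) \<Longrightarrow>
      0 \<le> N \<Longrightarrow> N \<le> 1 + L + a1 * q \<Longrightarrow>
      n ^ (CARD('k) - 1) * N ^ (2 * CARD('k)) \<le> K * ((1 + n * L) * (1 + n * d * u)) ^ P"
    using frequency_tradeoff[OF w(1,2) c w(3) a0 a1_0, of "CARD('k) - 1" "2 * CARD('k)"] by blast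
  obtain C1 where C1: "0 \<le> C1" and mu_decay:
    "\<And>\<eta> (R :: real^'k::_^'k::_) t \<xi> v. 0 < \<eta> \<Longrightarrow> orthogonal_matrix R \<Longrightarrow> (R *v axis last_ix 1) \<bullet> v = 0 \<Longrightarrow>
      norm (LINT x|lborel. vec_char \<xi> x * of_real (mu B r \<beta> R t \<eta> x))
        \<le> C1 * (1 + CARD('k) * norm v) ^ P / (1 + \<bar>v \<bullet> \<xi>\<bar>) ^ P"
    using mu_fourier_decay[where B = B and r = r and \<beta> = \<beta> and M = P, OF B r \<beta> card] by blast
  define K1 where "K1 = C1 * (1 + CARD('k) * (1 + a1)) ^ P"
  have K1: "0 \<le> K1" using C1 a1_0 by (simp add: K1_def)
  have "\<exists>C. \<forall>\<xi>. norm (fourier_transform (b j) \<xi>) \<le> C / (1 + \<bar>\<xi>\<bar>) ^ P" for j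
    using fourier_transform_decay[OF bump_function_test_function[OF b], of j P] by blast
  then obtain C2 where C2: "\<And>j \<xi>. norm (fourier_transform (b j) \<xi>) \<le> C2 j / (1 + \<bar>\<xi>\<bar>) ^ P"
    by metis
  have C2_0: "0 \<le> C2 j" for j using order.trans[OF norm_ge_zero C2[of j 0]] by simp
  define bI where "bI j = (LINT t|lborel. b j t)" for j
  have bI: "0 < bI j" for j unfolding bI_def by (rule bump_function_integral_pos[OF b])
  define K2 where "K2 = (\<Sum>j\<in>UNIV. C2 j / bI j)"
  have K2_ge: "C2 j / bI j \<le> K2" for j
    unfolding K2_def using C2_0 bI by (intro member_le_sum) (auto intro: divide_nonneg_pos)
  have K2: "0 \<le> K2" using order.trans[OF _ K2_ge[of f]] C2_0 bI by (meson divide_nonneg_pos)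
  define C where "C = K1 * K2 * K"
  have "norm (A_star_coeff b y d n m * (LINT x|lborel. vec_char (n *\<^sub>R of_int_vec m) x * of_real (mu B r \<beta> R t \<eta> x)))
      \<le> (\<Prod>j\<in>UNIV. n * d j * (LINT t|lborel. b j t)) *
        (C / real n ^ (CARD('k) - 1) * (\<Prod>j\<in>UNIV. 1 / (1 + \<bar>real_of_int (m $ j)\<bar>)\<^sup>2))"
    if \<eta>: "0 < \<eta>" and R: "orthogonal_matrix R" "R *v axis last_ix 1 = (1 / norm \<alpha>) *\<^sub>R \<alpha>"
      and n: "1 \<le> n" and d: "\<And>j. 0 < d j" and dmax: "c * real n powr (- 1 - 1 / \<omega>') \<le> Max (d ` {..l})" and m: "m \<noteq> 0"
    for \<eta> and R :: "real^'k::_^'k::_" and t and n :: nat and y and d :: "'k \<Rightarrow> real" and m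
  proof -
    define U where "U = norm (LINT x|lborel. vec_char (n *\<^sub>R of_int_vec m) x * of_real (mu B r \<beta> R t \<eta> x))"
    define V where "V j = norm (fourier_transform (b j) (n * d j * m $ j)) / bI j" for j
    \<comment> \<open>Since the first coordinate of \<alpha> is 1, \<open>m $ f\<close> is the
      multiple of \<alpha> with which \<open>m\<close> is compared.\<close>
    define D where "D i = \<bar>of_int (m $ i) - \<alpha> $ i * of_int (m $ f)\<bar>" for i
    define L where "L = Max (range D)"
    have D_le: "D i \<le> L" for i unfolding L_def by (intro Max_ge) auto
    have "L \<in> range D" unfolding L_def by (intro Max_in) auto
    then obtain i where i: "L = D i" by blast
    have "Max (d ` {..l}) \<in> d ` {..l}" by (intro Max_in) auto
    then obtain j where "j \<le> l" "Max (d ` {..l}) = d j" by (metis imageE atMost_iff)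
    with dmax have j: "j \<le> l" "c * real n powr (- 1 - 1 / \<omega>') \<le> d j" by simp_all
    define q where "q = \<bar>real_of_int (m $ f)\<bar>"
    define u where "u = \<bar>real_of_int (m $ j)\<bar>"
    define N where "N = 1 + L + a1 * q"
    have L0: "0 \<le> L" unfolding i D_def by simp
    have U_le: "U \<le> K1 / (1 + n * L) ^ P"
    proof -
      \<comment> \<open>Orthogonal to \<alpha> because \<open>\<alpha> $ f = 1\<close>, and its
        inner product with \<open>m\<close> has modulus \<open>D i\<close>, which is
        \<open>L\<close>.\<close>
      define v where "v = axis i 1 - (\<alpha> $ i) *\<^sub>R axis f (1::real)"
      have v_inner: "v \<bullet> x = x $ i - \<alpha> $ i * x $ f" for x :: "real^'k::_"
        by (simp add: v_def inner_diff_left inner_axis')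
      have "(R *v axis last_ix 1) \<bullet> v = 0"
        using \<alpha>1 v_inner[of \<alpha>] unfolding R(2) f_def[symmetric] by (simp add: inner_commute)
      from mu_decay[OF \<eta> R(1) this, of "n *\<^sub>R of_int_vec m" t]
      have "U \<le> C1 * (1 + CARD('k) * norm v) ^ P / (1 + \<bar>v \<bullet> (n *\<^sub>R of_int_vec m)\<bar>) ^ P"
        unfolding U_def .
      also have "\<bar>v \<bullet> (n *\<^sub>R of_int_vec m)\<bar> = n * L"
      proof -
        have "v \<bullet> of_int_vec m = of_int (m $ i) - \<alpha> $ i * of_int (m $ f)"
          by (simp add: v_inner)
        then show ?thesis by (simp add: i D_def abs_mult)
      qed
      also have "C1 * (1 + CARD('k) * norm v) ^ P / (1 + n * L) ^ P \<le> K1 / (1 + n * L) ^ P"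
      proof -
        have "norm v \<le> norm (axis i (1::real)) + norm ((\<alpha> $ i) *\<^sub>R axis f (1::real))"
          unfolding v_def by (rule norm_triangle_ineq4)
        also have "\<dots> \<le> 1 + a1" using a1[of i] by simp
        finally show ?thesis
          unfolding K1_def using C1 L0 by (intro divide_right_mono mult_left_mono power_mono add_left_mono) auto
      qed
      finally show ?thesis .
    qed
    have V0: "0 \<le> V k" and V1: "V k \<le> 1" for k
      using bI[of k] bump_fourier_ratio_le_1[OF b] by (auto simp: V_def bI_def)
    \<comment> \<open>Decay is taken only in coordinate \<open>j\<close>, where \<open>d\<close> has
      its lower bound; the remaining ratios are bounded by 1.\<close>
    have prodV: "prod V UNIV \<le> K2 / (1 + n * d j * u) ^ P"
    proof -
      have "prod V UNIV = V j * prod V (UNIV - {j})" by (rule prod.remove) auto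
      also have "\<dots> \<le> V j * 1" by (intro mult_left_mono prod_le_1) (auto simp: V0 V1)
      also have "V j \<le> (C2 j / (1 + \<bar>n * d j * m $ j\<bar>) ^ P) / bI j"
        unfolding V_def using C2 bI[of j] by (intro divide_right_mono) auto
      also have "\<dots> = (C2 j / bI j) / (1 + n * d j * u) ^ P"
        using d[of j] by (simp add: u_def abs_mult)
      also have "\<dots> \<le> K2 / (1 + n * d j * u) ^ P"
        using K2_ge d[of j] by (intro divide_right_mono) (auto simp: u_def)
      finally show ?thesis by simp
    qed
    have tr: "real n ^ (CARD('k) - 1) * N ^ (2 * CARD('k)) \<le> K * ((1 + n * L) * (1 + n * d j * u)) ^ P"
    proof (rule trade)
      show "a0 * q \<le> u + L"
      proof -
        have "a0 * q \<le> \<bar>\<alpha> $ j\<bar> * q" using a0_le[OF j(1)] by (intro mult_right_mono) (auto simp: q_def)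
        also have "\<dots> = \<bar>\<alpha> $ j * of_int (m $ f)\<bar>" by (simp add: q_def abs_mult)
        also have "\<dots> \<le> u + D j" unfolding u_def D_def by linarith
        finally show ?thesis using D_le[of j] by linarith
      qed
      show "c0 * q powr (- w) \<le> L" if "0 < q"
      proof -
        have q: "real (nat \<bar>m $ f\<bar>) = q" by (simp add: q_def)
        have "1 \<le> nat \<bar>m $ f\<bar>" using that by (simp add: q_def)
        from dio[OF this] obtain i' where i': "\<And>p. c0 * q powr (- w) \<le> \<bar>q * \<alpha> $ i' - of_int p\<bar>"
          unfolding q by blast
        have "c0 * q powr (- w) \<le> D i'"
        \<comment> \<open>The Diophantine bound speaks of the natural number \<open>q\<close>; a
          negative \<open>m $ f\<close> is handled by changing the sign of the integer
          \<open>p\<close>.\<close>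
        proof (cases "0 \<le> m $ f")
          case True
          then show ?thesis using i'[of "m $ i'"] by (simp add: D_def q_def mult.commute abs_minus_commute)
        next
          case False
          then show ?thesis using i'[of "- m $ i'"] by (simp add: D_def q_def mult.commute)
        qed
        then show ?thesis using D_le[of i'] by linarith
      qed
      show "1 \<le> L" if "q = 0"
      proof -
        have mf: "m $ f = 0" using that by (simp add: q_def)
        obtain i' where "m $ i' \<noteq> 0" using m by (auto simp: vec_eq_iff)
        then have "1 \<le> D i'" using mf by (simp add: D_def)
        then show ?thesis using D_le[of i'] by linarith
      qed
      show "0 \<le> N" unfolding N_def using L0 a1_0 by (simp add: q_def)
    qed (use n L0 j in \<open>auto simp: q_def u_def N_def\<close>)
    have N1: "1 + \<bar>real_of_int (m $ k)\<bar> \<le> N" for k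
    proof -
      have "\<bar>real_of_int (m $ k)\<bar> \<le> D k + \<bar>\<alpha> $ k * of_int (m $ f)\<bar>" unfolding D_def by linarith
      also have "\<bar>\<alpha> $ k * of_int (m $ f)\<bar> \<le> a1 * q"
        using a1[of k] by (auto simp: abs_mult q_def intro!: mult_right_mono)
      finally show ?thesis using D_le[of k] by (simp add: N_def)
    qed
    have W: "1 / N ^ (2 * CARD('k)) \<le> (\<Prod>j\<in>UNIV. 1 / (1 + \<bar>real_of_int (m $ j)\<bar>)\<^sup>2)"
    proof -
      have "1 / N ^ (2 * CARD('k)) = (\<Prod>j\<in>(UNIV :: 'k set). 1 / N\<^sup>2)"
        by (simp add: power_mult power_one_over)
      also have "\<dots> \<le> (\<Prod>j\<in>UNIV. 1 / (1 + \<bar>real_of_int (m $ j)\<bar>)\<^sup>2)"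
      proof (intro prod_mono conjI)
        fix k
        have "(1 + \<bar>real_of_int (m $ k)\<bar>)\<^sup>2 \<le> N\<^sup>2" using N1[of k] by (intro power_mono) auto
        then show "1 / N\<^sup>2 \<le> 1 / (1 + \<bar>real_of_int (m $ k)\<bar>)\<^sup>2"
          using N1[of k] by (intro divide_left_mono) (auto intro!: mult_pos_pos zero_less_power)
      qed simp
      finally show ?thesis .
    qed
    have N_pos: "0 < N" using N1[of f] by linarith
    define Q where "Q = ((1 + n * L) * (1 + n * d j * u)) ^ P"
    have Q_pos: "0 < Q"
      unfolding Q_def using n L0 d[of j] by (intro zero_less_power mult_pos_pos add_pos_nonneg) (auto simp: u_def)
    have "prod V UNIV * U \<le> (K2 / (1 + n * d j * u) ^ P) * (K1 / (1 + n * L) ^ P)"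
      using prodV U_le V0 K2 d[of j] by (intro mult_mono) (auto simp: U_def u_def)
    also have "\<dots> = K1 * K2 / Q"
      by (simp add: Q_def power_mult_distrib mult_ac)
    also have "\<dots> \<le> K1 * K2 * (K / (real n ^ (CARD('k) - 1) * N ^ (2 * CARD('k))))"
    proof -
      have "1 / Q \<le> K / (real n ^ (CARD('k) - 1) * N ^ (2 * CARD('k)))"
        using tr Q_pos N_pos n unfolding Q_def[symmetric] by (simp add: field_simps)
      from mult_left_mono[OF this, of "K1 * K2"] show ?thesis using K1 K2 by simp
    qed
    also have "\<dots> = C / real n ^ (CARD('k) - 1) * (1 / N ^ (2 * CARD('k)))"
      by (simp add: C_def)
    also have "\<dots> \<le> C / real n ^ (CARD('k) - 1) * (\<Prod>j\<in>UNIV. 1 / (1 + \<bar>real_of_int (m $ j)\<bar>)\<^sup>2)"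
      using K1 K2 K by (intro mult_left_mono W) (auto simp: C_def)
    finally have "(\<Prod>j\<in>UNIV. n * d j * bI j) * (prod V UNIV * U) \<le> (\<Prod>j\<in>UNIV. n * d j * bI j) *
        (C / real n ^ (CARD('k) - 1) * (\<Prod>j\<in>UNIV. 1 / (1 + \<bar>real_of_int (m $ j)\<bar>)\<^sup>2))"
      by (rule mult_left_mono) (intro prod_nonneg ballI mult_nonneg_nonneg less_imp_le[OF d] less_imp_le[OF bI] of_nat_0_le_iff)
    then show ?thesis
      unfolding norm_mult A_star_coeff_norm[where b = b and d = d, OF b d] U_def V_def bI_def by (simp only: mult.assoc)
  qed
  note bound = this
  have "0 \<le> C" using K1 K2 K by (simp add: C_def)
  then show ?thesis by (rule that) (rule bound)
qed

text \<open>The order of the quantifiers encodes the dependence of the constants: \<open>C\<close>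
  comes after the bump functions, \<omega>' (the \<varpi> of the English statement) and the constant
  \<open>c\<close> of the lower bound on \<open>d\<close>, but before \<eta>, the rigid motion,
  \<open>n\<close>, \<open>y\<close> and \<open>d\<close>. \<open>E\<close> is the relative
  error.\<close>

theorem mainTheorem8:
  fixes \<alpha> :: "real^'k::{finite,wellorder}" and l :: 'k and B r :: "'k \<Rightarrow> real"
  assumes "CARD('k) \<ge> 2"
    and "\<alpha> $ first_ix = 1"
    and "\<forall>i\<le>l. \<alpha> $ i \<noteq> 0"
    and "\<forall>i>l. \<alpha> $ i = 0"
    and "simultaneous_exponent {first_ix<..} (\<lambda>i. \<alpha> $ i) < \<infinity>"
    and "\<forall>i<last_ix. 0 < B i"
    and "\<forall>i<last_ix. 0 < r i"
  shows "\<exists>\<eta>0>0. \<forall>(\<beta> :: 'k \<Rightarrow> real \<Rightarrow> real) (b :: 'k \<Rightarrow> real \<Rightarrow> real) (\<omega>' :: real) (c :: real).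
    (\<forall>i. bump_function (\<beta> i)) \<and> (\<forall>j. bump_function (b j)) \<and>
    simultaneous_exponent {first_ix<..} (\<lambda>i. \<alpha> $ i) < ereal \<omega>' \<and> 0 < c \<longrightarrow>
    (\<exists>C. \<forall>(\<eta> :: real) (H :: (real^'k::_) set) (h :: real) (R :: real^'k::_^'k::_) (t :: real^'k::_)
          (n :: nat) (y :: real^'k::_) (d :: 'k \<Rightarrow> real).
      0 < \<eta> \<and> \<eta> \<le> \<eta>0 \<and>
      H = {x. \<alpha> \<bullet> x = h} \<and>
      rotation_matrix R \<and> (\<lambda>x. R *v x) ` {x. x $ last_ix = 0} = {x. \<alpha> \<bullet> x = 0} \<and>
      R *v axis last_ix 1 = (1 / norm \<alpha>) *\<^sub>R \<alpha> \<and>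
      (\<lambda>x. x + t) ` {x. \<alpha> \<bullet> x = 0} = H \<and>
      1 \<le> n \<and> (\<forall>j. 0 < d j \<and> d j \<le> 1 / (2 * real n)) \<and>
      Max (d ` {..l}) \<ge> c * real n powr (- 1 - 1 / \<omega>')
      \<longrightarrow>
      (\<exists>E. \<bar>E\<bar> \<le> C * real n powr (1 - real CARD('k)) \<and>
        (LINT x:cbox 0 1|lborel. A_star b y d n x * periodisation (mu B r \<beta> R t \<eta>) x) =
        (LINT x:cbox 0 1|lborel. A_star b y d n x) * (1 + E)))"
proof (rule exI[of _ 1], intro conjI allI impI)
  fix \<beta> b :: "'k \<Rightarrow> real \<Rightarrow> real" and \<omega>' c :: real
  assume asm: "(\<forall>i. bump_function (\<beta> i)) \<and> (\<forall>j. bump_function (b j)) \<and>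
    simultaneous_exponent {first_ix<..} (\<lambda>i. \<alpha> $ i) < ereal \<omega>' \<and> 0 < c"
  then have \<beta>: "\<And>i. bump_function (\<beta> i)" and b: "\<And>j. bump_function (b j)" by auto
  have B: "\<And>i. i < last_ix \<Longrightarrow> 0 < B i" and r: "\<And>i. i < last_ix \<Longrightarrow> 0 < r i" using assms by auto
  obtain C where C: "0 \<le> C" and bound:
    "\<And>\<eta> (R :: real^'k::_^'k::_) t (n::nat) y (d :: 'k \<Rightarrow> real) m. 0 < \<eta> \<Longrightarrow> orthogonal_matrix R \<Longrightarrow>
      R *v axis last_ix 1 = (1 / norm \<alpha>) *\<^sub>R \<alpha> \<Longrightarrow> 1 \<le> n \<Longrightarrow> (\<And>j. 0 < d j) \<Longrightarrow>
      c * real n powr (- 1 - 1 / \<omega>') \<le> Max (d ` {..l}) \<Longrightarrow> m \<noteq> 0 \<Longrightarrow>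
      norm (A_star_coeff b y d n m * (LINT x|lborel. vec_char (n *\<^sub>R of_int_vec m) x * of_real (mu B r \<beta> R t \<eta> x)))
      \<le> (\<Prod>j\<in>UNIV. n * d j * (LINT t|lborel. b j t)) *
        (C / real n ^ (CARD('k) - 1) * (\<Prod>j\<in>UNIV. 1 / (1 + \<bar>real_of_int (m $ j)\<bar>)\<^sup>2))"
    using A_star_coeff_mu_fourier_bound[of \<alpha> l B r \<beta> b \<omega>' c] assms asm by blast
  define W where "W m = (\<Prod>j\<in>UNIV. 1 / (1 + \<bar>real_of_int (m $ j)\<bar>)\<^sup>2)" for m :: "int^'k::_"
  have W_sum: "W summable_on UNIV"
  proof -
    have "(\<lambda>m::int^'k::_. norm (\<Prod>j\<in>UNIV. 1 / (1 + \<bar>real_of_int (m $ j)\<bar>)\<^sup>2)) summable_on UNIV"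
      by (rule vec_prod_norm_summable) (use summable_on_int_inverse_square in simp)
    moreover have "norm (W m) = W m" for m unfolding W_def by (simp add: prod_nonneg)
    ultimately show ?thesis by (simp flip: W_def)
  qed
  show "\<exists>C. \<forall>(\<eta> :: real) (H :: (real^'k::_) set) (h :: real) (R :: real^'k::_^'k::_) (t :: real^'k::_)
          (n :: nat) (y :: real^'k::_) (d :: 'k \<Rightarrow> real).
      0 < \<eta> \<and> \<eta> \<le> 1 \<and>
      H = {x. \<alpha> \<bullet> x = h} \<and>
      rotation_matrix R \<and> (\<lambda>x. R *v x) ` {x. x $ last_ix = 0} = {x. \<alpha> \<bullet> x = 0} \<and>
      R *v axis last_ix 1 = (1 / norm \<alpha>) *\<^sub>R \<alpha> \<and>
      (\<lambda>x. x + t) ` {x. \<alpha> \<bullet> x = 0} = H \<and>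
      1 \<le> n \<and> (\<forall>j. 0 < d j \<and> d j \<le> 1 / (2 * real n)) \<and>
      Max (d ` {..l}) \<ge> c * real n powr (- 1 - 1 / \<omega>')
      \<longrightarrow>
      (\<exists>E. \<bar>E\<bar> \<le> C * real n powr (1 - real CARD('k)) \<and>
        (LINT x:cbox 0 1|lborel. A_star b y d n x * periodisation (mu B r \<beta> R t \<eta>) x) =
        (LINT x:cbox 0 1|lborel. A_star b y d n x) * (1 + E))"
  \<comment> \<open>The constant is the termwise bound summed over all nonzero frequencies;
    \<open>W\<close> depends on none of the parameters.\<close>
  proof (rule exI[of _ "C * infsum W (UNIV - {0})"], intro allI impI)
    fix \<eta> :: real and H :: "(real^'k::_) set" and h :: real and R :: "real^'k::_^'k::_"
      and t :: "real^'k::_" and n :: nat and y :: "real^'k::_" and d :: "'k \<Rightarrow> real"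
    assume hyp: "0 < \<eta> \<and> \<eta> \<le> 1 \<and>
      H = {x. \<alpha> \<bullet> x = h} \<and>
      rotation_matrix R \<and> (\<lambda>x. R *v x) ` {x. x $ last_ix = 0} = {x. \<alpha> \<bullet> x = 0} \<and>
      R *v axis last_ix 1 = (1 / norm \<alpha>) *\<^sub>R \<alpha> \<and>
      (\<lambda>x. x + t) ` {x. \<alpha> \<bullet> x = 0} = H \<and>
      1 \<le> n \<and> (\<forall>j. 0 < d j \<and> d j \<le> 1 / (2 * real n)) \<and>
      Max (d ` {..l}) \<ge> c * real n powr (- 1 - 1 / \<omega>')"
    then have \<eta>: "0 < \<eta>" and R: "orthogonal_matrix R" and n: "1 \<le> n" and d: "\<And>j. 0 < d j"
      by (auto simp: rotation_matrix_def)
    define \<mu> where "\<mu> = mu B r \<beta> R t \<eta>"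
    have \<mu>_int: "integrable lborel \<mu>" unfolding \<mu>_def by (rule mu_integrable[where B = B and r = r and \<beta> = \<beta>, OF B r \<beta> \<eta> R])
    obtain K where K: "\<And>x. K < norm x \<Longrightarrow> \<mu> x = 0"
      using mu_bounded_support[where B = B and r = r and \<beta> = \<beta>, OF B r \<beta> \<eta> R] unfolding \<mu>_def by blast
    note tb = bump_function_test_function[OF b]
    define F where "F m = A_star_coeff b y d n m * (LINT x|lborel. vec_char (n *\<^sub>R of_int_vec m) x * of_real (\<mu> x))" for m
    define I where "I = (LINT x:cbox 0 1|lborel. A_star b y d n x * periodisation \<mu> x)"
    define \<Lambda> where "\<Lambda> = (LINT x:cbox 0 1|lborel. A_star b y d n x)"
    have \<Lambda>: "\<Lambda> = (\<Prod>j\<in>UNIV. n * d j * (LINT t|lborel. b j t))"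
      unfolding \<Lambda>_def by (rule A_star_unit_cube_integral[where b = b and d = d, OF tb d n])
    have \<Lambda>_pos: "0 < \<Lambda>"
      unfolding \<Lambda> using n d bump_function_integral_pos[OF b] by (intro prod_pos) auto
    have I_eq: "I = (LINT x|lborel. A_star b y d n x * \<mu> x)"
      unfolding I_def by (rule A_star_periodisation_integral[where b = b and d = d, OF tb d n \<mu>_int K])
    have F_sum: "(F has_sum of_real I) UNIV"
      unfolding F_def I_eq
      by (rule A_star_integral_has_sum(1)[where b = b and d = d, OF tb d n \<mu>_int])
    \<comment> \<open>Total mass 1 of \<open>mu\<close> makes the term of frequency 0 equal to the
      main term \<Lambda>.\<close>
    have "(LINT x|lborel. vec_char 0 x * complex_of_real (\<mu> x)) = 1"
      using mu_integral[where B = B and r = r and \<beta> = \<beta>, OF B r \<beta> \<eta> R, of t] by (simp add: vec_char_def \<mu>_def)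
    moreover have "of_int_vec (0 :: int^'k::_) = 0" by (simp add: vec_eq_iff)
    ultimately have F0: "F 0 = of_real \<Lambda>"
      unfolding F_def by (simp add: \<Lambda> A_star_coeff_def fourier_transform_0)
    define S where "S = \<Lambda> * C / real n ^ (CARD('k) - 1)"
    have F_bound: "norm (F m) \<le> S * W m" if "m \<noteq> 0" for m
    proof -
      have "norm (F m) \<le> \<Lambda> * (C / real n ^ (CARD('k) - 1) * W m)"
        unfolding F_def W_def \<Lambda> \<mu>_def by (rule bound[OF \<eta> R _ n _ _ that]) (use hyp in auto)
      then show ?thesis by (simp add: S_def)
    qed
    have SW: "(\<lambda>m. S * W m) summable_on (UNIV - {0})"
      by (intro summable_on_cmult_right summable_on_subset_banach[OF W_sum]) auto
    have F_norm: "(\<lambda>m. norm (F m)) summable_on (UNIV - {0})"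
      by (rule Infinite_Sum.abs_summable_on_comparison_test'[OF SW]) (use F_bound in auto)
    have "of_real I - F 0 = infsum F (UNIV - {0})"
      using infsum_Diff[of F UNIV "{0}"] F_sum by (auto simp: has_sum_iff)
    also have "norm \<dots> \<le> infsum (\<lambda>m. norm (F m)) (UNIV - {0})"
      by (rule norm_infsum_bound[OF F_norm])
    also have "\<dots> \<le> infsum (\<lambda>m. S * W m) (UNIV - {0})"
      by (rule infsum_mono[OF F_norm SW]) (use F_bound in auto)
    also have "\<dots> = S * infsum W (UNIV - {0})" by (rule infsum_cmult_right')
    finally have diff: "\<bar>I - \<Lambda>\<bar> \<le> S * infsum W (UNIV - {0})"
      unfolding F0 by (simp flip: of_real_diff)
    have n_powr: "real n powr (1 - real CARD('k)) = 1 / real n ^ (CARD('k) - 1)"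
    proof -
      have e: "1 - real CARD('k) = - real (CARD('k) - 1)"
        using assms(1) by (simp add: of_nat_diff)
      have "real n powr real (CARD('k) - 1) = real n ^ (CARD('k) - 1)"
        using n by (intro powr_realpow) simp
      then show ?thesis unfolding e powr_minus by (simp only: inverse_eq_divide)
    qed
    show "\<exists>E. \<bar>E\<bar> \<le> C * infsum W (UNIV - {0}) * real n powr (1 - real CARD('k)) \<and>
        (LINT x:cbox 0 1|lborel. A_star b y d n x * periodisation (mu B r \<beta> R t \<eta>) x) =
        (LINT x:cbox 0 1|lborel. A_star b y d n x) * (1 + E)"
    \<comment> \<open>The relative error is well defined because \<Lambda> is positive, and the
      factor \<Lambda> in \<open>S\<close> cancels.\<close>
    proof (intro exI[of _ "(I - \<Lambda>) / \<Lambda>"] conjI)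
      have "\<bar>(I - \<Lambda>) / \<Lambda>\<bar> \<le> S * infsum W (UNIV - {0}) / \<Lambda>"
        using diff \<Lambda>_pos by (simp add: divide_right_mono)
      then show "\<bar>(I - \<Lambda>) / \<Lambda>\<bar> \<le> C * infsum W (UNIV - {0}) * real n powr (1 - real CARD('k))"
        using \<Lambda>_pos by (simp add: S_def n_powr)
      show "(LINT x:cbox 0 1|lborel. A_star b y d n x * periodisation (mu B r \<beta> R t \<eta>) x) =
        (LINT x:cbox 0 1|lborel. A_star b y d n x) * (1 + (I - \<Lambda>) / \<Lambda>)"
        using \<Lambda>_pos unfolding \<mu>_def[symmetric] I_def[symmetric] \<Lambda>_def[symmetric] by (simp add: field_simps)
    qed
  qed
qed simp

end
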